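(* Let $\alpha\in[0,1]$ and let $\varepsilon=(\varepsilon_n)_{n\ge1}$ be a sequence in $(0,1)$ that is regularly varying with index $-\alpha$; if $\alpha=0$, assume in addition that $\lim_{n\to\infty}\varepsilon_n=0$; if $\alpha=1$, assume in addition that $\lim_{n\to\infty} n\varepsilon_n/\log n=\infty$. Let $X=(X_n)_{n\ge0}$ be the random walk with drift sequence $\varepsilon$ under $P$. Then, as $n\to\infty$, $X_n/b_n$ converges in distribution to a random variable with density $e^{-2|x|}$, $x\in(-\infty,\infty)$.
   Context: The walk: under $P$, $X_0=0$, $\eta_0=1$, and $\eta_n=\eta_0+\#\{i\in(0,n]: X_i=0\}$ for $n\ge1$. The pair $(X_n,\eta_n)_{n\ge 0}$ is a Markov chain with $|X_{n+1}-X_n|=1$ and: given $X_n=0$, $X_{n+1}=\pm1$ with probability $\frac12$ each; given $X_n=i\neq 0$ and $\eta_n=m$, $X_{n+1}=i+1$ with probability $\frac12(1-\mathrm{sign}(i)\varepsilon_m)$ and $X_{n+1}=i-1$ with probability $\frac12(1+\mathrm{sign}(i)\varepsilon_m)$. A sequence $(r_n)_{n\ge1}$ of positive reals is regularly varying with index $\rho\in\mathbb{R}$ if $r_n=n^\rho\ell_n$ where $\lim_{n\to\infty}\ell_{[\lambda n]}/\ell_n=1$ for every $\lambda>0$ ($[x]$ is the integer part of $x$). $a_n=n+\sum_{i=1}^n\frac1{\varepsilon_i}$, $c_n=\min\{i\in\mathbb{N}: a_i\ge n\}$, $b_n=1/\varepsilon_{c_n}$. *)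

theory Defs
  imports "HOL-Probability.Probability"
begin

(* Sequences are functions on nat of which only the entries with index n >= 1 matter.  The value
   at 0 does not affect the limit below, since nat (floor (t * n)) = 0 for finitely many n only. *)
definition regularly_varying :: "(nat \<Rightarrow> real) \<Rightarrow> real \<Rightarrow> bool" where
  "regularly_varying r \<rho> \<longleftrightarrow>
     (\<forall>n\<ge>1. r n > 0) \<and>
     (\<exists>l. (\<forall>n\<ge>1. r n = real n powr \<rho> * l n) \<and>
          (\<forall>t>0. (\<lambda>n. l (nat \<lfloor>t * real n\<rfloor>) / l n) \<longlonglongrightarrow> 1))"

definition a_seq :: "(nat \<Rightarrow> real) \<Rightarrow> nat \<Rightarrow> real" where
  "a_seq \<epsilon> n = real n + (\<Sum>i=1..n. 1 / \<epsilon> i)"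

(* For n >= 1 the constraint i >= 1 is redundant, since a_seq \<epsilon> 0 = 0. *)
definition c_seq :: "(nat \<Rightarrow> real) \<Rightarrow> nat \<Rightarrow> nat" where
  "c_seq \<epsilon> n = (LEAST i. 1 \<le> i \<and> a_seq \<epsilon> i \<ge> real n)"

definition b_seq :: "(nat \<Rightarrow> real) \<Rightarrow> nat \<Rightarrow> real" where
  "b_seq \<epsilon> n = 1 / \<epsilon> (c_seq \<epsilon> n)"

definition is_markov_chain :: "'w measure \<Rightarrow> ('s \<Rightarrow> 's pmf) \<Rightarrow> (nat \<Rightarrow> 'w \<Rightarrow> 's) \<Rightarrow> bool" where
  "is_markov_chain M K Y \<longleftrightarrow>
     prob_space M \<and>
     (\<forall>n. Y n \<in> measurable M (count_space UNIV)) \<and>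
     (\<forall>n s t. \<P>(\<omega> in M. \<forall>k\<le>n. Y k \<omega> = s k) > 0 \<longrightarrow>
        \<P>(\<omega> in M. Y (Suc n) \<omega> = t \<bar> \<forall>k\<le>n. Y k \<omega> = s k) = pmf (K (s n)) t)"

definition eta :: "(nat \<Rightarrow> 'w \<Rightarrow> int) \<Rightarrow> nat \<Rightarrow> 'w \<Rightarrow> nat" where
  "eta X n \<omega> = 1 + card {i \<in> {0<..n}. X i \<omega> = 0}"

definition up_prob :: "(nat \<Rightarrow> real) \<Rightarrow> int \<Rightarrow> nat \<Rightarrow> real" where
  "up_prob \<epsilon> i m = (if i = 0 then 1 / 2 else (1 - real_of_int (sgn i) * \<epsilon> m) / 2)"

(* The second component, the value of eta, increases by 1 exactly when the walk arrives at 0. *)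
definition drift_kernel :: "(nat \<Rightarrow> real) \<Rightarrow> int \<times> nat \<Rightarrow> (int \<times> nat) pmf" where
  "drift_kernel \<epsilon> = (\<lambda>(i, m).
     map_pmf (\<lambda>up. let j = (if up then i + 1 else i - 1) in (j, if j = 0 then m + 1 else m))
       (bernoulli_pmf (up_prob \<epsilon> i m)))"

definition drift_walk :: "'w measure \<Rightarrow> (nat \<Rightarrow> real) \<Rightarrow> (nat \<Rightarrow> 'w \<Rightarrow> int) \<Rightarrow> bool" where
  "drift_walk M \<epsilon> X \<longleftrightarrow>
     is_markov_chain M (drift_kernel \<epsilon>) (\<lambda>n \<omega>. (X n \<omega>, eta X n \<omega>)) \<and>
     (AE \<omega> in M. X 0 \<omega> = 0)"

end

theory Submission
  imports Defs
begin

text \<open>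
  The steps of the walk from \<open>0\<close> are symmetric, and so are its drifts towards \<open>0\<close>. Hence the law of
  \<open>X n\<close> is symmetric and its characteristic function at \<open>s / b\<close> is the mean of \<open>cos (s * X n / b)\<close>,
  which depends only on the reflected walk \<open>\<bar>X\<bar>\<close>. During an excursion with drift \<open>e\<close>, the reflected
  walk moves like a birth-death chain whose stationary law, on the scale \<open>1 / e\<close>, is close to the
  exponential law with rate \<open>2\<close>; its symmetrization has the density \<open>exp (- 2 * \<bar>x\<bar>)\<close>. The theorem
  says that at time \<open>n\<close> the walk has nearly reached the stationary law that belongs to the excursion
  with number \<open>c_seq \<epsilon> n\<close>. Two estimates show this.

  \<^bold>\<open>Counting excursions.\<close> An excursion with drift \<open>e\<close> lasts \<open>1 + 1 / e\<close> steps on average, and from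
  height \<open>x\<close> it takes another \<open>x / e\<close> steps to return. So \<open>a_seq\<close> at the current excursion number,
  minus the expected remaining time of the current excursion, is a clock that advances by \<open>1\<close> per
  step on average. The deviation of the clock from the true time is a martingale with increments of
  variance at most \<open>B\<^sup>2\<close>, where \<open>B\<close> bounds the reciprocals of the relevant drifts, and Chebyshev's
  inequality (lemmas \<open>prob_many_excursions\<close>, \<open>prob_few_excursions\<close>, \<open>prob_clock_late\<close>) gives errors
  of order \<open>B\<^sup>2 / n\<close>. Regular variation, together with \<open>n * \<epsilon> n \<rightarrow> \<infinity>\<close>, makes \<open>B\<^sup>2\<close> small compared with \<open>n\<close>
  (lemma \<open>inverse_drift_bound\<close>), and it shows that the drifts of the excursions visited during the
  last stretch of the time interval agree up to a factor close to \<open>1\<close> (lemma \<open>excursion_window\<close>).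

  \<^bold>\<open>Forgetting the past.\<close> During the last stretch, whose length is a small multiple of \<open>n\<close>, the walk is
  compared with the walk of constant drift \<open>\<epsilon> = \<epsilon> (c_seq \<epsilon> n)\<close>. For constant drift the differences
  \<open>u (x + 2) - u x\<close> of a function averaged over \<open>k\<close> steps decay like \<open>(1 - \<epsilon>\<^sup>2 / 2) ^ k\<close>, with a weight
  \<open>(1 + \<epsilon>) ^ x\<close>; the step \<open>2\<close> respects the periodicity of the walk. This decay beats the accumulated
  effect of the small relative error in the drift (lemma \<open>frozen_drift_comparison\<close>) and it shows that
  the starting point is forgotten (lemma \<open>const_step_pow_oscillation\<close>). The value to which
  the mean of the cosine settles is read off from an explicit solution of the Poisson equation
  (lemma \<open>poisson_equation_cos\<close>), and it tends to the Fourier transform \<open>4 / (4 + s\<^sup>2)\<close> of the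
  limit density as \<open>\<epsilon> \<rightarrow> 0\<close>.

  All probabilities are expressed by iterating the one-step averaging operator \<open>avg_step\<close> on
  functions of the pair (height, number of completed excursions), so that both estimates are
  inductions over the number of steps. Levy's continuity theorem concludes the proof.
\<close>


section \<open>Uniform convergence and power bounds for regularly varying sequences\<close>

text \<open>
  The pointwise limit is uniform over \<open>m\<close> between \<open>n / 2\<close> and \<open>n\<close>. If it were not, there would be
  indices \<open>n N\<close> and \<open>m N\<close> of this kind, tending to infinity, at which \<open>ln (l (m N))\<close> and
  \<open>ln (l (n N))\<close> stay apart. The multipliers \<open>t\<close> for which \<open>l\<close> has settled at \<open>t * n N\<close>
  fill most of \<open>{1..4}\<close> in measure, and the multipliers \<open>t'\<close> for which it has settled at
  \<open>t' * m N\<close> fill most of \<open>{1..8}\<close>. Therefore some pair satisfies \<open>t * n N = t' * m N\<close>, and both values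
  are compared with \<open>l\<close> at the same integer.
\<close>
lemma slowly_varying_uniform:
  fixes l :: "nat \<Rightarrow> real"
  assumes pos: "\<And>n. n \<ge> 1 \<Longrightarrow> l n > 0"
    and lim: "\<And>t. t > 0 \<Longrightarrow> (\<lambda>n. l (nat \<lfloor>t * real n\<rfloor>) / l n) \<longlonglongrightarrow> 1"
    and d: "d > 0"
  shows "\<exists>N\<ge>1. \<forall>n\<ge>N. \<forall>m. n \<le> 2 * m \<and> m \<le> n \<longrightarrow> \<bar>ln (l m) - ln (l n)\<bar> \<le> d"
proof (rule ccontr)
  assume neg: "\<not> ?thesis"
  define h where "h n = ln (l n)" for n
  have "\<forall>N. \<exists>n m. n \<ge> Suc N \<and> n \<le> 2 * m \<and> m \<le> n \<and> \<bar>h m - h n\<bar> > d"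
    using neg unfolding h_def not_ex not_all not_le by (metis One_nat_def Suc_le_mono le0 not_le)
  then obtain n m where nm: "\<And>N. n N \<ge> Suc N" "\<And>N. n N \<le> 2 * m N" "\<And>N. m N \<le> n N"
    "\<And>N. \<bar>h (m N) - h (n N)\<bar> > d" by metis
  have n_lim: "filterlim n at_top sequentially"
    unfolding filterlim_at_top eventually_sequentially using nm(1)
    by (metis Suc_leD order_trans)
  have m_lim: "filterlim m at_top sequentially"
    unfolding filterlim_at_top eventually_sequentially
  proof
    fix Z
    have "Z \<le> m N" if "N \<ge> 2 * Z" for N using nm(1,2)[of N] that by linarith
    then show "\<exists>N. \<forall>n\<ge>N. Z \<le> m n" by blast
  qed
  have hlim: "(\<lambda>k. h (nat \<lfloor>t * real k\<rfloor>) - h k) \<longlonglongrightarrow> 0" if t: "t > 0" for t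
  proof -
    have "(\<lambda>k. ln (l (nat \<lfloor>t * real k\<rfloor>) / l k)) \<longlonglongrightarrow> ln 1"
      using lim[OF t] by (intro tendsto_ln) auto
    moreover have "\<forall>\<^sub>F k in sequentially. ln (l (nat \<lfloor>t * real k\<rfloor>) / l k) = h (nat \<lfloor>t * real k\<rfloor>) - h k"
    proof -
      have "\<forall>\<^sub>F k in sequentially. real k \<ge> max 1 (1 / t)"
        using filterlim_real_sequentially unfolding filterlim_at_top by blast
      then show ?thesis
      proof eventually_elim
        case (elim k)
        then have "1 \<le> t * real k" using t by (simp add: field_simps)
        then have "1 \<le> nat \<lfloor>t * real k\<rfloor>" by linarith
        moreover have "1 \<le> k" using elim by auto
        ultimately show ?case using pos[of k] pos[of "nat \<lfloor>t * real k\<rfloor>"]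
            by (simp add: h_def ln_div)
      qed
    qed
    ultimately show ?thesis by (simp add: tendsto_cong)
  qed
  define G where "G q b K = {t \<in> {1..b}. \<forall>N\<ge>K. \<bar>h (nat \<lfloor>t * real (q N)\<rfloor>) - h (q N)\<bar> < d / 2}"
    for q :: "nat \<Rightarrow> nat" and b :: real and K :: nat
  have G_meas [measurable]: "G q b K \<in> sets lborel" for q b K
    unfolding G_def by measurable
  have G_ev: "\<forall>\<^sub>F K in sequentially. measure lborel (G q b K) > b - 1 - 1/2"
    if q: "filterlim q at_top sequentially" and b: "b \<ge> 1" for q b
  proof -
    have "incseq (G q b)" unfolding incseq_def G_def by auto
    moreover have "(\<Union>K. G q b K) = {1..b}"
    proof
      show "{1..b} \<subseteq> (\<Union>K. G q b K)"
      proof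
        fix t assume t: "t \<in> {1..b}"
        then have "((\<lambda>k. h (nat \<lfloor>t * real k\<rfloor>) - h k) \<circ> q) \<longlonglongrightarrow> 0"
          unfolding o_def by (intro filterlim_compose[OF hlim q]) auto
        then have "\<forall>\<^sub>F N in sequentially. \<bar>h (nat \<lfloor>t * real (q N)\<rfloor>) - h (q N)\<bar> < d / 2"
          using d by (force simp: tendsto_iff dist_real_def dest: spec[of _ "d / 2"])
        then show "t \<in> (\<Union>K. G q b K)"
          using t by (auto simp: G_def eventually_sequentially)
      qed
    qed (auto simp: G_def)
    ultimately have "(\<lambda>K. measure lborel (G q b K)) \<longlonglongrightarrow> measure lborel {1..b}"
      using Lim_measure_incseq[of "G q b" lborel] b G_meas[of q b] by auto
    then show ?thesis using b by (intro order_tendstoD(1)) auto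
  qed
  \<comment> \<open>each of the two sets misses its interval by a measure less than \<open>1/2\<close>\<close>
  have "\<forall>\<^sub>F K in sequentially. measure lborel (G n 4 K) > 5/2 \<and> measure lborel (G m 8 K) > 13/2"
    using G_ev[OF n_lim, of 4] G_ev[OF m_lim, of 8] by (simp add: eventually_conj)
  then obtain K where K: "measure lborel (G n 4 K) > 5/2" "measure lborel (G m 8 K) > 13/2"
    by (auto simp: eventually_sequentially)
  define r where "r = real (m K) / real (n K)"
  have nK: "n K \<ge> 1" "m K \<ge> 1" using nm(1,2)[of K] by linarith+
  have r: "r \<ge> 1/2" "r \<le> 1" "r * real (n K) = real (m K)"
    using nm(2,3)[of K] nK by (auto simp: r_def field_simps)
  \<comment> \<open>\<open>t / r * m K\<close> and \<open>t * n K\<close> are equal, so both settled values sit at the same integer\<close>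
  have disj: "t / r \<notin> G m 8 K" if t: "t \<in> G n 4 K" for t
  proof
    assume t': "t / r \<in> G m 8 K"
    have eq: "t / r * real (m K) = t * real (n K)" using r by (auto simp: field_simps)
    have "\<bar>h (nat \<lfloor>t * real (n K)\<rfloor>) - h (n K)\<bar> < d / 2" using t by (auto simp: G_def)
    moreover have "\<bar>h (nat \<lfloor>t / r * real (m K)\<rfloor>) - h (m K)\<bar> < d / 2" using t' unfolding G_def by blast
    ultimately show False using nm(4)[of K] unfolding eq by linarith
  qed
  define S where "S = {1..8} - G m 8 K"
  have S_sub: "G m 8 K \<subseteq> {1..8}" "G n 4 K \<subseteq> {1..4}" by (auto simp: G_def)
  have S_meas [measurable]: "S \<in> sets lborel" unfolding S_def by measurable
  have S: "measure lborel S < 1/2"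
    unfolding S_def using K(2) S_sub by (subst measure_Diff) (auto simp: G_meas[simplified])
  \<comment> \<open>for \<open>t\<close> in \<open>{1..4}\<close> the quotient \<open>t / r\<close> lies in \<open>{1..8}\<close>, because \<open>r \<ge> 1/2\<close>\<close>
  have "{1..4} \<subseteq> ({1..4} - G n 4 K) \<union> (*\<^sub>R) r ` S"
  proof
    fix t :: real assume t: "t \<in> {1..4}"
    have "t \<le> t / r" using t r(1,2) by (simp add: pos_le_divide_eq mult_le_cancel_left1)
    moreover have "t / r \<le> 8" using t r(1) by (simp add: pos_divide_le_eq)
    ultimately have "t / r \<in> {1..8}" using t by auto
    moreover have "t = r *\<^sub>R (t / r)" using r by auto
    ultimately show "t \<in> ({1..4} - G n 4 K) \<union> (*\<^sub>R) r ` S"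
      using disj[of t] t unfolding S_def by blast
  qed
  moreover have fm: "{1..4} - G n 4 K \<in> lmeasurable" "S \<in> lmeasurable"
  proof -
    have "{1..4} - G n 4 K \<in> sets lebesgue" "S \<in> sets lebesgue"
      using G_meas[of n 4 K] S_meas by auto
    then show "{1..4} - G n 4 K \<in> lmeasurable" "S \<in> lmeasurable"
      unfolding S_def by (blast intro: bounded_set_imp_lmeasurable bounded_subset[OF bounded_closed_interval])+
  qed
  moreover have rS: "(*\<^sub>R) r ` S \<in> lmeasurable"
  proof (rule bounded_set_imp_lmeasurable)
    show "bounded ((*\<^sub>R) r ` S)"
      unfolding S_def by (blast intro: bounded_scaling bounded_subset[OF bounded_closed_interval])
    have "(*\<^sub>R) r ` S = (\<lambda>t. t / r) -` S" using r(1) by (auto intro: rev_image_eqI)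
    also have "\<dots> \<in> sets borel" using S_meas by (intro measurable_sets_borel) auto
    finally show "(*\<^sub>R) r ` S \<in> sets lebesgue" by simp
  qed
  ultimately have "measure lebesgue {1..4::real}
      \<le> measure lebesgue (({1..4} - G n 4 K) \<union> (*\<^sub>R) r ` S)"
    by (intro measure_mono_fmeasurable) auto
  also have "\<dots> \<le> measure lebesgue ({1..4} - G n 4 K) + measure lebesgue ((*\<^sub>R) r ` S)"
    using fm rS by (intro measure_Un_le) auto
  also have "measure lebesgue ({1..4} - G n 4 K) < 1/2"
  proof -
    have "measure lborel ({1..4} - G n 4 K) < 1/2" using K(1) S_sub by (subst measure_Diff) (auto simp: G_meas[simplified])
    then show ?thesis using G_meas[of n 4 K] by (simp add: measure_completion)
  qed
  also have "measure lebesgue ((*\<^sub>R) r ` S) = r * measure lebesgue S"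
    using measure_lebesgue_affine[of r 0 S] r by simp
  also have "\<dots> \<le> 1 * measure lebesgue S" using r by (intro mult_right_mono) auto
  also have "1 * measure lebesgue S < 1/2" using S S_meas by (simp add: measure_completion)
  finally show False by simp
qed

lemma regularly_varying_pos: "regularly_varying r \<rho> \<Longrightarrow> n \<ge> 1 \<Longrightarrow> r n > 0"
  by (auto simp: regularly_varying_def)

lemma regularly_varying_inverse:
  assumes "regularly_varying r \<rho>"
  shows "regularly_varying (\<lambda>n. 1 / r n) (- \<rho>)"
proof -
  obtain l where l: "\<And>n. n \<ge> 1 \<Longrightarrow> r n = real n powr \<rho> * l n"
    "\<And>t. t > 0 \<Longrightarrow> (\<lambda>n. l (nat \<lfloor>t * real n\<rfloor>) / l n) \<longlonglongrightarrow> 1"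
    using assms unfolding regularly_varying_def by blast
  have "(\<lambda>n. (1 / l (nat \<lfloor>t * real n\<rfloor>)) / (1 / l n)) \<longlonglongrightarrow> 1" if "t > 0" for t
    using tendsto_inverse[OF l(2)[OF that]] by (simp add: field_simps)
  moreover have "\<forall>n\<ge>1. 1 / r n = real n powr (- \<rho>) * (1 / l n)"
    using l(1) by (simp add: powr_minus field_simps)
  moreover have "\<forall>n\<ge>1. 1 / r n > 0" using regularly_varying_pos[OF assms] by simp
  ultimately show ?thesis unfolding regularly_varying_def
    by (intro conjI exI[of _ "\<lambda>n. 1 / l n"]) blast+
qed

lemma regularly_varying_log_ratio:
  assumes r: "regularly_varying r \<rho>" and d: "d > 0"
  shows "\<exists>N\<ge>1. \<forall>n\<ge>N. \<forall>m. n \<le> 2 * m \<and> m \<le> n \<longrightarrow>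
           \<bar>ln (r m) - ln (r n) - \<rho> * (ln (real m) - ln (real n))\<bar> \<le> d"
proof -
  obtain l where l: "\<And>n. n \<ge> 1 \<Longrightarrow> r n = real n powr \<rho> * l n"
    "\<And>t. t > 0 \<Longrightarrow> (\<lambda>n. l (nat \<lfloor>t * real n\<rfloor>) / l n) \<longlonglongrightarrow> 1"
    using r unfolding regularly_varying_def by blast
  have l_pos: "l n > 0" if "n \<ge> 1" for n
  proof -
    have "real n powr \<rho> * l n > 0" using regularly_varying_pos[OF r that] l(1)[OF that] by simp
    then show ?thesis using that by (simp add: zero_less_mult_iff)
  qed
  have ln_r: "ln (r n) = \<rho> * ln (real n) + ln (l n)" if "n \<ge> 1" for n
    using l(1)[OF that] l_pos[OF that] that by (simp add: ln_mult ln_powr)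
  obtain N where N: "N \<ge> 1" "\<And>n m. n \<ge> N \<Longrightarrow> n \<le> 2 * m \<Longrightarrow> m \<le> n \<Longrightarrow> \<bar>ln (l m) - ln (l n)\<bar> \<le> d"
    using slowly_varying_uniform[of l, OF l_pos l(2) d] by blast
  have "\<bar>ln (r m) - ln (r n) - \<rho> * (ln (real m) - ln (real n))\<bar> \<le> d"
    if "n \<ge> N" "n \<le> 2 * m" "m \<le> n" for n m
  proof -
    have "n \<ge> 1" "m \<ge> 1" using that N(1) by auto
    then show ?thesis using N(2)[OF that] by (simp add: ln_r algebra_simps)
  qed
  then show ?thesis using N(1) by blast
qed

lemma regularly_varying_near:
  assumes r: "regularly_varying r \<rho>" and d: "d > 0"
  shows "\<exists>s>0. s \<le> 1/2 \<and> (\<forall>\<^sub>F m in sequentially. \<forall>i. \<bar>real i - real m\<bar> \<le> s * real m \<longrightarrow> \<bar>r i - r m\<bar> \<le> d * r m)"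
proof -
  define c where "c = ln (1 + d) / 2"
  have c: "c > 0" using d by (simp add: c_def)
  define s where "s = min (1/2) (c / (2 * (\<bar>\<rho>\<bar> + 1)))"
  have s: "s > 0" "s \<le> 1/2" "\<bar>\<rho>\<bar> * (2 * s) \<le> c"
  proof -
    have "s \<le> c / (2 * (\<bar>\<rho>\<bar> + 1))" by (simp add: s_def)
    then have "2 * s * (\<bar>\<rho>\<bar> + 1) \<le> c" by (simp add: pos_le_divide_eq mult_ac)
    moreover show s0: "s > 0" using c by (simp add: s_def)
    ultimately show "\<bar>\<rho>\<bar> * (2 * s) \<le> c" by (simp add: algebra_simps)
    show "s \<le> 1/2" unfolding s_def by (rule min.cobounded1)
  qed
  obtain N where N: "N \<ge> 1" "\<And>n m. n \<ge> N \<Longrightarrow> n \<le> 2 * m \<Longrightarrow> m \<le> n \<Longrightarrow>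
      \<bar>ln (r m) - ln (r n) - \<rho> * (ln (real m) - ln (real n))\<bar> \<le> c"
    using regularly_varying_log_ratio[OF r c] by blast
  have main: "\<bar>r i - r m\<bar> \<le> d * r m" if m: "m \<ge> N" and i: "\<bar>real i - real m\<bar> \<le> s * real m" for m i
  proof -
    have sm: "s * real m \<le> real m / 2" using s(2) mult_right_mono[of s "1/2" "real m"] by simp
    have im: "m \<le> 2 * i" "i \<le> 2 * m" using i sm by linarith+
    have m1: "m \<ge> 1" "i \<ge> 1" using m N(1) im by linarith+
    have L: "\<bar>ln (r i) - ln (r m) - \<rho> * (ln (real i) - ln (real m))\<bar> \<le> c"
    proof (cases "i \<le> m")
      case True then show ?thesis using N(2)[OF m im(1)] by simp
    next
      case False
      then have "\<bar>ln (r m) - ln (r i) - \<rho> * (ln (real m) - ln (real i))\<bar> \<le> c"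
        using N(2)[of i m] m im(2) by simp
      then show ?thesis by (simp add: algebra_simps abs_le_iff)
    qed
    have "\<bar>ln (real i) - ln (real m)\<bar> \<le> 2 * s"
    proof -
      have "ln (real i) - ln (real m) = ln (real i / real m)" using m1 by (simp add: ln_div)
      also have "\<dots> \<le> real i / real m - 1" using m1 by (intro ln_le_minus_one) auto
      also have "\<dots> = (real i - real m) / real m" using m1 by (simp add: field_simps)
      also have "\<dots> \<le> s" using i m1 by (simp add: pos_divide_le_eq)
      finally have 1: "ln (real i) - ln (real m) \<le> s" .
      have "ln (real m) - ln (real i) = ln (real m / real i)" using m1 by (simp add: ln_div)
      also have "\<dots> \<le> real m / real i - 1" using m1 by (intro ln_le_minus_one) auto
      also have "\<dots> = (real m - real i) / real i" using m1 by (simp add: field_simps)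
      also have "\<dots> \<le> (s * real m) / real i" using i m1 by (intro divide_right_mono) auto
      also have "\<dots> \<le> 2 * s"
      proof -
        have "s * real m \<le> s * (2 * real i)" using s(1) im(1) by (intro mult_left_mono) linarith+
        then show ?thesis using m1 by (simp add: pos_divide_le_eq mult_ac)
      qed
      finally show ?thesis using 1 s(1) by linarith
    qed
    then have "\<bar>\<rho> * (ln (real i) - ln (real m))\<bar> \<le> \<bar>\<rho>\<bar> * (2 * s)"
      unfolding abs_mult by (rule mult_left_mono) simp
    then have "\<bar>ln (r i) - ln (r m)\<bar> \<le> ln (1 + d)" using L s(3) unfolding c_def by linarith
    then have "ln (r i) \<le> ln (r m) + ln (1 + d)" "ln (r m) \<le> ln (r i) + ln (1 + d)" by linarith+
    moreover have rp: "r i > 0" "r m > 0" using m1 regularly_varying_pos[OF r] by auto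
    ultimately have "ln (r i) \<le> ln (r m * (1 + d))" "ln (r m) \<le> ln (r i * (1 + d))"
      using d by (simp_all add: ln_mult)
    then have 2: "r i \<le> r m * (1 + d)" "r m \<le> r i * (1 + d)" using rp d by simp_all
    have "r m - r i \<le> d * r m"
    proof (cases "r i \<le> r m")
      case True
      then have "d * r i \<le> d * r m" using d by simp
      then show ?thesis using 2(2) by (simp add: algebra_simps)
    next
      case False
      moreover have "0 \<le> d * r m" using d rp by simp
      ultimately show ?thesis by linarith
    qed
    then show ?thesis using 2(1) by (simp add: algebra_simps abs_le_iff)
  qed
  show ?thesis using s(1,2) main unfolding eventually_sequentially by blast
qed

text \<open>
  Potter's bound: below the index, regular variation gives a power bound that is uniform over all
  pairs \<open>i \<le> m\<close>. The function \<open>g n = ln (r n) - \<beta> * ln n\<close> increases when a large argument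
  is replaced by its double, so \<open>i\<close> and \<open>m\<close> can be linked by halving \<open>m\<close> until it is within a factor
  \<open>2\<close> of \<open>i\<close>.
\<close>
lemma regularly_varying_potter:
  assumes r: "regularly_varying r \<rho>" and b: "\<beta> < \<rho>"
  shows "\<exists>C>0. \<forall>i m. 1 \<le> i \<longrightarrow> i \<le> m \<longrightarrow> r i \<le> C * (real i / real m) powr \<beta> * r m"
proof -
  define g where "g n = ln (r n) - \<beta> * ln (real n)" for n
  define d where "d = (\<rho> - \<beta>) * ln (3/2)"
  have d: "d > 0" using b by (simp add: d_def)
  obtain N where N: "N \<ge> 1" "\<And>n m. n \<ge> N \<Longrightarrow> n \<le> 2 * m \<Longrightarrow> m \<le> n \<Longrightarrow>
      \<bar>ln (r m) - ln (r n) - \<rho> * (ln (real m) - ln (real n))\<bar> \<le> d"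
    using regularly_varying_log_ratio[OF r d] by blast
  have loc: "g m \<le> g n + (\<rho> - \<beta>) * (ln (real m) - ln (real n)) + d"
    if "n \<ge> N" "n \<le> 2 * m" "m \<le> n" for n m
    using N(2)[OF that] by (simp add: g_def algebra_simps abs_le_iff)
  \<comment> \<open>accounts for the finitely many arguments up to \<open>N\<close>\<close>
  define D where "D = 2 * (\<Sum>k\<le>N. \<bar>g k\<bar>)"
  have bound: "1 \<le> i \<Longrightarrow> i \<le> m \<Longrightarrow> g i \<le> g m + D + d" for i m
  proof (induction m rule: less_induct)
    case (less m)
    show ?case
    proof (cases "m \<le> N")
      case True
      have "\<bar>g i\<bar> \<le> (\<Sum>k\<le>N. \<bar>g k\<bar>)" "\<bar>g m\<bar> \<le> (\<Sum>k\<le>N. \<bar>g k\<bar>)"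
        using less.prems True by (auto intro!: member_le_sum)
      then show ?thesis using d unfolding D_def by linarith
    next
      case m: False
      have D0: "D \<ge> 0" by (simp add: D_def sum_nonneg)
      show ?thesis
      proof (cases "m \<le> 2 * i")
        case True
        have "(\<rho> - \<beta>) * (ln (real i) - ln (real m)) \<le> 0"
          using b less.prems by (intro mult_nonneg_nonpos) auto
        then show ?thesis using loc[of m i] m True less.prems D0 by simp
      next
        case False
        \<comment> \<open>rounding up keeps \<open>m \<le> 2 * h\<close>, and for \<open>m \<ge> 2\<close> still \<open>h \<le> 2/3 * m\<close>\<close>
        define h where "h = (m + 1) div 2"
        have h: "i \<le> h" "h < m" "m \<le> 2 * h" "3 * h \<le> 2 * m" "h \<ge> 1"
          using False m N(1) less.prems unfolding h_def by auto
        have "ln (real h) - ln (real m) = ln (real h / real m)" using h m by (simp add: ln_div)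
        also have "\<dots> \<le> ln (2/3)"
        proof -
          have "real h / real m \<le> 2/3" using h by (simp add: pos_divide_le_eq)
          then show ?thesis using h by simp
        qed
        also have "ln (2/3::real) = - ln (3/2)" by (simp add: ln_div)
        finally have "(\<rho> - \<beta>) * (ln (real h) - ln (real m)) \<le> (\<rho> - \<beta>) * - ln (3/2)"
          using b by (intro mult_left_mono) auto
        then have "g h \<le> g m" using loc[of m h] h m by (simp add: d_def)
        then show ?thesis using less.IH[of h] h less.prems by simp
      qed
    qed
  qed
  have "r i \<le> exp (D + d) * (real i / real m) powr \<beta> * r m" if "1 \<le> i" "i \<le> m" for i m
  proof -
    have p: "r i > 0" "r m > 0" "real i > 0" "real m > 0"
      using that regularly_varying_pos[OF r] by auto
    have "ln (r i) \<le> D + d + \<beta> * (ln (real i) - ln (real m)) + ln (r m)"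
      using bound[OF that] by (simp add: g_def algebra_simps)
    then have "exp (ln (r i)) \<le> exp (D + d + \<beta> * (ln (real i) - ln (real m)) + ln (r m))" by simp
    then show ?thesis using p by (simp add: exp_add powr_def ln_div mult_ac)
  qed
  then show ?thesis by (intro exI[of _ "exp (D + d)"]) auto
qed

section \<open>The sequence of mean excursion times\<close>

lemma a_seq_ge: "(\<And>i. i \<ge> 1 \<Longrightarrow> 0 < \<epsilon> i) \<Longrightarrow> real n \<le> a_seq \<epsilon> n"
  by (auto simp: a_seq_def intro!: sum_nonneg intro: order.strict_implies_order)

lemma a_seq_diff_ge:
  assumes "m1 \<le> m2" "\<And>i. m1 < i \<Longrightarrow> i \<le> m2 \<Longrightarrow> y \<le> 1 / \<epsilon> i"
  shows "real (m2 - m1) * y \<le> a_seq \<epsilon> m2 - a_seq \<epsilon> m1"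
proof -
  have "{1..m2} = {1..m1} \<union> {m1<..m2}" using assms(1) by auto
  then have "(\<Sum>i=1..m2. 1 / \<epsilon> i) = (\<Sum>i=1..m1. 1 / \<epsilon> i) + (\<Sum>i\<in>{m1<..m2}. 1 / \<epsilon> i)"
    by (simp only:) (rule sum.union_disjoint, auto)
  moreover have "(\<Sum>i\<in>{m1<..m2}. y) \<le> (\<Sum>i\<in>{m1<..m2}. 1 / \<epsilon> i)"
    by (rule sum_mono) (use assms(2) in auto)
  ultimately show ?thesis using assms(1) by (simp add: a_seq_def)
qed

lemma sum_inverse_sqrt_le: "(\<Sum>i=1..m. 1 / sqrt (real i)) \<le> 2 * sqrt (real m)"
proof (induction m)
  case (Suc m)
  have "2 * sqrt (real m) * sqrt (real (Suc m)) + 1 \<le> 2 * real (Suc m)"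
  proof -
    have "sqrt (real m) * sqrt (real (Suc m)) = sqrt (real m * real (Suc m))" by (simp add: real_sqrt_mult)
    also have "\<dots> \<le> real m + 1/2" by (rule real_le_lsqrt) (auto simp: power2_eq_square field_simps)
    finally show ?thesis by simp
  qed
  also have "2 * real (Suc m) = 2 * sqrt (real (Suc m)) * sqrt (real (Suc m))"
    by (simp only: mult.assoc real_sqrt_mult_self abs_of_nat)
  finally have "2 * sqrt (real m) + 1 / sqrt (real (Suc m)) \<le> 2 * sqrt (real (Suc m))"
    by (simp add: field_simps)
  then show ?case using Suc by simp
qed simp

text \<open>
  The mean excursion times grow with an index \<open>\<alpha> \<ge> 0 > - 1/2\<close>, so by Potter's bound their sum is
  dominated by \<open>m\<close> times the last one.
\<close>
lemma a_seq_le: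
  assumes reg: "regularly_varying \<epsilon> (- \<alpha>)" and a: "0 \<le> \<alpha>" and e1: "\<And>n. n \<ge> 1 \<Longrightarrow> 0 < \<epsilon> n \<and> \<epsilon> n < 1"
  shows "\<exists>C>0. \<forall>m\<ge>1. a_seq \<epsilon> m \<le> C * (real m / \<epsilon> m)"
proof -
  have "regularly_varying (\<lambda>n. 1 / \<epsilon> n) \<alpha>" using regularly_varying_inverse[OF reg] by simp
  from regularly_varying_potter[OF this, of "- 1/2"] a
  obtain C where C: "C > 0" "\<And>i m. 1 \<le> i \<Longrightarrow> i \<le> m \<Longrightarrow>
      1 / \<epsilon> i \<le> C * (real i / real m) powr (- 1/2) * (1 / \<epsilon> m)" by auto
  have "a_seq \<epsilon> m \<le> (2 * C + 1) * (real m / \<epsilon> m)" if m: "m \<ge> 1" for m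
  proof -
    have em: "0 < \<epsilon> m" "\<epsilon> m < 1" using e1[OF m] by auto
    have "(\<Sum>i=1..m. 1 / \<epsilon> i) \<le> (\<Sum>i=1..m. C * sqrt (real m) / \<epsilon> m * (1 / sqrt (real i)))"
    proof (rule sum_mono)
      fix i assume i: "i \<in> {1..m}"
      have "(real i / real m) powr (- 1/2) = sqrt (real m) / sqrt (real i)"
        using i by (simp add: powr_minus powr_half_sqrt powr_divide field_simps)
      then show "1 / \<epsilon> i \<le> C * sqrt (real m) / \<epsilon> m * (1 / sqrt (real i))"
        using C(2)[of i m] i by (simp add: mult.commute)
    qed
    also have "\<dots> = C * sqrt (real m) / \<epsilon> m * (\<Sum>i=1..m. 1 / sqrt (real i))"
      by (rule sum_distrib_left[symmetric])
    also have "\<dots> \<le> C * sqrt (real m) / \<epsilon> m * (2 * sqrt (real m))"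
      using C(1) em by (intro mult_left_mono sum_inverse_sqrt_le) auto
    also have "\<dots> = 2 * C * (real m / \<epsilon> m)" by simp
    finally have "(\<Sum>i=1..m. 1 / \<epsilon> i) \<le> 2 * C * (real m / \<epsilon> m)" .
    moreover have "real m \<le> real m / \<epsilon> m" using em by (simp add: pos_le_divide_eq mult_left_le)
    ultimately show ?thesis unfolding a_seq_def by (simp add: algebra_simps)
  qed
  then show ?thesis using C(1) by (intro exI[of _ "2 * C + 1"]) auto
qed

text \<open>
  A window of excursion numbers around \<open>m\<close> that is wide enough to change the total mean time by a fixed
  fraction \<open>z\<close>, but so narrow that the drifts inside it agree up to the relative error \<open>d\<close>.
\<close>
lemma excursion_window:
  assumes reg: "regularly_varying \<epsilon> (- \<alpha>)" and a: "0 \<le> \<alpha>" and e1: "\<And>n. n \<ge> 1 \<Longrightarrow> 0 < \<epsilon> n \<and> \<epsilon> n < 1"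
    and d: "0 < d" "d \<le> 1"
  shows "\<exists>s>0. \<exists>z>0. z \<le> 1 \<and> (\<forall>\<^sub>F m in sequentially. \<exists>h. 0 < h \<and> 2 * h \<le> m \<and>
      (\<forall>i. m - h \<le> i \<longrightarrow> i \<le> m + h \<longrightarrow> \<bar>\<epsilon> i - \<epsilon> m\<bar> \<le> d * \<epsilon> m) \<and>
      (1 + z) * a_seq \<epsilon> m \<le> a_seq \<epsilon> (m + h) \<and> a_seq \<epsilon> (m - h) \<le> (1 - z) * a_seq \<epsilon> m)
      \<and> (\<forall>\<^sub>F m in sequentially. s * (real m / \<epsilon> m) \<le> a_seq \<epsilon> m)"
proof -
  obtain C where C: "C > 0" "\<And>m. m \<ge> 1 \<Longrightarrow> a_seq \<epsilon> m \<le> C * (real m / \<epsilon> m)"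
    using a_seq_le[OF reg a e1] by blast
  obtain s where s: "s > 0" "s \<le> 1/2"
    "\<forall>\<^sub>F m in sequentially. \<forall>i. \<bar>real i - real m\<bar> \<le> s * real m \<longrightarrow> \<bar>\<epsilon> i - \<epsilon> m\<bar> \<le> d * \<epsilon> m"
    using regularly_varying_near[OF reg d(1)] by blast
  \<comment> \<open>either half of the window contributes at least \<open>s / 4 * (m / \<epsilon> m)\<close> to the total mean time, which is at most \<open>C * (m / \<epsilon> m)\<close>\<close>
  define z where "z = min 1 (s / (4 * C))"
  have z: "z > 0" "z \<le> 1" "z * C \<le> s / 4"
  proof -
    show "z > 0" using s C by (simp add: z_def)
    show "z \<le> 1" unfolding z_def by (rule min.cobounded1)
    have "z \<le> s / (4 * C)" by (simp add: z_def)
    then show "z * C \<le> s / 4" using C(1) by (simp add: field_simps)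
  qed
  have ev: "\<forall>\<^sub>F m in sequentially. real m \<ge> 2 / s"
    using filterlim_real_sequentially unfolding filterlim_at_top by blast
  have both: "\<forall>\<^sub>F m in sequentially. (\<exists>h. 0 < h \<and> 2 * h \<le> m \<and>
      (\<forall>i. m - h \<le> i \<longrightarrow> i \<le> m + h \<longrightarrow> \<bar>\<epsilon> i - \<epsilon> m\<bar> \<le> d * \<epsilon> m) \<and>
      (1 + z) * a_seq \<epsilon> m \<le> a_seq \<epsilon> (m + h) \<and> a_seq \<epsilon> (m - h) \<le> (1 - z) * a_seq \<epsilon> m)
      \<and> s / 4 * (real m / \<epsilon> m) \<le> a_seq \<epsilon> m"
    using s(3) ev
  proof eventually_elim
    case (elim m)
    define h where "h = nat \<lfloor>s * real m\<rfloor>"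
    have sm: "2 \<le> s * real m" using elim(2) s(1) by (simp add: field_simps)
    have sm2: "s * real m \<le> real m / 2" using s(2) mult_right_mono[of s "1/2" "real m"] by simp
    have h: "real h \<le> s * real m" "s * real m / 2 \<le> real h" using sm unfolding h_def by linarith+
    have h2: "0 < h" "2 * h \<le> m" using h sm sm2 by linarith+
    have m: "m \<ge> 1" using h2 by simp
    have em: "0 < \<epsilon> m" "\<epsilon> m < 1" using e1[OF m] by auto
    have win: "\<bar>\<epsilon> i - \<epsilon> m\<bar> \<le> d * \<epsilon> m" if "m - h \<le> i" "i \<le> m + h" for i
    proof -
      have "\<bar>real i - real m\<bar> \<le> real h" using that by linarith
      then show ?thesis using elim(1) h by auto
    qed
    have low: "1 / (2 * \<epsilon> m) \<le> 1 / \<epsilon> i" if "m - h < i" "i \<le> m + h" for i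
    proof -
      have "d * \<epsilon> m \<le> 1 * \<epsilon> m" using d em by (intro mult_right_mono) auto
      then have "\<epsilon> i \<le> 2 * \<epsilon> m" using win[of i] that by linarith
      moreover have "0 < \<epsilon> i" using that e1[of i] by simp
      ultimately show ?thesis by (intro divide_left_mono) auto
    qed
    have zz: "s / 4 * (real m / \<epsilon> m) \<le> real h * (1 / (2 * \<epsilon> m))"
      using mult_right_mono[OF h(2), of "1 / (2 * \<epsilon> m)"] em by (simp add: field_simps)
    have "z * a_seq \<epsilon> m \<le> z * (C * (real m / \<epsilon> m))" using C(2)[OF m] z by (intro mult_left_mono) auto
    also have "\<dots> = (z * C) * (real m / \<epsilon> m)" by simp
    also have "\<dots> \<le> s / 4 * (real m / \<epsilon> m)" using z(3) em by (intro mult_right_mono) auto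
    finally have za: "z * a_seq \<epsilon> m \<le> real h * (1 / (2 * \<epsilon> m))" using zz by linarith
    have up: "real h * (1 / (2 * \<epsilon> m)) \<le> a_seq \<epsilon> (m + h) - a_seq \<epsilon> m"
      using a_seq_diff_ge[of m "m + h" "1 / (2 * \<epsilon> m)" \<epsilon>] low by simp
    have dn: "real h * (1 / (2 * \<epsilon> m)) \<le> a_seq \<epsilon> m - a_seq \<epsilon> (m - h)"
      using a_seq_diff_ge[of "m - h" m "1 / (2 * \<epsilon> m)" \<epsilon>] low h2 by simp
    have "0 \<le> a_seq \<epsilon> (m - h)" using a_seq_ge[of \<epsilon> "m - h"] e1 by (meson of_nat_0_le_iff order_trans)
    then show ?case using h2 win za up dn zz by (intro conjI exI[of _ h]) (auto simp: algebra_simps)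
  qed
  have ex_pos: "\<exists>h. 0 < h \<and> P h" if "0 < h" "P h" for P and h :: real using that by blast
  show ?thesis
  proof (rule ex_pos[of "s / 4"], goal_cases)
    case 2
    show ?case using z(2) both[unfolded eventually_conj_iff]
      by (intro ex_pos[OF z(1)]) (elim conjE, intro conjI; assumption)
  qed (use s(1) in simp)
qed

lemma drift_tendsto_0:
  assumes reg: "regularly_varying \<epsilon> (- \<alpha>)" and a: "0 < \<alpha>"
  shows "\<epsilon> \<longlonglongrightarrow> 0"
proof -
  have "regularly_varying (\<lambda>n. 1 / \<epsilon> n) \<alpha>" using regularly_varying_inverse[OF reg] by simp
  from regularly_varying_potter[OF this, of "\<alpha> / 2"] a
  obtain C where C: "C > 0" "\<And>i m. 1 \<le> i \<Longrightarrow> i \<le> m \<Longrightarrow>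
      1 / \<epsilon> i \<le> C * (real i / real m) powr (\<alpha> / 2) * (1 / \<epsilon> m)" by auto
  have pos: "0 < \<epsilon> n" if "n \<ge> 1" for n using regularly_varying_pos[OF reg that] .
  have "\<epsilon> m \<le> C * \<epsilon> 1 * real m powr (- (\<alpha> / 2))" if "m \<ge> 1" for m
  proof -
    have "1 / \<epsilon> 1 \<le> C * (1 / real m) powr (\<alpha> / 2) * (1 / \<epsilon> m)" using C(2)[of 1 m] that by simp
    also have "(1 / real m) powr (\<alpha> / 2) = real m powr (- (\<alpha> / 2))"
      using that by (simp add: powr_minus powr_divide field_simps)
    finally show ?thesis using pos[of 1] pos[OF that] by (simp add: field_simps)
  qed
  then have ev: "\<forall>\<^sub>F m in sequentially. norm (\<epsilon> m) \<le> C * \<epsilon> 1 * real m powr (- (\<alpha> / 2))"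
    using pos by (intro eventually_sequentiallyI[of 1]) (auto simp: less_imp_le)
  have "(\<lambda>m. C * \<epsilon> 1 * real m powr (- (\<alpha> / 2))) \<longlonglongrightarrow> C * \<epsilon> 1 * 0"
    by (intro tendsto_mult tendsto_const tendsto_neg_powr filterlim_real_sequentially) (use a in auto)
  then have "(\<lambda>m. C * \<epsilon> 1 * real m powr (- (\<alpha> / 2))) \<longlonglongrightarrow> 0" by simp
  then show ?thesis by (rule Lim_null_comparison[OF ev])
qed

lemma scaled_drift_diverges:
  assumes reg: "regularly_varying \<epsilon> (- \<alpha>)" and a: "\<alpha> < 1"
  shows "filterlim (\<lambda>n. real n * \<epsilon> n) at_top sequentially"
proof -
  \<comment> \<open>an exponent strictly between \<open>- 1\<close> and \<open>- \<alpha>\<close>\<close>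
  from regularly_varying_potter[OF reg, of "- ((1 + \<alpha>) / 2)"] a
  obtain C where C: "C > 0" "\<And>i m. 1 \<le> i \<Longrightarrow> i \<le> m \<Longrightarrow>
      \<epsilon> i \<le> C * (real i / real m) powr (- ((1 + \<alpha>) / 2)) * \<epsilon> m" by (auto simp: field_simps)
  have pos: "0 < \<epsilon> n" if "n \<ge> 1" for n using regularly_varying_pos[OF reg that] .
  have low: "\<epsilon> 1 / C * real m powr ((1 - \<alpha>) / 2) \<le> real m * \<epsilon> m" if "m \<ge> 1" for m
  proof -
    have "\<epsilon> 1 \<le> C * (1 / real m) powr (- ((1 + \<alpha>) / 2)) * \<epsilon> m" using C(2)[of 1 m] that by simp
    also have "(1 / real m) powr (- ((1 + \<alpha>) / 2)) = real m powr ((1 + \<alpha>) / 2)"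
      using that by (simp add: powr_minus powr_divide field_simps)
    finally have "\<epsilon> 1 * real m powr ((1 - \<alpha>) / 2)
        \<le> C * real m powr ((1 + \<alpha>) / 2) * \<epsilon> m * real m powr ((1 - \<alpha>) / 2)" by (intro mult_right_mono) auto
    also have "\<dots> = C * \<epsilon> m * (real m powr ((1 + \<alpha>) / 2) * real m powr ((1 - \<alpha>) / 2))" by simp
    also have "real m powr ((1 + \<alpha>) / 2) * real m powr ((1 - \<alpha>) / 2) = real m"
    proof -
      have "(1 + \<alpha>) / 2 + (1 - \<alpha>) / 2 = 1" by (simp add: field_simps)
      then show ?thesis unfolding powr_add[symmetric] using that by simp
    qed
    finally show ?thesis using C(1) by (simp add: field_simps)
  qed
  have "filterlim (\<lambda>m. real m powr ((1 - \<alpha>) / 2)) at_top sequentially"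
  proof -
    have "filterlim (\<lambda>m. exp ((1 - \<alpha>) / 2 * ln (real m))) at_top sequentially"
      using a by (intro filterlim_compose[OF exp_at_top] filterlim_tendsto_pos_mult_at_top[OF tendsto_const]
          filterlim_compose[OF ln_at_top filterlim_real_sequentially]) auto
    then show ?thesis
      by (rule filterlim_at_top_mono) (auto simp: powr_def intro: eventually_sequentiallyI[of 1])
  qed
  then have "filterlim (\<lambda>m. \<epsilon> 1 / C * real m powr ((1 - \<alpha>) / 2)) at_top sequentially"
    using pos[of 1] C(1) by (intro filterlim_tendsto_pos_mult_at_top[OF tendsto_const]) auto
  then show ?thesis
    by (rule filterlim_at_top_mono) (use low in \<open>auto intro: eventually_sequentiallyI[of 1]\<close>)
qed

text \<open>
  The variance of the time taken by \<open>m\<close> excursions is governed by the square of the largest reciprocal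
  drift among them, and for the law of large numbers this square must be negligible
  compared with the mean time. For \<open>\<alpha> = 0\<close> the reciprocal drifts need not be comparable with the last
  one, but they are at most of order \<open>m powr (1/4)\<close>. For \<open>\<alpha> > 0\<close> they are bounded by a multiple of the last one,
  the mean time is at least a multiple of \<open>m / \<epsilon> m\<close>, and the quotient is of order \<open>1 / (m * \<epsilon> m)\<close>.
\<close>
lemma inverse_drift_bound:
  assumes reg: "regularly_varying \<epsilon> (- \<alpha>)" and a: "0 \<le> \<alpha>" and e1: "\<And>n. n \<ge> 1 \<Longrightarrow> 0 < \<epsilon> n \<and> \<epsilon> n < 1"
    and div: "filterlim (\<lambda>n. real n * \<epsilon> n) at_top sequentially"
  shows "\<exists>B. (\<forall>m\<ge>1. \<forall>i. 1 \<le> i \<longrightarrow> i \<le> 2 * m \<longrightarrow> 1 / \<epsilon> i \<le> B m) \<and> (\<lambda>m. (B m)\<^sup>2 / a_seq \<epsilon> m) \<longlonglongrightarrow> 0"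
proof (cases "\<alpha> = 0")
  case True
  from regularly_varying_potter[OF reg, of "- 1/4"] True
  obtain C where C: "C > 0" "\<And>i m. 1 \<le> i \<Longrightarrow> i \<le> m \<Longrightarrow>
      \<epsilon> i \<le> C * (real i / real m) powr (- 1/4) * \<epsilon> m" by (auto simp: field_simps)
  define K where "K = C / \<epsilon> 1"
  have K: "K > 0" using C(1) e1[of 1] by (simp add: K_def)
  define B where "B m = K * real (2 * m) powr (1/4)" for m
  have "1 / \<epsilon> i \<le> B m" if "1 \<le> i" "i \<le> 2 * m" for i m
  proof -
    have "\<epsilon> 1 \<le> C * (1 / real i) powr (- 1/4) * \<epsilon> i" using C(2)[of 1 i] that by simp
    also have "(1 / real i) powr (- 1/4) = real i powr (1/4)"
      using that by (simp add: powr_minus powr_divide field_simps)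
    finally have "1 / \<epsilon> i \<le> K * real i powr (1/4)"
      using e1[of 1] e1[OF that(1)] by (simp add: K_def field_simps)
    also have "\<dots> \<le> B m" unfolding B_def using that K by (intro mult_left_mono powr_mono2) auto
    finally show ?thesis .
  qed
  moreover have "(\<lambda>m. (B m)\<^sup>2 / a_seq \<epsilon> m) \<longlonglongrightarrow> 0"
  proof -
    have sq: "(B m)\<^sup>2 = K\<^sup>2 * sqrt 2 * sqrt (real m)" for m
    proof -
      have "(real (2 * m) powr (1/4))\<^sup>2 = real (2 * m) powr (1/2)"
        by (simp add: power2_eq_square powr_add[symmetric])
      also have "\<dots> = sqrt 2 * sqrt (real m)" by (simp add: powr_half_sqrt real_sqrt_mult)
      finally show ?thesis by (simp add: B_def power_mult_distrib)
    qed
    have le: "norm ((B m)\<^sup>2 / a_seq \<epsilon> m) \<le> K\<^sup>2 * sqrt 2 * (1 / sqrt (real m))" if "m \<ge> 1" for m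
    proof -
      have am: "real m \<le> a_seq \<epsilon> m" using a_seq_ge e1 by blast
      then have "(B m)\<^sup>2 / a_seq \<epsilon> m \<le> (B m)\<^sup>2 / real m" using that by (intro divide_left_mono) auto
      also have "\<dots> = K\<^sup>2 * sqrt 2 * (sqrt (real m) / real m)" by (simp add: sq)
      also have "sqrt (real m) / real m = 1 / sqrt (real m)" using that by (simp add: real_div_sqrt field_simps)
      finally show ?thesis using am that by simp
    qed
    have "(\<lambda>m. K\<^sup>2 * sqrt 2 * (1 / sqrt (real m))) \<longlonglongrightarrow> K\<^sup>2 * sqrt 2 * 0"
      by (intro tendsto_mult tendsto_const tendsto_divide_0[OF tendsto_const]
          filterlim_at_top_imp_at_infinity filterlim_compose[OF sqrt_at_top filterlim_real_sequentially])
    then have "(\<lambda>m. K\<^sup>2 * sqrt 2 * (1 / sqrt (real m))) \<longlonglongrightarrow> 0" by simp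
    then show ?thesis
      by (rule Lim_null_comparison[rotated]) (use le in \<open>blast intro: eventually_sequentiallyI\<close>)
  qed
  ultimately show ?thesis by blast
next
  case False
  have reg': "regularly_varying (\<lambda>n. 1 / \<epsilon> n) \<alpha>" using regularly_varying_inverse[OF reg] by simp
  from regularly_varying_potter[OF this, of 0] a False
  obtain C where C: "C > 0" "\<And>i m. 1 \<le> i \<Longrightarrow> i \<le> m \<Longrightarrow> 1 / \<epsilon> i \<le> C * (1 / \<epsilon> m)"
    by (auto simp: powr_0)
  from regularly_varying_potter[OF reg, of "- \<alpha> - 1"]
  obtain D where D: "D > 0" "\<And>i m. 1 \<le> i \<Longrightarrow> i \<le> m \<Longrightarrow>
      \<epsilon> i \<le> D * (real i / real m) powr (- \<alpha> - 1) * \<epsilon> m" by auto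
  define K where "K = C * (D * (1/2) powr (- \<alpha> - 1))"
  have K: "K > 0" using C(1) D(1) by (simp add: K_def)
  have bd: "1 / \<epsilon> i \<le> K * (1 / \<epsilon> m)" if "1 \<le> i" "i \<le> 2 * m" for i m
  proof -
    have m: "m \<ge> 1" using that by simp
    have p: "0 < \<epsilon> m" "0 < \<epsilon> (2 * m)" using e1[of m] e1[of "2 * m"] m by auto
    have "real m / real (2 * m) = 1/2" using m by simp
    then have "\<epsilon> m \<le> D * (1/2) powr (- \<alpha> - 1) * \<epsilon> (2 * m)" using D(2)[of m "2 * m"] m by simp
    then have 1: "1 / \<epsilon> (2 * m) \<le> D * (1/2) powr (- \<alpha> - 1) * (1 / \<epsilon> m)" using p by (simp add: field_simps)
    have "1 / \<epsilon> i \<le> C * (1 / \<epsilon> (2 * m))" using C(2) that by blast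
    also have "\<dots> \<le> C * (D * (1/2) powr (- \<alpha> - 1) * (1 / \<epsilon> m))" using 1 C(1) by (intro mult_left_mono) auto
    finally show ?thesis by (simp add: K_def mult_ac)
  qed
  obtain s where s: "s > 0" "\<forall>\<^sub>F m in sequentially. s * (real m / \<epsilon> m) \<le> a_seq \<epsilon> m"
    using excursion_window[OF reg a _ zero_less_one order_refl] e1 by blast
  have "(\<lambda>m. K\<^sup>2 / s * (1 / (real m * \<epsilon> m))) \<longlonglongrightarrow> K\<^sup>2 / s * 0"
    by (intro tendsto_mult tendsto_const tendsto_divide_0[OF tendsto_const] filterlim_at_top_imp_at_infinity div)
  then have lim: "(\<lambda>m. K\<^sup>2 / s * (1 / (real m * \<epsilon> m))) \<longlonglongrightarrow> 0" by simp
  have "\<forall>\<^sub>F m in sequentially. norm ((K * (1 / \<epsilon> m))\<^sup>2 / a_seq \<epsilon> m) \<le> K\<^sup>2 / s * (1 / (real m * \<epsilon> m))"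
    using s(2) eventually_ge_at_top[of 1]
  proof eventually_elim
    case (elim m)
    have em: "0 < \<epsilon> m" using e1 elim by auto
    have p: "0 < s * (real m / \<epsilon> m)" using s(1) em elim by simp
    then have "(K * (1 / \<epsilon> m))\<^sup>2 / a_seq \<epsilon> m \<le> (K * (1 / \<epsilon> m))\<^sup>2 / (s * (real m / \<epsilon> m))"
      by (intro divide_left_mono[OF elim(1)] mult_pos_pos[OF order_less_le_trans[OF p elim(1)] p]) auto
    also have "\<dots> = K\<^sup>2 / s * (1 / (real m * \<epsilon> m))" using em elim by (simp add: power2_eq_square field_simps)
    finally show ?case using p elim by simp
  qed
  then have "(\<lambda>m. (K * (1 / \<epsilon> m))\<^sup>2 / a_seq \<epsilon> m) \<longlonglongrightarrow> 0"
    using lim by (rule Lim_null_comparison)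
  then show ?thesis using bd by (intro exI[of _ "\<lambda>m. K * (1 / \<epsilon> m)"]) auto
qed

section \<open>Averaging operators of the reflected walk\<close>

text \<open>
  The Markov operator of the pair (height of the reflected walk, number of completed excursions).
  Counting completed excursions makes every natural number a legitimate state; the drift \<open>e j\<close>
  is that of the excursion following \<open>j\<close> completed ones.
\<close>
definition avg_step :: "(nat \<Rightarrow> real) \<Rightarrow> (nat \<Rightarrow> nat \<Rightarrow> real) \<Rightarrow> nat \<Rightarrow> nat \<Rightarrow> real" where
  "avg_step e g x j =
     (if x = 0 then g 1 j
      else (1 - e j) / 2 * g (x + 1) j + (1 + e j) / 2 * g (x - 1) (if x = 1 then Suc j else j))"

lemma avg_step_linear:
  "avg_step e (\<lambda>x j. a * g x j + b * h x j) x j = a * avg_step e g x j + b * avg_step e h x j"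
  by (simp add: avg_step_def algebra_simps)

lemma avg_step_const [simp]: "avg_step e (\<lambda>_ _. c) x j = c"
  by (simp add: avg_step_def field_simps)

lemma avg_step_pow_linear:
  "(avg_step e ^^ n) (\<lambda>x j. a * g x j + b * h x j) x j
     = a * (avg_step e ^^ n) g x j + b * (avg_step e ^^ n) h x j"
proof (induction n arbitrary: x j)
  case (Suc n)
  have "(avg_step e ^^ n) (\<lambda>x j. a * g x j + b * h x j)
      = (\<lambda>x j. a * (avg_step e ^^ n) g x j + b * (avg_step e ^^ n) h x j)"
    using Suc.IH by (intro ext)
  then show ?case by (simp add: avg_step_linear)
qed simp

lemma avg_step_pow_const [simp]: "(avg_step e ^^ n) (\<lambda>_ _. c) x j = c"
proof (induction n arbitrary: x j)
  case (Suc n)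
  have "(avg_step e ^^ n) (\<lambda>_ _. c) = (\<lambda>_ _. c)" using Suc.IH by (intro ext)
  then show ?case by simp
qed simp

lemma avg_step_pow_add_const:
  "(avg_step e ^^ n) (\<lambda>x j. g x j + c) x j = (avg_step e ^^ n) g x j + c"
  using avg_step_pow_linear[of n e 1 g 1 "\<lambda>_ _. c" x j] by simp

lemma avg_step_pow_cmult:
  "(avg_step e ^^ n) (\<lambda>x j. c * g x j) x j = c * (avg_step e ^^ n) g x j"
  using avg_step_pow_linear[of n e c g 0 "\<lambda>_ _. 0" x j] by simp

locale drift_seq =
  fixes e :: "nat \<Rightarrow> real"
  assumes e_pos: "0 < e j" and e_less_1: "e j < 1"
begin

abbreviation Q where "Q \<equiv> avg_step e"

lemma Q_mono:
  assumes "\<And>y i. i \<ge> j \<Longrightarrow> g y i \<le> h y i"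
  shows "Q g x j \<le> Q h x j"
proof -
  have "0 \<le> (1 - e j) / 2" "0 \<le> (1 + e j) / 2" using e_pos[of j] e_less_1[of j] by auto
  then show ?thesis unfolding avg_step_def
    by (auto intro!: add_mono mult_left_mono assms)
qed

lemma Q_pow_mono:
  assumes "\<And>y i. i \<ge> j \<Longrightarrow> g y i \<le> h y i"
  shows "(Q ^^ n) g x j \<le> (Q ^^ n) h x j"
  using assms
proof (induction n arbitrary: x j)
  case (Suc n)
  show ?case unfolding funpow.simps o_apply
    by (rule Q_mono) (use Suc in auto)
qed simp

lemma Q_pow_abs:
  "\<bar>(Q ^^ n) g x j\<bar> \<le> (Q ^^ n) (\<lambda>y i. \<bar>g y i\<bar>) x j"
proof -
  have 1: "(Q ^^ n) g x j \<le> (Q ^^ n) (\<lambda>y i. \<bar>g y i\<bar>) x j" by (rule Q_pow_mono) auto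
  have 2: "(Q ^^ n) (\<lambda>y i. - 1 * g y i) x j \<le> (Q ^^ n) (\<lambda>y i. \<bar>g y i\<bar>) x j"
    by (rule Q_pow_mono) auto
  show ?thesis using 1 2 unfolding avg_step_pow_cmult by auto
qed

lemma Q_abs: "\<bar>Q g x j\<bar> \<le> Q (\<lambda>y i. \<bar>g y i\<bar>) x j"
  using Q_pow_abs[of 1] by simp

definition mean_time :: "nat \<Rightarrow> real" where "mean_time m = (\<Sum>i<m. 1 + 1 / e i)"

text \<open>
  The mean time of all excursions begun so far, minus the mean remaining time \<open>x / e j\<close> of the current
  one. At height \<open>0\<close> the next excursion has not begun.
\<close>
definition clock :: "nat \<Rightarrow> nat \<Rightarrow> real" where
  "clock x j = (if x = 0 then mean_time j else mean_time (Suc j) - real x / e j)"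

lemma mean_time_mono: "i \<le> j \<Longrightarrow> mean_time i \<le> mean_time j"
  unfolding mean_time_def by (rule sum_mono2) (auto intro!: add_nonneg_nonneg order.strict_implies_order[OF e_pos])

lemma clock_le: "j < m \<Longrightarrow> clock x j \<le> mean_time m"
proof -
  assume "j < m"
  then have "mean_time (Suc j) \<le> mean_time m" "mean_time j \<le> mean_time m" by (auto intro: mean_time_mono)
  moreover have "0 \<le> real x / e j" using e_pos[of j] by auto
  ultimately show ?thesis by (auto simp: clock_def)
qed

text \<open>
  The squared deviation of the clock from the time \<open>t\<close>, frozen at the value \<open>w\<close> once \<open>m\<close> excursions are
  completed. Freezing confines the argument to the first \<open>m\<close> drifts. The value \<open>w = 0\<close> serves to bound
  the probability of too few excursions, a positive \<open>w\<close> that of too many.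
\<close>
definition clock_dev :: "nat \<Rightarrow> real \<Rightarrow> nat \<Rightarrow> nat \<Rightarrow> nat \<Rightarrow> real" where
  "clock_dev m w t x j = (if j < m then (clock x j - real t)\<^sup>2 else w)"

text \<open>
  The clock gains \<open>1\<close> on average, so the cross term vanishes, and its fluctuation in one step has
  variance at most \<open>B\<^sup>2\<close>. When the frozen region is entered the clock shows \<open>mean_time m\<close>, so that the
  condition on \<open>w\<close> makes the value drop.
\<close>
lemma clock_dev_step:
  assumes B: "\<And>i. i < m \<Longrightarrow> 1 / e i \<le> B" and w: "w \<le> (mean_time m - real (Suc t))\<^sup>2"
  shows "Q (clock_dev m w (Suc t)) x j \<le> clock_dev m w t x j + B\<^sup>2"
proof (cases "j < m")
  case False
  then show ?thesis by (simp add: avg_step_def clock_dev_def field_simps)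
next
  case True
  define r where "r = 1 / e j"
  have r: "r > 0" "e j * r = 1" "r \<le> B" "\<And>y. y / e j = y * r"
    using e_pos[of j] B[OF True] by (auto simp: r_def)
  have mean_time_Suc: "mean_time (Suc j) = mean_time j + 1 + r" by (simp add: mean_time_def r_def)
  show ?thesis
  proof (cases "x = 0")
    case x: True
    then show ?thesis using True by (simp add: avg_step_def clock_dev_def clock_def mean_time_Suc r(4) algebra_simps)
  next
    case x: False
    let ?D = "clock x j - real t"
    have up: "clock_dev m w (Suc t) (x + 1) j = (?D - r - 1)\<^sup>2"
      using x True by (simp add: clock_dev_def clock_def r(4) algebra_simps)
    have down: "clock_dev m w (Suc t) (x - 1) (if x = 1 then Suc j else j) \<le> (?D + r - 1)\<^sup>2"
    proof (cases "x = 1")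
      case x1: True
      show ?thesis
      proof (cases "Suc j < m")
        case T2: True
        then show ?thesis using x1 by (simp add: clock_dev_def clock_def r(4) algebra_simps)
      next
        case F2: False
        then have "m = Suc j" using True by simp
        then show ?thesis using x1 w by (simp add: clock_dev_def clock_def r(4) algebra_simps)
      qed
    next
      case x1: False
      then have "real (x - 1) = real x - 1" using x by (simp add: of_nat_diff)
      then show ?thesis using x x1 True by (simp add: clock_dev_def clock_def r(4) algebra_simps)
    qed
    have q: "0 \<le> (1 + e j) / 2" using e_pos[of j] by auto
    have "Q (clock_dev m w (Suc t)) x j
        \<le> (1 - e j) / 2 * (?D - r - 1)\<^sup>2 + (1 + e j) / 2 * (?D + r - 1)\<^sup>2"
      using x up mult_left_mono[OF down q] by (simp add: avg_step_def)
    also have "\<dots> = ?D\<^sup>2 - 2 * ?D + 1 + r\<^sup>2 + 2 * (e j * r) * ?D - 2 * (e j * r)"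
      by (simp add: power2_eq_square algebra_simps add_divide_distrib diff_divide_distrib)
    also have "\<dots> = ?D\<^sup>2 + r\<^sup>2 - 1" using r(2) by simp
    also have "\<dots> \<le> ?D\<^sup>2 + B\<^sup>2" using r by (smt (verit) power_mono)
    finally show ?thesis using True by (simp add: clock_dev_def)
  qed
qed

lemma clock_second_moment:
  assumes B: "\<And>i. i < m \<Longrightarrow> 1 / e i \<le> B" and w: "\<And>s. s \<le> t \<Longrightarrow> w \<le> (mean_time m - real s)\<^sup>2"
  shows "(Q ^^ t) (clock_dev m w t) 0 0 \<le> real t * B\<^sup>2"
proof -
  have "s \<le> t \<Longrightarrow> (Q ^^ s) (clock_dev m w s) 0 0 \<le> real s * B\<^sup>2" for s
  proof (induction s)
    case 0
    have "w \<le> (mean_time m)\<^sup>2" using w[of 0] by simp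
    then show ?case by (auto simp: clock_dev_def clock_def mean_time_def)
  next
    case (Suc s)
    have "(Q ^^ Suc s) (clock_dev m w (Suc s)) 0 0 = (Q ^^ s) (Q (clock_dev m w (Suc s))) 0 0"
      by (simp only: funpow_Suc_right o_apply)
    also have "\<dots> \<le> (Q ^^ s) (\<lambda>x j. clock_dev m w s x j + B\<^sup>2) 0 0"
      by (rule Q_pow_mono, rule clock_dev_step) (use B w[of "Suc s"] Suc.prems in auto)
    also have "\<dots> = (Q ^^ s) (clock_dev m w s) 0 0 + B\<^sup>2" by (rule avg_step_pow_add_const)
    also have "\<dots> \<le> real (Suc s) * B\<^sup>2" using Suc by (simp add: algebra_simps)
    finally show ?case .
  qed
  then show ?thesis by simp
qed

text \<open>
  Chebyshev's inequality for a clock that is \<open>d\<close> behind the true time. Besides small excursion numbers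
  this event covers the case that the walk is far from \<open>0\<close>.
\<close>
lemma prob_clock_late:
  assumes B: "\<And>i. i < m \<Longrightarrow> 1 / e i \<le> B" and d: "d > 0"
  shows "(Q ^^ t) (\<lambda>x j. if j < m \<and> clock x j \<le> real t - d then 1 else 0) 0 0 \<le> real t * B\<^sup>2 / d\<^sup>2"
proof -
  have "(Q ^^ t) (\<lambda>x j. d\<^sup>2 * (if j < m \<and> clock x j \<le> real t - d then 1 else 0)) 0 0
        \<le> (Q ^^ t) (clock_dev m 0 t) 0 0"
  proof (rule Q_pow_mono)
    fix x j
    have "d\<^sup>2 \<le> (clock x j - real t)\<^sup>2" if "clock x j \<le> real t - d"
    proof -
      have "d\<^sup>2 \<le> (real t - clock x j)\<^sup>2" using that d by (intro power_mono) auto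
      then show ?thesis by (simp add: power2_commute)
    qed
    then show "d\<^sup>2 * (if j < m \<and> clock x j \<le> real t - d then 1 else 0) \<le> clock_dev m 0 t x j"
      by (auto simp: clock_dev_def)
  qed
  also have "\<dots> \<le> real t * B\<^sup>2" by (rule clock_second_moment) (use B in auto)
  finally show ?thesis using d unfolding avg_step_pow_cmult by (simp add: pos_le_divide_eq mult.commute)
qed

lemma prob_many_excursions:
  assumes B: "\<And>i. i < m \<Longrightarrow> 1 / e i \<le> B" and d: "d > 0" "real t + d \<le> mean_time m"
  shows "(Q ^^ t) (\<lambda>x j. if m \<le> j then 1 else 0) 0 0 \<le> real t * B\<^sup>2 / d\<^sup>2"
proof -
  have "(Q ^^ t) (\<lambda>x j. d\<^sup>2 * (if m \<le> j then 1 else 0)) 0 0 \<le> (Q ^^ t) (clock_dev m (d\<^sup>2) t) 0 0"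
    by (rule Q_pow_mono) (auto simp: clock_dev_def)
  also have "\<dots> \<le> real t * B\<^sup>2"
  proof (rule clock_second_moment)
    fix s assume "s \<le> t"
    then show "d\<^sup>2 \<le> (mean_time m - real s)\<^sup>2" using d by (intro power_mono) auto
  qed (use B in auto)
  finally show ?thesis using d unfolding avg_step_pow_cmult by (simp add: pos_le_divide_eq mult.commute)
qed

lemma prob_few_excursions:
  assumes B: "\<And>i. i < m \<Longrightarrow> 1 / e i \<le> B" and d: "d > 0" "mean_time m \<le> real t - d"
  shows "(Q ^^ t) (\<lambda>x j. if j < m then 1 else 0) 0 0 \<le> real t * B\<^sup>2 / d\<^sup>2"
proof -
  have "(Q ^^ t) (\<lambda>x j. if j < m then 1 else 0) 0 0
      \<le> (Q ^^ t) (\<lambda>x j. if j < m \<and> clock x j \<le> real t - d then 1 else 0) 0 0"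
    by (rule Q_pow_mono) (simp add: order_trans[OF clock_le d(2)])
  also have "\<dots> \<le> real t * B\<^sup>2 / d\<^sup>2" by (rule prob_clock_late) (use B d in auto)
  finally show ?thesis .
qed

end

section \<open>The reflected walk with constant drift\<close>

text \<open>
  The averaging operator for constant drift; since the excursion number is irrelevant then, it acts on functions of
  the height alone.
\<close>
definition const_step :: "real \<Rightarrow> (nat \<Rightarrow> real) \<Rightarrow> nat \<Rightarrow> real" where
  "const_step \<epsilon> u x = (if x = 0 then u 1 else (1 - \<epsilon>) / 2 * u (x + 1) + (1 + \<epsilon>) / 2 * u (x - 1))"

lemma const_step_pow_eq:
  "(const_step \<epsilon> ^^ n) u x = (avg_step (\<lambda>_. \<epsilon>) ^^ n) (\<lambda>x _. u x) x j"
proof -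
  have "(avg_step (\<lambda>_. \<epsilon>) ^^ n) (\<lambda>x _. u x) = (\<lambda>x _. (const_step \<epsilon> ^^ n) u x)"
  proof (induction n)
    case (Suc n)
    then show ?case by (intro ext) (simp add: avg_step_def const_step_def)
  qed simp
  then show ?thesis by simp
qed

lemma const_step_pow_linear:
  "(const_step \<epsilon> ^^ n) (\<lambda>x. a * g x + b * h x) x = a * (const_step \<epsilon> ^^ n) g x + b * (const_step \<epsilon> ^^ n) h x"
  by (simp only: const_step_pow_eq[where j = 0] avg_step_pow_linear)

lemma const_step_pow_const: "(const_step \<epsilon> ^^ n) (\<lambda>_. c) x = c"
  by (simp add: const_step_pow_eq[where j = 0])

lemma const_step_pow_abs:
  assumes "0 < \<epsilon>" "\<epsilon> < 1" "\<And>y. \<bar>u y\<bar> \<le> a * v y + c"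
  shows "\<bar>(const_step \<epsilon> ^^ n) u x\<bar> \<le> a * (const_step \<epsilon> ^^ n) v x + c"
proof -
  interpret drift_seq "\<lambda>_. \<epsilon>" by unfold_locales (use assms in auto)
  have "\<bar>(const_step \<epsilon> ^^ n) u x\<bar> \<le> (Q ^^ n) (\<lambda>y _. \<bar>u y\<bar>) x 0"
    unfolding const_step_pow_eq[where j = 0] by (rule Q_pow_abs)
  also have "\<dots> \<le> (Q ^^ n) (\<lambda>y _. a * v y + c * 1) x 0"
    by (rule Q_pow_mono) (use assms in simp)
  also have "\<dots> = a * (const_step \<epsilon> ^^ n) v x + c"
    unfolding const_step_pow_eq[where j = 0]
    using avg_step_pow_linear[of n "\<lambda>_. \<epsilon>" a "\<lambda>y _. v y" c "\<lambda>_ _. 1" x 0] by simp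
  finally show ?thesis .
qed

text \<open>
  The differences \<open>u (x + 2) - u x\<close> are averaged by the same walk, killed when it falls
  below \<open>0\<close>. For this killed walk \<open>(1 + \<epsilon>) ^ x\<close> is an eigenfunction up to the boundary term, since
  \<open>(1 - \<epsilon>) / 2 * (1 + \<epsilon>) + (1 + \<epsilon>) / 2 / (1 + \<epsilon>) = 1 - \<epsilon>\<^sup>2 / 2\<close>.
\<close>
lemma const_step_second_difference:
  assumes e: "0 < \<epsilon>" "\<epsilon> < 1" and u: "\<And>x. \<bar>u (x + 2) - u x\<bar> \<le> K * (1 + \<epsilon>) ^ x"
  shows "\<bar>const_step \<epsilon> u (x + 2) - const_step \<epsilon> u x\<bar> \<le> (K * (1 - \<epsilon>\<^sup>2 / 2)) * (1 + \<epsilon>) ^ x"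
proof -
  have K: "K \<ge> 0" using u[of 0] by simp
  show ?thesis
  proof (cases x)
    case 0
    have "const_step \<epsilon> u (x + 2) - const_step \<epsilon> u x = (1 - \<epsilon>) / 2 * (u (1 + 2) - u 1)"
      using 0 by (simp add: const_step_def eval_nat_numeral field_simps)
    then have "\<bar>const_step \<epsilon> u (x + 2) - const_step \<epsilon> u x\<bar> = (1 - \<epsilon>) / 2 * \<bar>u (1 + 2) - u 1\<bar>"
      using e by (simp only: abs_mult, simp)
    also have "\<dots> \<le> (1 - \<epsilon>) / 2 * (K * (1 + \<epsilon>) ^ 1)" using e by (intro mult_left_mono u) auto
    also have "\<dots> = K * ((1 - \<epsilon>\<^sup>2) / 2)" by (simp add: power2_eq_square field_simps)
    also have "\<dots> \<le> K * (1 - \<epsilon>\<^sup>2 / 2)" using K by (intro mult_left_mono) (auto simp: field_simps)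
    finally show ?thesis using 0 by simp
  next
    case (Suc y)
    have "const_step \<epsilon> u (x + 2) - const_step \<epsilon> u x
        = (1 - \<epsilon>) / 2 * (u ((x + 1) + 2) - u (x + 1)) + (1 + \<epsilon>) / 2 * (u (y + 2) - u y)"
      using Suc by (simp add: const_step_def eval_nat_numeral field_simps)
    also have "\<bar>\<dots>\<bar> \<le> (1 - \<epsilon>) / 2 * \<bar>u ((x + 1) + 2) - u (x + 1)\<bar> + (1 + \<epsilon>) / 2 * \<bar>u (y + 2) - u y\<bar>"
      using e by (intro order_trans[OF abs_triangle_ineq] add_mono) (auto simp: abs_mult)
    also have "\<dots> \<le> (1 - \<epsilon>) / 2 * (K * (1 + \<epsilon>) ^ (x + 1)) + (1 + \<epsilon>) / 2 * (K * (1 + \<epsilon>) ^ y)"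
      using e by (intro add_mono mult_left_mono u) auto
    also have "\<dots> = (K * (1 - \<epsilon>\<^sup>2 / 2)) * (1 + \<epsilon>) ^ x"
      using Suc by (simp add: power2_eq_square field_simps)
    finally show ?thesis .
  qed
qed

lemma const_step_pow_second_difference:
  assumes "0 < \<epsilon>" "\<epsilon> < 1" "\<And>x. \<bar>u (x + 2) - u x\<bar> \<le> K * (1 + \<epsilon>) ^ x"
  shows "\<bar>(const_step \<epsilon> ^^ k) u (x + 2) - (const_step \<epsilon> ^^ k) u x\<bar> \<le> (K * (1 - \<epsilon>\<^sup>2 / 2) ^ k) * (1 + \<epsilon>) ^ x"
proof (induction k arbitrary: x)
  case (Suc k)
  show ?case using const_step_second_difference[OF assms(1,2) Suc] by (simp add: mult_ac)
qed (use assms in simp)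

text \<open>
  Differences between neighbours do not decay, because the walk has period \<open>2\<close>, but they do
  not grow either.
\<close>
lemma const_step_pow_first_difference:
  assumes e: "0 < \<epsilon>" "\<epsilon> < 1" and u: "\<And>x. \<bar>u (x + 1) - u x\<bar> \<le> K"
  shows "\<bar>(const_step \<epsilon> ^^ k) u (x + 1) - (const_step \<epsilon> ^^ k) u x\<bar> \<le> K"
proof (induction k arbitrary: x)
  case (Suc k)
  let ?u = "(const_step \<epsilon> ^^ k) u"
  obtain y z where yz: "const_step \<epsilon> ?u (x + 1) - const_step \<epsilon> ?u x
      = (1 - \<epsilon>) / 2 * (?u (y + 1) - ?u y) + (1 + \<epsilon>) / 2 * (?u (z + 1) - ?u z)
    \<or> const_step \<epsilon> ?u (x + 1) - const_step \<epsilon> ?u x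
      = (1 - \<epsilon>) / 2 * (?u (y + 1) - ?u y) - (1 + \<epsilon>) / 2 * (?u (z + 1) - ?u z)"
  proof (cases x)
    case 0
    have "const_step \<epsilon> ?u (x + 1) - const_step \<epsilon> ?u x
      = (1 - \<epsilon>) / 2 * (?u (1 + 1) - ?u 1) - (1 + \<epsilon>) / 2 * (?u (0 + 1) - ?u 0)"
      using 0 by (simp add: const_step_def field_simps)
    then show thesis using that by blast
  next
    case (Suc y)
    have "const_step \<epsilon> ?u (x + 1) - const_step \<epsilon> ?u x
      = (1 - \<epsilon>) / 2 * (?u (x + 1 + 1) - ?u (x + 1)) + (1 + \<epsilon>) / 2 * (?u (y + 1) - ?u y)"
      using Suc by (simp add: const_step_def field_simps)
    then show thesis using that by blast
  qed
  then have "\<bar>const_step \<epsilon> ?u (x + 1) - const_step \<epsilon> ?u x\<bar>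
      \<le> \<bar>(1 - \<epsilon>) / 2 * (?u (y + 1) - ?u y)\<bar> + \<bar>(1 + \<epsilon>) / 2 * (?u (z + 1) - ?u z)\<bar>" by linarith
  also have "\<dots> = (1 - \<epsilon>) / 2 * \<bar>?u (y + 1) - ?u y\<bar> + (1 + \<epsilon>) / 2 * \<bar>?u (z + 1) - ?u z\<bar>"
    using e by (simp add: abs_mult)
  also have "\<dots> \<le> (1 - \<epsilon>) / 2 * K + (1 + \<epsilon>) / 2 * K"
    using e by (intro add_mono mult_left_mono Suc) auto
  also have "\<dots> = K" by (simp add: field_simps)
  finally show ?case by simp
qed (use assms in simp)

text \<open>
  The dependence on the starting point: heights of equal parity are linked by second differences, which
  decay, and a change of parity costs at most \<open>L * \<epsilon>\<close>, which is small since \<open>\<epsilon>\<close> is.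
\<close>
lemma const_step_pow_oscillation:
  assumes e: "0 < \<epsilon>" "\<epsilon> < 1"
    and u1: "\<And>x. \<bar>u (x + 1) - u x\<bar> \<le> L * \<epsilon>" and u2: "\<And>x. \<bar>u (x + 2) - u x\<bar> \<le> (K * \<epsilon>) * (1 + \<epsilon>) ^ x"
  shows "\<bar>(const_step \<epsilon> ^^ k) u x - (const_step \<epsilon> ^^ k) u 0\<bar> \<le> L * \<epsilon> + K * (1 - \<epsilon>\<^sup>2 / 2) ^ k * (1 + \<epsilon>) ^ x"
proof (induction x rule: induct_nat_012)
  case 0
  have "0 \<le> L * \<epsilon>" using u1[of 0] by simp
  moreover have "0 \<le> K * \<epsilon>" using u2[of 0] by simp
  then have "0 \<le> K" using e by (simp add: zero_le_mult_iff)
  moreover have "\<epsilon>\<^sup>2 \<le> 1" using e by (simp add: power_le_one)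
  ultimately show ?case by simp
next
  case 1
  have "0 \<le> K * \<epsilon>" using u2[of 0] by simp
  then have "0 \<le> K" using e by (simp add: zero_le_mult_iff)
  moreover have "\<epsilon>\<^sup>2 \<le> 1" using e by (simp add: power_le_one)
  ultimately have "0 \<le> K * (1 - \<epsilon>\<^sup>2 / 2) ^ k * (1 + \<epsilon>) ^ 1" using e by simp
  then show ?case using const_step_pow_first_difference[where K = "L * \<epsilon>" and u = u and k = k and x = 0, OF e u1] by simp
next
  case (ge2 x)
  let ?u = "(const_step \<epsilon> ^^ k) u" and ?c = "(1 - \<epsilon>\<^sup>2 / 2) ^ k"
  have "0 \<le> K * \<epsilon>" using u2[of 0] by simp
  then have K: "0 \<le> K" using e by (simp add: zero_le_mult_iff)
  have "\<epsilon>\<^sup>2 \<le> 1" using e by (simp add: power_le_one)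
  then have c: "0 \<le> K * ?c" using K by simp
  have "\<bar>?u (x + 2) - ?u 0\<bar> \<le> \<bar>?u (x + 2) - ?u x\<bar> + \<bar>?u x - ?u 0\<bar>" by simp
  also have "\<dots> \<le> (K * \<epsilon> * ?c) * (1 + \<epsilon>) ^ x + (L * \<epsilon> + K * ?c * (1 + \<epsilon>) ^ x)"
    by (intro add_mono const_step_pow_second_difference[OF e u2] ge2)
  also have "\<dots> = L * \<epsilon> + (K * ?c) * ((1 + \<epsilon>) ^ x * (1 + \<epsilon>))" by (simp add: algebra_simps)
  also have "\<dots> \<le> L * \<epsilon> + (K * ?c) * (1 + \<epsilon>) ^ (x + 2)"
    using c e by (intro add_left_mono mult_left_mono) (auto simp: mult_left_mono mult_le_cancel_left1)
  finally show ?case by (simp add: eval_nat_numeral)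
qed

text \<open>
  A Lyapunov function that dominates the weight \<open>(1 + \<epsilon>) ^ x\<close>. The second summand makes it flat at \<open>0\<close>
  up to order \<open>\<epsilon>\<^sup>2\<close>, so that the reflection at \<open>0\<close> adds only a term of order \<open>\<epsilon>\<^sup>2\<close>.
\<close>
definition lyap :: "real \<Rightarrow> nat \<Rightarrow> real" where
  "lyap \<epsilon> x = (1 + \<epsilon>) ^ x + (1 / (1 + \<epsilon>)) ^ x"

lemma lyap_bounds:
  assumes "0 < \<epsilon>"
  shows "(1 + \<epsilon>) ^ x \<le> lyap \<epsilon> x" "1 \<le> lyap \<epsilon> x" "lyap \<epsilon> x \<le> 2 * (1 + \<epsilon>) ^ x" "\<epsilon> * real x \<le> lyap \<epsilon> x"
proof -
  have 1: "1 \<le> (1 + \<epsilon>) ^ x" "0 < (1 / (1 + \<epsilon>)) ^ x" "(1 / (1 + \<epsilon>)) ^ x \<le> 1"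
    using assms by (auto intro: power_le_one)
  then show "(1 + \<epsilon>) ^ x \<le> lyap \<epsilon> x" "1 \<le> lyap \<epsilon> x" "lyap \<epsilon> x \<le> 2 * (1 + \<epsilon>) ^ x"
    unfolding lyap_def by linarith+
  have "1 + real x * \<epsilon> \<le> (1 + \<epsilon>) ^ x" using assms by (intro Bernoulli_inequality) auto
  then show "\<epsilon> * real x \<le> lyap \<epsilon> x" using 1 unfolding lyap_def by (simp add: mult.commute)
qed

text \<open>
  The estimate tolerates a drift \<open>c\<close> that differs from \<open>\<epsilon>\<close> by a factor between \<open>3/4\<close> and \<open>3/2\<close>; this slack is used
  for the walk whose drift varies.
\<close>
lemma lyap_step:
  assumes e: "0 < \<epsilon>" "\<epsilon> < 1" and c: "3/4 * \<epsilon> \<le> c" "c \<le> 3/2 * \<epsilon>" "c \<le> 1"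
  shows "(if x = 0 then lyap \<epsilon> 1 else (1 - c) / 2 * lyap \<epsilon> (x + 1) + (1 + c) / 2 * lyap \<epsilon> (x - 1))
    \<le> (1 - \<epsilon>\<^sup>2 / 4) * lyap \<epsilon> x + 3 * \<epsilon>\<^sup>2"
proof -
  define s where "s = 1 / (1 + \<epsilon>)"
  have s: "s * (1 + \<epsilon>) = 1" "0 < s" "s \<le> 1" using e by (auto simp: s_def)
  have s_le: "s \<le> 1 - \<epsilon> + \<epsilon>\<^sup>2"
  proof -
    have "1 \<le> (1 - \<epsilon> + \<epsilon>\<^sup>2) * (1 + \<epsilon>)" using e by (simp add: power2_eq_square algebra_simps)
    then show ?thesis unfolding s_def using e by (simp add: pos_divide_le_eq)
  qed
  show ?thesis
  proof (cases x)
    case 0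
    have "lyap \<epsilon> 1 = 1 + \<epsilon> + s" by (simp add: lyap_def s_def)
    also have "\<dots> \<le> (1 - \<epsilon>\<^sup>2 / 4) * 2 + 3 * \<epsilon>\<^sup>2" using s_le zero_le_power2[of \<epsilon>] by argo
    finally show ?thesis using 0 by (simp add: lyap_def)
  next
    case (Suc y)
    let ?a = "(1 + \<epsilon>) ^ y" and ?b = "s ^ Suc y"
    have b: "0 \<le> ?b" "?b \<le> 1" using s power_le_one[of s "Suc y"] by auto
    have a: "0 \<le> ?a" using e by simp
    have sy: "s ^ y = ?b * (1 + \<epsilon>)" using s(1) by (simp add: mult.assoc)
    have V: "lyap \<epsilon> (x + 1) = ?a * (1 + \<epsilon>)\<^sup>2 + ?b * s" "lyap \<epsilon> x = ?a * (1 + \<epsilon>) + ?b"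
      "lyap \<epsilon> (x - 1) = ?a + ?b * (1 + \<epsilon>)"
      using Suc sy by (auto simp: lyap_def s_def[symmetric] power2_eq_square)
    have A: "(1 - c) / 2 * (1 + \<epsilon>)\<^sup>2 + (1 + c) / 2 \<le> (1 - \<epsilon>\<^sup>2 / 4) * (1 + \<epsilon>)"
    proof -
      have "(1 - c) / 2 * (1 + \<epsilon>)\<^sup>2 + (1 + c) / 2 = 1 + \<epsilon> + \<epsilon>\<^sup>2 / 2 - c * (\<epsilon> + \<epsilon>\<^sup>2 / 2)"
        by (simp add: power2_eq_square field_simps)
      moreover have "c * (\<epsilon> + \<epsilon>\<^sup>2 / 2) \<ge> 3/4 * \<epsilon> * (\<epsilon> + \<epsilon>\<^sup>2 / 2)"
        using c e by (intro mult_right_mono) auto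
      moreover have "1 + \<epsilon> + \<epsilon>\<^sup>2 / 2 - 3/4 * \<epsilon> * (\<epsilon> + \<epsilon>\<^sup>2 / 2) = (1 - \<epsilon>\<^sup>2 / 4) * (1 + \<epsilon>) - \<epsilon> ^ 3 / 8"
        by (simp add: power2_eq_square power3_eq_cube field_simps)
      moreover have "0 \<le> \<epsilon> ^ 3" using e by simp
      ultimately show ?thesis by linarith
    qed
    have "(1 - c) / 2 * s + (1 + c) / 2 * (1 + \<epsilon>) \<le> (1 - c) / 2 * (1 - \<epsilon> + \<epsilon>\<^sup>2) + (1 + c) / 2 * (1 + \<epsilon>)"
      using c s_le by (intro add_right_mono mult_left_mono) auto
    also have "\<dots> = 1 + \<epsilon>\<^sup>2 / 2 + c * \<epsilon> - c * \<epsilon>\<^sup>2 / 2" by (simp add: power2_eq_square field_simps)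
    also have "\<dots> \<le> 1 + 2 * \<epsilon>\<^sup>2"
    proof -
      have "c * \<epsilon> \<le> 3/2 * \<epsilon> * \<epsilon>" "0 \<le> c * \<epsilon>\<^sup>2" using c e by (auto intro!: mult_right_mono)
      then show ?thesis by (simp add: power2_eq_square)
    qed
    finally have B: "(1 - c) / 2 * s + (1 + c) / 2 * (1 + \<epsilon>) \<le> 1 + 2 * \<epsilon>\<^sup>2" .
    have "(1 - c) / 2 * lyap \<epsilon> (x + 1) + (1 + c) / 2 * lyap \<epsilon> (x - 1)
        = ?a * ((1 - c) / 2 * (1 + \<epsilon>)\<^sup>2 + (1 + c) / 2) + ?b * ((1 - c) / 2 * s + (1 + c) / 2 * (1 + \<epsilon>))"
      unfolding V by (simp add: field_simps)
    also have "\<dots> \<le> ?a * ((1 - \<epsilon>\<^sup>2 / 4) * (1 + \<epsilon>)) + ?b * (1 + 2 * \<epsilon>\<^sup>2)"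
      by (rule add_mono[OF mult_left_mono[OF A a] mult_left_mono[OF B b(1)]])
    also have "\<dots> = (1 - \<epsilon>\<^sup>2 / 4) * lyap \<epsilon> x + ?b * (9/4 * \<epsilon>\<^sup>2)"
      unfolding V by (simp add: algebra_simps)
    also have "?b * (9/4 * \<epsilon>\<^sup>2) \<le> 1 * (3 * \<epsilon>\<^sup>2)" using b by (intro mult_mono) auto
    finally show ?thesis using Suc by simp
  qed
qed

lemma const_step_pow_lyap:
  assumes e: "0 < \<epsilon>" "\<epsilon> < 1"
  shows "(const_step \<epsilon> ^^ n) (lyap \<epsilon>) 0 \<le> 12"
proof (induction n)
  case (Suc n)
  interpret drift_seq "\<lambda>_. \<epsilon>" by unfold_locales (use e in auto)
  have step: "const_step \<epsilon> (lyap \<epsilon>) y \<le> (1 - \<epsilon>\<^sup>2 / 4) * lyap \<epsilon> y + 3 * \<epsilon>\<^sup>2 * 1" for y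
    using lyap_step[OF e, of \<epsilon> y] e by (simp add: const_step_def)
  have "(const_step \<epsilon> ^^ Suc n) (lyap \<epsilon>) 0 = (const_step \<epsilon> ^^ n) (const_step \<epsilon> (lyap \<epsilon>)) 0"
    by (simp only: funpow_Suc_right o_apply)
  also have "\<dots> \<le> (const_step \<epsilon> ^^ n) (\<lambda>y. (1 - \<epsilon>\<^sup>2 / 4) * lyap \<epsilon> y + 3 * \<epsilon>\<^sup>2 * 1) 0"
    unfolding const_step_pow_eq[where j = 0] by (rule Q_pow_mono, rule step)
  also have "\<dots> = (1 - \<epsilon>\<^sup>2 / 4) * (const_step \<epsilon> ^^ n) (lyap \<epsilon>) 0 + 3 * \<epsilon>\<^sup>2"
    unfolding const_step_pow_linear const_step_pow_const by simp
  also have "\<dots> \<le> (1 - \<epsilon>\<^sup>2 / 4) * 12 + 3 * \<epsilon>\<^sup>2"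
  proof -
    have "\<epsilon>\<^sup>2 \<le> 1" using e by (simp add: power_le_one)
    then show ?thesis using Suc by (intro add_right_mono mult_left_mono) auto
  qed
  also have "\<dots> = 12" by simp
  finally show ?case .
qed (simp add: lyap_def)

text \<open>
  The mean of \<open>cos (\<theta> * x)\<close> under the stationary law of the reflected walk with drift \<open>\<epsilon>\<close>.
\<close>
definition stat_cos :: "real \<Rightarrow> real \<Rightarrow> real" where
  "stat_cos \<epsilon> \<theta> = \<epsilon>\<^sup>2 * (sin \<theta>)\<^sup>2 / ((1 - cos \<theta>)\<^sup>2 + \<epsilon>\<^sup>2 * (sin \<theta>)\<^sup>2)"

text \<open>
  The operator maps \<open>cos (\<theta> * x)\<close> and \<open>sin (\<theta> * x)\<close> to combinations of the two, up to a defect at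
  \<open>0\<close> caused by the reflection, and this defect is compensated by a multiple of \<open>x\<close>. Solving the linear
  equations for the coefficients gives \<open>G\<close>, and the drift of the linear part produces the constant \<open>stat_cos \<epsilon> \<theta>\<close>.
\<close>
lemma poisson_equation_cos:
  assumes e: "0 < \<epsilon>" "\<epsilon> < 1" and s: "sin \<theta> \<noteq> 0"
  shows "\<exists>G K. (\<forall>x. const_step \<epsilon> G x - G x = cos (\<theta> * real x) - stat_cos \<epsilon> \<theta>) \<and> (\<forall>x. \<bar>G x\<bar> \<le> K * lyap \<epsilon> x)"
proof -
  define D where "D = (1 - cos \<theta>)\<^sup>2 + \<epsilon>\<^sup>2 * (sin \<theta>)\<^sup>2"
  have D: "D > 0" unfolding D_def using e s by (intro add_nonneg_pos) auto
  define a where "a = - (1 - cos \<theta>) / D"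
  define b where "b = - \<epsilon> * sin \<theta> / D"
  define c where "c = \<epsilon> * (sin \<theta>)\<^sup>2 / D"
  have eqs: "a * (cos \<theta> - 1) - b * \<epsilon> * sin \<theta> = 1" "a * \<epsilon> * sin \<theta> + b * (cos \<theta> - 1) = 0"
    "b * sin \<theta> + c = 0" "c * \<epsilon> = stat_cos \<epsilon> \<theta>"
  proof -
    have "a * (cos \<theta> - 1) - b * \<epsilon> * sin \<theta> = ((1 - cos \<theta>)\<^sup>2 + \<epsilon>\<^sup>2 * (sin \<theta>)\<^sup>2) / D"
      by (simp add: a_def b_def power2_eq_square add_divide_distrib[symmetric] diff_divide_distrib[symmetric] algebra_simps)
    then show "a * (cos \<theta> - 1) - b * \<epsilon> * sin \<theta> = 1" using D by (simp add: D_def)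
    show "a * \<epsilon> * sin \<theta> + b * (cos \<theta> - 1) = 0"
      by (simp add: a_def b_def add_divide_distrib[symmetric] algebra_simps)
    show "b * sin \<theta> + c = 0" by (simp add: b_def c_def power2_eq_square)
    show "c * \<epsilon> = stat_cos \<epsilon> \<theta>" by (simp add: c_def stat_cos_def D_def power2_eq_square mult_ac)
  qed
  define G where "G x = a * cos (\<theta> * real x) + b * sin (\<theta> * real x) + c * real x" for x :: nat
  have "const_step \<epsilon> G x - G x = cos (\<theta> * real x) - stat_cos \<epsilon> \<theta>" for x
  proof (cases "x = 0")
    case True
    have "const_step \<epsilon> G x - G x = a * (cos \<theta> - 1) + (b * sin \<theta> + c)"
      using True by (simp add: const_step_def G_def algebra_simps)
    also have "\<dots> = a * (cos \<theta> - 1)" using eqs by simp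
    also have "\<dots> = 1 + b * sin \<theta> * \<epsilon>" using eqs(1) by (simp add: algebra_simps)
    also have "b * sin \<theta> = - c" using eqs(3) by simp
    finally show ?thesis using True eqs(4) by simp
  next
    case False
    let ?C = "cos (\<theta> * real x)" and ?S = "sin (\<theta> * real x)"
    have up: "cos (\<theta> * real (x + 1)) = ?C * cos \<theta> - ?S * sin \<theta>"
      "sin (\<theta> * real (x + 1)) = ?S * cos \<theta> + ?C * sin \<theta>"
      by (simp_all add: distrib_left cos_add sin_add)
    have xm: "\<theta> * real (x - 1) = \<theta> * real x - \<theta>" using False by (simp add: of_nat_diff algebra_simps)
    have dn: "cos (\<theta> * real (x - 1)) = ?C * cos \<theta> + ?S * sin \<theta>"
      "sin (\<theta> * real (x - 1)) = ?S * cos \<theta> - ?C * sin \<theta>"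
      unfolding xm by (simp_all add: cos_diff sin_diff)
    have "const_step \<epsilon> G x - G x = ?C * (a * (cos \<theta> - 1) - b * \<epsilon> * sin \<theta>)
        + ?S * (a * \<epsilon> * sin \<theta> + b * (cos \<theta> - 1)) - c * \<epsilon>"
      using False unfolding const_step_def G_def up dn by (simp add: of_nat_diff field_simps)
    then show ?thesis unfolding eqs by simp
  qed
  moreover have "\<bar>G x\<bar> \<le> (\<bar>a\<bar> + \<bar>b\<bar> + \<bar>c\<bar> / \<epsilon>) * lyap \<epsilon> x" for x
  proof -
    have "\<bar>G x\<bar> \<le> \<bar>a * cos (\<theta> * real x)\<bar> + \<bar>b * sin (\<theta> * real x)\<bar> + \<bar>c * real x\<bar>"
      unfolding G_def by linarith
    also have "\<dots> \<le> \<bar>a\<bar> * lyap \<epsilon> x + \<bar>b\<bar> * lyap \<epsilon> x + \<bar>c\<bar> / \<epsilon> * lyap \<epsilon> x"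
    proof (intro add_mono)
      have 1: "1 \<le> lyap \<epsilon> x" using lyap_bounds(2) e by blast
      show "\<bar>a * cos (\<theta> * real x)\<bar> \<le> \<bar>a\<bar> * lyap \<epsilon> x"
        unfolding abs_mult by (intro mult_left_mono order_trans[OF abs_cos_le_one 1]) auto
      show "\<bar>b * sin (\<theta> * real x)\<bar> \<le> \<bar>b\<bar> * lyap \<epsilon> x"
        unfolding abs_mult by (intro mult_left_mono order_trans[OF abs_sin_le_one 1]) auto
      have "\<bar>c * real x\<bar> = \<bar>c\<bar> / \<epsilon> * (\<epsilon> * real x)" using e by (simp add: abs_mult)
      also have "\<dots> \<le> \<bar>c\<bar> / \<epsilon> * lyap \<epsilon> x" using e lyap_bounds(4) by (intro mult_left_mono) auto
      finally show "\<bar>c * real x\<bar> \<le> \<bar>c\<bar> / \<epsilon> * lyap \<epsilon> x" .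
    qed
    finally show ?thesis by (simp add: algebra_simps)
  qed
  ultimately show ?thesis by blast
qed

lemma cos_differences:
  fixes s \<epsilon> :: real
  assumes "0 < \<epsilon>"
  shows "\<bar>cos (s * \<epsilon> * real (x + 1)) - cos (s * \<epsilon> * real x)\<bar> \<le> \<bar>s\<bar> * \<epsilon>"
    and "\<bar>cos (s * \<epsilon> * real (x + 2)) - cos (s * \<epsilon> * real x)\<bar> \<le> (2 * \<bar>s\<bar> * \<epsilon>) * (1 + \<epsilon>) ^ x"
proof -
  have lip: "\<bar>cos a - cos b\<bar> \<le> \<bar>a - b\<bar>" for a b :: real
  proof -
    have "\<bar>cos a - cos b\<bar> = 2 * \<bar>sin ((a + b) / 2)\<bar> * \<bar>sin ((b - a) / 2)\<bar>"
      unfolding cos_diff_cos by (simp add: abs_mult)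
    also have "\<dots> \<le> 2 * 1 * \<bar>(b - a) / 2\<bar>"
      by (intro mult_mono abs_sin_x_le_abs_x) auto
    finally show ?thesis by (simp add: abs_minus_commute)
  qed
  show "\<bar>cos (s * \<epsilon> * real (x + 1)) - cos (s * \<epsilon> * real x)\<bar> \<le> \<bar>s\<bar> * \<epsilon>"
    using lip[of "s * \<epsilon> * real (x + 1)" "s * \<epsilon> * real x"] assms by (simp add: algebra_simps abs_mult)
  have "\<bar>cos (s * \<epsilon> * real (x + 2)) - cos (s * \<epsilon> * real x)\<bar> \<le> 2 * \<bar>s\<bar> * \<epsilon>"
    using lip[of "s * \<epsilon> * real (x + 2)" "s * \<epsilon> * real x"] assms by (simp add: algebra_simps abs_mult)
  also have "\<dots> \<le> (2 * \<bar>s\<bar> * \<epsilon>) * (1 + \<epsilon>) ^ x"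
    using mult_left_mono[OF one_le_power[of "1 + \<epsilon>" x], of "2 * \<bar>s\<bar> * \<epsilon>"] assms by simp
  finally show "\<bar>cos (s * \<epsilon> * real (x + 2)) - cos (s * \<epsilon> * real x)\<bar> \<le> (2 * \<bar>s\<bar> * \<epsilon>) * (1 + \<epsilon>) ^ x" .
qed

text \<open>
  By the Poisson equation the averages of \<open>u (k + i) 0\<close> over \<open>i < N\<close> converge to \<open>stat_cos\<close> as \<open>N\<close> grows.
  All these values are within \<open>R\<close> of \<open>u k 0\<close>, because averaging \<open>u k\<close> over further steps changes it only by its
  oscillation; hence so is their limit.
\<close>
lemma const_drift_cos_limit:
  assumes e: "0 < \<epsilon>" "\<epsilon> < 1" and s: "sin (s * \<epsilon>) \<noteq> 0"
  shows "\<bar>(const_step \<epsilon> ^^ k) (\<lambda>x. cos (s * \<epsilon> * real x)) 0 - stat_cos \<epsilon> (s * \<epsilon>)\<bar>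
    \<le> \<bar>s\<bar> * \<epsilon> + 24 * \<bar>s\<bar> * (1 - \<epsilon>\<^sup>2 / 2) ^ k"
proof -
  define f where "f x = cos (s * \<epsilon> * real x)" for x :: nat
  define u where "u i = (const_step \<epsilon> ^^ i) f" for i
  define R where "R = \<bar>s\<bar> * \<epsilon> + 24 * \<bar>s\<bar> * (1 - \<epsilon>\<^sup>2 / 2) ^ k"
  have "\<epsilon>\<^sup>2 \<le> 1" using e by (simp add: power_le_one)
  then have lam: "0 \<le> (1 - \<epsilon>\<^sup>2 / 2) ^ k" by simp
  have near: "\<bar>u (k + i) 0 - u k 0\<bar> \<le> R" for i
  proof -
    have osc: "\<bar>u k x - u k 0\<bar> \<le> (2 * \<bar>s\<bar> * (1 - \<epsilon>\<^sup>2 / 2) ^ k) * lyap \<epsilon> x + \<bar>s\<bar> * \<epsilon>" for x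
    proof -
      have "\<bar>u k x - u k 0\<bar> \<le> \<bar>s\<bar> * \<epsilon> + 2 * \<bar>s\<bar> * (1 - \<epsilon>\<^sup>2 / 2) ^ k * (1 + \<epsilon>) ^ x"
        unfolding u_def
        by (rule const_step_pow_oscillation) (use e cos_differences[of \<epsilon> s] in \<open>auto simp: f_def\<close>)
      also have "\<dots> \<le> \<bar>s\<bar> * \<epsilon> + 2 * \<bar>s\<bar> * (1 - \<epsilon>\<^sup>2 / 2) ^ k * lyap \<epsilon> x"
        using lyap_bounds(1)[OF e(1)] lam by (intro add_left_mono mult_left_mono) auto
      finally show ?thesis by simp
    qed
    have "u (k + i) 0 - u k 0 = (const_step \<epsilon> ^^ i) (\<lambda>x. 1 * u k x + (- u k 0) * 1) 0"
      unfolding const_step_pow_linear const_step_pow_const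
      by (simp add: u_def funpow_add add.commute[of k])
    also have "\<bar>\<dots>\<bar> \<le> (2 * \<bar>s\<bar> * (1 - \<epsilon>\<^sup>2 / 2) ^ k) * (const_step \<epsilon> ^^ i) (lyap \<epsilon>) 0 + \<bar>s\<bar> * \<epsilon>"
      by (rule const_step_pow_abs[OF e]) (use osc in simp)
    also have "\<dots> \<le> (2 * \<bar>s\<bar> * (1 - \<epsilon>\<^sup>2 / 2) ^ k) * 12 + \<bar>s\<bar> * \<epsilon>"
      using const_step_pow_lyap[OF e] lam by (intro add_right_mono mult_left_mono) auto
    finally show ?thesis by (simp add: R_def)
  qed
  obtain G K where G: "\<And>x. const_step \<epsilon> G x - G x = f x - stat_cos \<epsilon> (s * \<epsilon>)" "\<And>x. \<bar>G x\<bar> \<le> K * lyap \<epsilon> x"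
    using poisson_equation_cos[OF e s] unfolding f_def by blast
  have Gb: "\<bar>(const_step \<epsilon> ^^ i) G 0\<bar> \<le> 12 * \<bar>K\<bar>" for i
  proof -
    have "\<bar>(const_step \<epsilon> ^^ i) G 0\<bar> \<le> \<bar>K\<bar> * (const_step \<epsilon> ^^ i) (lyap \<epsilon>) 0 + 0"
    proof (rule const_step_pow_abs[OF e])
      fix y
      have "K * lyap \<epsilon> y \<le> \<bar>K\<bar> * lyap \<epsilon> y"
        using lyap_bounds(2)[OF e(1), of y] by (intro mult_right_mono) auto
      then show "\<bar>G y\<bar> \<le> \<bar>K\<bar> * lyap \<epsilon> y + 0" using G(2)[of y] by simp
    qed
    also have "\<dots> \<le> \<bar>K\<bar> * 12 + 0" using const_step_pow_lyap[OF e] by (intro add_mono mult_left_mono) auto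
    finally show ?thesis by simp
  qed
  have tel: "(\<Sum>i<N. u (k + i) 0 - stat_cos \<epsilon> (s * \<epsilon>)) = (const_step \<epsilon> ^^ (k + N)) G 0 - (const_step \<epsilon> ^^ k) G 0" for N
  proof (induction N)
    case (Suc N)
    have "(const_step \<epsilon> ^^ (k + Suc N)) G 0 = (const_step \<epsilon> ^^ (k + N)) (const_step \<epsilon> G) 0"
      by (simp only: add_Suc_right funpow_Suc_right o_apply)
    also have "const_step \<epsilon> G = (\<lambda>x. 1 * (1 * G x + 1 * f x) + (- stat_cos \<epsilon> (s * \<epsilon>)) * 1)"
      using G(1) by (intro ext) (simp add: algebra_simps)
    also have "(const_step \<epsilon> ^^ (k + N)) \<dots> 0 = (const_step \<epsilon> ^^ (k + N)) G 0 + u (k + N) 0 - stat_cos \<epsilon> (s * \<epsilon>)"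
      unfolding const_step_pow_linear const_step_pow_const u_def by simp
    finally show ?case using Suc by simp
  qed simp
  define \<Delta> where "\<Delta> = \<bar>u k 0 - stat_cos \<epsilon> (s * \<epsilon>)\<bar>"
  have avg: "real N * (\<Delta> - R) \<le> 24 * \<bar>K\<bar>" for N
  proof -
    have "real N * (u k 0 - stat_cos \<epsilon> (s * \<epsilon>))
        = (\<Sum>i<N. u (k + i) 0 - stat_cos \<epsilon> (s * \<epsilon>)) - (\<Sum>i<N. u (k + i) 0 - u k 0)"
      by (simp add: sum_subtractf[symmetric] algebra_simps)
    also have "\<bar>\<dots>\<bar> \<le> \<bar>(const_step \<epsilon> ^^ (k + N)) G 0 - (const_step \<epsilon> ^^ k) G 0\<bar> + \<bar>\<Sum>i<N. u (k + i) 0 - u k 0\<bar>"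
      unfolding tel by linarith
    also have "\<dots> \<le> (12 * \<bar>K\<bar> + 12 * \<bar>K\<bar>) + (\<Sum>i<N. R)"
    proof (rule add_mono)
      show "\<bar>(const_step \<epsilon> ^^ (k + N)) G 0 - (const_step \<epsilon> ^^ k) G 0\<bar> \<le> 12 * \<bar>K\<bar> + 12 * \<bar>K\<bar>"
        using Gb[of "k + N"] Gb[of k] by linarith
      show "\<bar>\<Sum>i<N. u (k + i) 0 - u k 0\<bar> \<le> (\<Sum>i<N. R)"
        by (rule order_trans[OF sum_abs]) (intro sum_mono near)
    qed
    finally have "real N * \<Delta> \<le> 24 * \<bar>K\<bar> + real N * R" by (simp add: \<Delta>_def abs_mult)
    then show ?thesis by (simp add: algebra_simps)
  qed
  have "\<Delta> \<le> R"
  proof (rule ccontr)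
    assume "\<not> \<Delta> \<le> R"
    then obtain N where "24 * \<bar>K\<bar> < real N * (\<Delta> - R)"
      using reals_Archimedean3[of "\<Delta> - R"] by auto
    then show False using avg[of N] by simp
  qed
  then show ?thesis by (simp add: \<Delta>_def R_def u_def f_def[abs_def])
qed

text \<open>
  Dividing numerator and denominator by \<open>(E n) ^ 4\<close> leaves expressions in \<open>sin y / y\<close> with \<open>y \<rightarrow> 0\<close>,
  where \<open>1 - cos\<close> is rewritten as twice the square of a sine.
\<close>
lemma stat_cos_tendsto:
  assumes s: "s \<noteq> 0" and E: "E \<longlonglongrightarrow> 0" "\<forall>\<^sub>F n in sequentially. 0 < E n"
  shows "(\<lambda>n. stat_cos (E n) (s * E n)) \<longlonglongrightarrow> 4 / (4 + s\<^sup>2)"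
proof -
  define g where "g n = sin (s * E n) / (s * E n)" for n
  define h where "h n = sin (s * E n / 2) / (s * E n / 2)" for n
  have quot: "(\<lambda>n. sin (u n) / u n) \<longlonglongrightarrow> (1::real)" if "u \<longlonglongrightarrow> 0" "\<forall>\<^sub>F n in sequentially. u n \<noteq> 0" for u
  proof -
    have "((\<lambda>x::real. sin x / x) \<longlongrightarrow> 1) (at 0)"
      using DERIV_sin[of "0::real"] by (simp add: DERIV_def)
    moreover have "filterlim u (at 0) sequentially" using that by (simp add: filterlim_at)
    ultimately show ?thesis by (rule filterlim_compose)
  qed
  have lin: "(\<lambda>n. s * E n) \<longlonglongrightarrow> 0" using E(1) by (rule tendsto_mult_right_zero)
  have g: "g \<longlonglongrightarrow> 1"
    unfolding g_def by (rule quot[OF lin]) (use s in \<open>auto intro: eventually_mono[OF E(2)]\<close>)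
  have h: "h \<longlonglongrightarrow> 1"
    unfolding h_def by (rule quot[OF tendsto_divide_zero[OF lin]]) (use s in \<open>auto intro: eventually_mono[OF E(2)]\<close>)
  have "(\<lambda>n. s\<^sup>2 * (g n)\<^sup>2 / ((s\<^sup>2 / 2 * (h n)\<^sup>2)\<^sup>2 + s\<^sup>2 * (g n)\<^sup>2)) \<longlonglongrightarrow> s\<^sup>2 * 1\<^sup>2 / ((s\<^sup>2 / 2 * 1\<^sup>2)\<^sup>2 + s\<^sup>2 * 1\<^sup>2)"
    by (intro tendsto_intros g h) (use s in \<open>auto simp: add_nonneg_eq_0_iff\<close>)
  also have "s\<^sup>2 * 1\<^sup>2 / ((s\<^sup>2 / 2 * 1\<^sup>2)\<^sup>2 + s\<^sup>2 * 1\<^sup>2) = s\<^sup>2 / (s\<^sup>2 * ((4 + s\<^sup>2) / 4))"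
    by (simp add: power2_eq_square field_simps)
  also have "\<dots> = 4 / (4 + s\<^sup>2)" using s by simp
  finally have lim: "(\<lambda>n. s\<^sup>2 * (g n)\<^sup>2 / ((s\<^sup>2 / 2 * (h n)\<^sup>2)\<^sup>2 + s\<^sup>2 * (g n)\<^sup>2)) \<longlonglongrightarrow> 4 / (4 + s\<^sup>2)" .
  have "\<forall>\<^sub>F n in sequentially. s\<^sup>2 * (g n)\<^sup>2 / ((s\<^sup>2 / 2 * (h n)\<^sup>2)\<^sup>2 + s\<^sup>2 * (g n)\<^sup>2) = stat_cos (E n) (s * E n)"
    using E(2)
  proof eventually_elim
    case (elim n)
    have 1: "sin (s * E n) = g n * (s * E n)" using elim s by (simp add: g_def)
    have 2: "1 - cos (s * E n) = 2 * (h n * (s * E n / 2))\<^sup>2"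
    proof -
      have "cos (2 * (s * E n / 2)) = 1 - 2 * (sin (s * E n / 2))\<^sup>2" by (rule cos_double_sin)
      moreover have "sin (s * E n / 2) = h n * (s * E n / 2)" using elim s by (simp add: h_def)
      ultimately show ?thesis by simp
    qed
    have "stat_cos (E n) (s * E n) = ((E n)\<^sup>2)\<^sup>2 * (s\<^sup>2 * (g n)\<^sup>2)
        / (((E n)\<^sup>2)\<^sup>2 * ((s\<^sup>2 / 2 * (h n)\<^sup>2)\<^sup>2 + s\<^sup>2 * (g n)\<^sup>2))"
      unfolding stat_cos_def 1 2 by (simp add: power_mult_distrib power_divide algebra_simps power2_eq_square)
    also have "\<dots> = s\<^sup>2 * (g n)\<^sup>2 / ((s\<^sup>2 / 2 * (h n)\<^sup>2)\<^sup>2 + s\<^sup>2 * (g n)\<^sup>2)"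
      using elim by (intro mult_divide_mult_cancel_left) auto
    finally show ?case by simp
  qed
  then show ?thesis using lim by (simp add: tendsto_cong)
qed


section \<open>Comparison with the walk of frozen drift\<close>

context drift_seq
begin

lemma prob_beyond_window:
  assumes "m \<le> j"
  shows "1 \<le> (Q ^^ k) (\<lambda>_ i. if m \<le> i then 1 else 0) x j"
proof -
  have "(Q ^^ k) (\<lambda>_ _. 1) x j \<le> (Q ^^ k) (\<lambda>_ i. if m \<le> i then 1 else 0) x j"
    by (rule Q_pow_mono) (use assms in auto)
  then show ?thesis by simp
qed

lemma Q_lyap:
  assumes e: "0 < \<epsilon>" "\<epsilon> < 1" and ej: "3/4 * \<epsilon> \<le> e j" "e j \<le> 3/2 * \<epsilon>"
  shows "Q (\<lambda>x _. lyap \<epsilon> x) x j \<le> (1 - \<epsilon>\<^sup>2 / 4) * lyap \<epsilon> x + 3 * \<epsilon>\<^sup>2"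
  using lyap_step[OF e ej order.strict_implies_order[OF e_less_1], of x] by (simp add: avg_step_def)

text \<open>
  The generator of the true walk differs from that of the frozen one by \<open>(\<epsilon> - e j) / 2\<close> times a second
  difference of the averaged function. After \<open>k\<close> steps this is at most of order
  \<open>d * \<epsilon>\<^sup>2 * (1 - \<epsilon>\<^sup>2 / 2) ^ k * (1 + \<epsilon>) ^ x\<close>, and the sum over the steps remains of order \<open>d\<close>,
  however many steps are taken. The weight is absorbed by the Lyapunov function. The last summand
  bounds the probability that the walk leaves the window of excursions in which the drifts are controlled.
\<close>
lemma frozen_drift_comparison:
  assumes e: "0 < \<epsilon>" "\<epsilon> < 1" and d: "0 < d" "d \<le> 1/4"
    and win: "\<And>j. m \<le> j \<Longrightarrow> j < m' \<Longrightarrow> \<bar>e j - \<epsilon>\<bar> \<le> d * \<epsilon>"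
    and u1: "\<And>x. \<bar>u x\<bar> \<le> 1" and u2: "\<And>x. \<bar>u (x + 2) - u x\<bar> \<le> (K * \<epsilon>) * (1 + \<epsilon>) ^ x"
    and j: "m \<le> j"
  shows "\<bar>(Q ^^ k) (\<lambda>x _. u x) x j - (const_step \<epsilon> ^^ k) u x\<bar>
    \<le> d * K * (4 * (1 - \<epsilon>\<^sup>2 / 8) ^ k * lyap \<epsilon> x + 96 * (1 - (1 - \<epsilon>\<^sup>2 / 8) ^ k))
      + 2 * (Q ^^ k) (\<lambda>_ i. if m' \<le> i then 1 else 0) x j"
  using j
proof (induction k arbitrary: x j)
  case 0
  have "0 \<le> K * \<epsilon>" using u2[of 0] by simp
  then have "0 \<le> K" using e by (simp add: zero_le_mult_iff)
  then have "0 \<le> d * K * (4 * lyap \<epsilon> x)" using d lyap_bounds(2)[OF e(1), of x] by simp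
  then show ?case by simp
next
  case (Suc k)
  define \<mu> where "\<mu> = 1 - \<epsilon>\<^sup>2 / 8"
  define I where "I k = (Q ^^ k) (\<lambda>_ i. if m' \<le> i then 1 else 0)" for k
  have "0 \<le> K * \<epsilon>" using u2[of 0] by simp
  then have K: "0 \<le> K" using e by (simp add: zero_le_mult_iff)
  have "\<epsilon>\<^sup>2 \<le> 1" using e by (simp add: power_le_one)
  then have mu: "0 \<le> \<mu>" "\<mu> \<le> 1" by (auto simp: \<mu>_def)
  have V: "1 \<le> lyap \<epsilon> x" for x using lyap_bounds(2)[OF e(1)] .
  define W where "W k x = d * K * (4 * \<mu> ^ k * lyap \<epsilon> x + 96 * (1 - \<mu> ^ k))" for k x
  have W0: "0 \<le> W k x" for k x
  proof -
    have "\<mu> ^ k \<le> 1" using mu by (simp add: power_le_one)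
    then show ?thesis unfolding W_def using d K mu V[of x] by (intro mult_nonneg_nonneg add_nonneg_nonneg) auto
  qed
  let ?F = "(Q ^^ k) (\<lambda>x _. u x)" and ?u = "(const_step \<epsilon> ^^ k) u"
  show ?case
  proof (cases "m' \<le> j")
    case True
    have "\<bar>(Q ^^ Suc k) (\<lambda>x _. u x) x j\<bar> \<le> 1"
    proof -
      have "\<bar>(Q ^^ Suc k) (\<lambda>x _. u x) x j\<bar> \<le> (Q ^^ Suc k) (\<lambda>y i. \<bar>u y\<bar>) x j" by (rule Q_pow_abs)
      also have "\<dots> \<le> (Q ^^ Suc k) (\<lambda>_ _. 1) x j" by (rule Q_pow_mono) (use u1 in auto)
      finally show ?thesis by (simp del: funpow.simps)
    qed
    moreover have "\<bar>(const_step \<epsilon> ^^ Suc k) u x\<bar> \<le> 0 * (const_step \<epsilon> ^^ Suc k) u x + 1"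
      by (rule const_step_pow_abs[OF e]) (use u1 in simp)
    moreover have "1 \<le> I (Suc k) x j" unfolding I_def by (rule prob_beyond_window[OF True])
    ultimately show ?thesis using W0[of "Suc k" x] unfolding I_def W_def \<mu>_def by linarith
  next
    case False
    have ej: "\<bar>e j - \<epsilon>\<bar> \<le> d * \<epsilon>" using win[of j] Suc.prems False by simp
    have "d * \<epsilon> \<le> 1/4 * \<epsilon>" using d e by (intro mult_right_mono) auto
    then have ej2: "3/4 * \<epsilon> \<le> e j" "e j \<le> 3/2 * \<epsilon>" using ej e by linarith+
    \<comment> \<open>one step with the true drift against one step with the frozen drift\<close>
    have freeze: "\<bar>Q (\<lambda>x _. ?u x) x j - const_step \<epsilon> ?u x\<bar> \<le> d * K * (\<epsilon>\<^sup>2 / 2 * (\<mu> ^ k * lyap \<epsilon> x))"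
    proof (cases x)
      case 0
      then show ?thesis using mu V[of x] d K by (simp add: avg_step_def const_step_def)
    next
      case (Suc y)
      have "Q (\<lambda>x _. ?u x) x j - const_step \<epsilon> ?u x = (\<epsilon> - e j) / 2 * (?u (y + 2) - ?u y)"
        using Suc by (simp add: avg_step_def const_step_def field_simps)
      then have "\<bar>Q (\<lambda>x _. ?u x) x j - const_step \<epsilon> ?u x\<bar> = \<bar>e j - \<epsilon>\<bar> / 2 * \<bar>?u (y + 2) - ?u y\<bar>"
        by (simp only: abs_mult abs_divide abs_numeral abs_minus_commute)
      also have "\<dots> \<le> (d * \<epsilon>) / 2 * ((K * \<epsilon> * (1 - \<epsilon>\<^sup>2 / 2) ^ k) * (1 + \<epsilon>) ^ y)"
        using ej d e by (intro mult_mono const_step_pow_second_difference[OF e u2]) auto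
      also have "\<dots> = d * K * (\<epsilon>\<^sup>2 / 2 * ((1 - \<epsilon>\<^sup>2 / 2) ^ k * (1 + \<epsilon>) ^ y))"
        by (simp add: power2_eq_square)
      also have "\<dots> \<le> d * K * (\<epsilon>\<^sup>2 / 2 * (\<mu> ^ k * lyap \<epsilon> x))"
      proof -
        have "(1 - \<epsilon>\<^sup>2 / 2) ^ k \<le> \<mu> ^ k" using \<open>\<epsilon>\<^sup>2 \<le> 1\<close> by (intro power_mono) (auto simp: \<mu>_def)
        moreover have "(1 + \<epsilon>) ^ y \<le> lyap \<epsilon> x"
        proof -
          have "(1 + \<epsilon>) ^ y \<le> (1 + \<epsilon>) ^ x" using e Suc by (intro power_increasing) auto
          then show ?thesis using lyap_bounds(1)[OF e(1), of x] by linarith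
        qed
        ultimately show ?thesis
          using d K mu e by (intro mult_left_mono mult_mono) auto
      qed
      finally show ?thesis .
    qed
    have "(Q ^^ Suc k) (\<lambda>x _. u x) x j - (const_step \<epsilon> ^^ Suc k) u x
        = Q (\<lambda>y i. 1 * ?F y i + (- 1) * ?u y) x j + (Q (\<lambda>x _. ?u x) x j - const_step \<epsilon> ?u x)"
      unfolding avg_step_linear by simp
    then have split: "\<bar>(Q ^^ Suc k) (\<lambda>x _. u x) x j - (const_step \<epsilon> ^^ Suc k) u x\<bar>
        \<le> \<bar>Q (\<lambda>y i. 1 * ?F y i + (- 1) * ?u y) x j\<bar> + d * K * (\<epsilon>\<^sup>2 / 2 * (\<mu> ^ k * lyap \<epsilon> x))"
      using freeze by linarith
    have "\<bar>Q (\<lambda>y i. 1 * ?F y i + (- 1) * ?u y) x j\<bar> \<le> Q (\<lambda>y i. \<bar>1 * ?F y i + (- 1) * ?u y\<bar>) x j"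
      by (rule Q_abs)
    also have "\<dots> \<le> Q (\<lambda>y i. (4 * d * K * \<mu> ^ k) * lyap \<epsilon> y + 1 * (2 * I k y i + (96 * d * K * (1 - \<mu> ^ k)) * 1)) x j"
    proof (rule Q_mono)
      fix y i assume "j \<le> i"
      then have "\<bar>?F y i - ?u y\<bar> \<le> W k y + 2 * I k y i"
        using Suc.IH[of i y] Suc.prems unfolding W_def I_def \<mu>_def by simp
      then show "\<bar>1 * ?F y i + (- 1) * ?u y\<bar>
          \<le> (4 * d * K * \<mu> ^ k) * lyap \<epsilon> y + 1 * (2 * I k y i + (96 * d * K * (1 - \<mu> ^ k)) * 1)"
        by (simp add: W_def algebra_simps)
    qed
    also have "\<dots> = (4 * d * K * \<mu> ^ k) * Q (\<lambda>y _. lyap \<epsilon> y) x j + (2 * I (Suc k) x j + 96 * d * K * (1 - \<mu> ^ k))"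
      unfolding avg_step_linear avg_step_const by (simp add: I_def)
    also have "\<dots> \<le> (4 * d * K * \<mu> ^ k) * ((1 - \<epsilon>\<^sup>2 / 4) * lyap \<epsilon> x + 3 * \<epsilon>\<^sup>2)
        + (2 * I (Suc k) x j + 96 * d * K * (1 - \<mu> ^ k))"
      using d K mu by (intro add_right_mono mult_left_mono Q_lyap[OF e ej2]) auto
    finally have "\<bar>(Q ^^ Suc k) (\<lambda>x _. u x) x j - (const_step \<epsilon> ^^ Suc k) u x\<bar>
        \<le> (4 * d * K * \<mu> ^ k) * ((1 - \<epsilon>\<^sup>2 / 4) * lyap \<epsilon> x + 3 * \<epsilon>\<^sup>2)
        + (2 * I (Suc k) x j + 96 * d * K * (1 - \<mu> ^ k)) + d * K * (\<epsilon>\<^sup>2 / 2 * (\<mu> ^ k * lyap \<epsilon> x))"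
      using split by linarith
    also have "\<dots> = W (Suc k) x + 2 * I (Suc k) x j"
      by (simp add: W_def \<mu>_def algebra_simps)
    finally show ?thesis unfolding W_def I_def \<mu>_def .
  qed
qed

text \<open>
  Collects the three errors: freezing the drift, replacing the starting height by \<open>0\<close>, and the distance from
  stationarity for constant drift.
\<close>
lemma cos_close_to_stationary:
  assumes e: "0 < \<epsilon>" "\<epsilon> < 1" and d: "0 < d" "d \<le> 1/4"
    and win: "\<And>j. m \<le> j \<Longrightarrow> j < m' \<Longrightarrow> \<bar>e j - \<epsilon>\<bar> \<le> d * \<epsilon>"
    and s: "sin (s * \<epsilon>) \<noteq> 0" and j: "m \<le> j"
  shows "\<bar>(Q ^^ k) (\<lambda>x _. cos (s * \<epsilon> * real x)) x j - stat_cos \<epsilon> (s * \<epsilon>)\<bar>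
    \<le> 192 * d * \<bar>s\<bar> + 2 * \<bar>s\<bar> * \<epsilon> + 28 * \<bar>s\<bar> * ((1 - \<epsilon>\<^sup>2 / 8) ^ k * lyap \<epsilon> x)
      + 2 * (Q ^^ k) (\<lambda>_ i. if m' \<le> i then 1 else 0) x j"
proof -
  define \<mu> where "\<mu> = (1 - \<epsilon>\<^sup>2 / 8) ^ k"
  define V where "V = lyap \<epsilon> x"
  have e2: "\<epsilon>\<^sup>2 \<le> 1" using e by (simp add: power_le_one)
  then have mu: "0 \<le> \<mu>" "\<mu> \<le> 1" unfolding \<mu>_def using e2 by (auto intro!: power_le_one)
  have lam: "0 \<le> (1 - \<epsilon>\<^sup>2 / 2) ^ k" "(1 - \<epsilon>\<^sup>2 / 2) ^ k \<le> \<mu>"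
    unfolding \<mu>_def using e2 by (auto intro!: power_mono)
  have V: "1 \<le> V" "(1 + \<epsilon>) ^ x \<le> V" unfolding V_def using lyap_bounds[OF e(1)] by auto
  let ?u = "\<lambda>x. cos (s * \<epsilon> * real x)"
  have "\<bar>(Q ^^ k) (\<lambda>x _. ?u x) x j - (const_step \<epsilon> ^^ k) ?u x\<bar>
    \<le> d * (2 * \<bar>s\<bar>) * (4 * (1 - \<epsilon>\<^sup>2 / 8) ^ k * lyap \<epsilon> x + 96 * (1 - (1 - \<epsilon>\<^sup>2 / 8) ^ k))
      + 2 * (Q ^^ k) (\<lambda>_ i. if m' \<le> i then 1 else 0) x j"
    by (rule frozen_drift_comparison[OF e d win _ _ j]) (use cos_differences(2)[OF e(1)] in auto)
  moreover have "d * (2 * \<bar>s\<bar>) * (4 * (1 - \<epsilon>\<^sup>2 / 8) ^ k * lyap \<epsilon> x + 96 * (1 - (1 - \<epsilon>\<^sup>2 / 8) ^ k))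
      \<le> 2 * \<bar>s\<bar> * (\<mu> * V) + 192 * d * \<bar>s\<bar>"
  proof -
    have "d * (2 * \<bar>s\<bar>) * (4 * \<mu> * V + 96 * (1 - \<mu>)) \<le> d * (2 * \<bar>s\<bar>) * (4 * (\<mu> * V) + 96)"
      using d mu by (intro mult_left_mono) auto
    also have "\<dots> = (8 * d) * (\<bar>s\<bar> * (\<mu> * V)) + 192 * d * \<bar>s\<bar>" by (simp add: algebra_simps)
    also have "(8 * d) * (\<bar>s\<bar> * (\<mu> * V)) \<le> 2 * (\<bar>s\<bar> * (\<mu> * V))"
      using d mu V by (intro mult_right_mono) auto
    finally show ?thesis by (simp add: \<mu>_def V_def mult_ac)
  qed
  moreover have "\<bar>(const_step \<epsilon> ^^ k) ?u x - (const_step \<epsilon> ^^ k) ?u 0\<bar> \<le> \<bar>s\<bar> * \<epsilon> + 2 * \<bar>s\<bar> * (\<mu> * V)"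
  proof -
    have "\<bar>(const_step \<epsilon> ^^ k) ?u x - (const_step \<epsilon> ^^ k) ?u 0\<bar>
        \<le> \<bar>s\<bar> * \<epsilon> + 2 * \<bar>s\<bar> * (1 - \<epsilon>\<^sup>2 / 2) ^ k * (1 + \<epsilon>) ^ x"
      by (rule const_step_pow_oscillation) (use e cos_differences[of \<epsilon> s] in auto)
    also have "\<dots> = \<bar>s\<bar> * \<epsilon> + 2 * \<bar>s\<bar> * ((1 - \<epsilon>\<^sup>2 / 2) ^ k * (1 + \<epsilon>) ^ x)" by simp
    also have "\<dots> \<le> \<bar>s\<bar> * \<epsilon> + 2 * \<bar>s\<bar> * (\<mu> * V)"
      using lam V e mu by (intro add_left_mono mult_left_mono mult_mono) auto
    finally show ?thesis .
  qed
  moreover have "\<bar>(const_step \<epsilon> ^^ k) ?u 0 - stat_cos \<epsilon> (s * \<epsilon>)\<bar> \<le> \<bar>s\<bar> * \<epsilon> + 24 * \<bar>s\<bar> * (\<mu> * V)"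
  proof -
    have "(1 - \<epsilon>\<^sup>2 / 2) ^ k \<le> \<mu> * 1" using lam by simp
    also have "\<dots> \<le> \<mu> * V" using mu V by (intro mult_left_mono) auto
    finally have "24 * \<bar>s\<bar> * (1 - \<epsilon>\<^sup>2 / 2) ^ k \<le> 24 * \<bar>s\<bar> * (\<mu> * V)" by (intro mult_left_mono) auto
    then show ?thesis using const_drift_cos_limit[OF e s, of k] by linarith
  qed
  ultimately show ?thesis unfolding \<mu>_def[symmetric] V_def[symmetric] by linarith
qed

text \<open>
  The time \<open>t + k\<close> is split. At time \<open>t\<close> the walk is, up to an event of small probability, inside the window of
  excursions and at a height from which the mean return time is at most \<open>3 * \<Delta>\<close>, a small fraction of \<open>k\<close>.
  From such a height the remaining \<open>k\<close> steps suffice for mixing. The height bound holds because the clock is at least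
  \<open>t - \<Delta>\<close> while the total mean time of the excursions begun so far is at most \<open>t + 2 * \<Delta>\<close>.
\<close>
lemma cos_error_bound:
  assumes e: "0 < \<epsilon>" "\<epsilon> < 1" and d: "0 < d" "d \<le> 1/4"
    and win: "\<And>j. m \<le> j \<Longrightarrow> j < m' \<Longrightarrow> \<bar>e j - \<epsilon>\<bar> \<le> d * \<epsilon>"
    and s: "sin (s * \<epsilon>) \<noteq> 0"
    and B: "\<And>i. i < m' \<Longrightarrow> 1 / e i \<le> B" and B0: "0 < B" and \<Delta>: "1 + B \<le> \<Delta>" "72 * \<Delta> \<le> real k" and m: "m \<le> m'"
    and low: "mean_time m \<le> real t - \<Delta>" and high: "real (t + k) + \<Delta> \<le> mean_time m'"
  shows "\<bar>(Q ^^ (t + k)) (\<lambda>x _. cos (s * \<epsilon> * real x)) 0 0 - stat_cos \<epsilon> (s * \<epsilon>)\<bar>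
    \<le> 192 * d * \<bar>s\<bar> + 2 * \<bar>s\<bar> * \<epsilon> + 56 * \<bar>s\<bar> * exp (- (\<epsilon>\<^sup>2 * real k / 16)) + 8 * (real (t + k) * B\<^sup>2 / \<Delta>\<^sup>2)"
proof -
  let ?u = "\<lambda>x::nat. cos (s * \<epsilon> * real x)"
  define C where "C = stat_cos \<epsilon> (s * \<epsilon>)"
  have C: "0 \<le> C" "C \<le> 1"
  proof -
    have "(1 - cos (s * \<epsilon>))\<^sup>2 + \<epsilon>\<^sup>2 * (sin (s * \<epsilon>))\<^sup>2 > 0" using e s by (intro add_nonneg_pos) auto
    then show "0 \<le> C" "C \<le> 1" unfolding C_def stat_cos_def by (auto simp: pos_divide_le_eq)
  qed
  define R where "R = 192 * d * \<bar>s\<bar> + 2 * \<bar>s\<bar> * \<epsilon> + 56 * \<bar>s\<bar> * exp (- (\<epsilon>\<^sup>2 * real k / 16))"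
  have R: "0 \<le> R" using d e by (simp add: R_def)
  have \<Delta>0: "\<Delta> > 0" using B0 \<Delta> by simp
  \<comment> \<open>the first number of excursions whose total mean time reaches \<open>t + \<Delta>\<close>; it overshoots by at most the mean length of one excursion\<close>
  define m3 where "m3 = (LEAST i. real t + \<Delta> \<le> mean_time i)"
  have ex3: "real t + \<Delta> \<le> mean_time m'" using high by simp
  have m3: "real t + \<Delta> \<le> mean_time m3" "m3 \<le> m'" unfolding m3_def
    using LeastI[of "\<lambda>i. real t + \<Delta> \<le> mean_time i", OF ex3] Least_le[of "\<lambda>i. real t + \<Delta> \<le> mean_time i", OF ex3] by auto
  have m3_up: "mean_time m3 \<le> real t + 2 * \<Delta>"
  proof -
    have "m3 \<noteq> 0"
    proof
      assume "m3 = 0"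
      then have "real t + \<Delta> \<le> mean_time 0" using m3(1) by simp
      then show False using \<Delta>0 by (simp add: mean_time_def)
    qed
    then obtain i where i: "m3 = Suc i" by (cases m3) auto
    have "\<not> real t + \<Delta> \<le> mean_time i" using not_less_Least[of i "\<lambda>i. real t + \<Delta> \<le> mean_time i"] i unfolding m3_def by simp
    moreover have "mean_time m3 = mean_time i + (1 + 1 / e i)" by (simp add: i mean_time_def)
    moreover have "1 / e i \<le> B" using B[of i] i m3(2) by simp
    ultimately show ?thesis using \<Delta>(1) by linarith
  qed
  define J where "J i = (if m' \<le> i then 1 else (0::real))" for i :: nat
  define b1 where "b1 i = (if i < m then 1 else (0::real))" for i :: nat
  define b2 where "b2 i = (if m3 \<le> i then 1 else (0::real))" for i :: nat
  define b3 where "b3 x i = (if i < m3 \<and> clock x i \<le> real t - \<Delta> then 1 else (0::real))" for x i :: nat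
  have pointwise: "\<bar>(Q ^^ k) (\<lambda>x _. ?u x) x j - C\<bar>
      \<le> 2 * (Q ^^ k) (\<lambda>_. J) x j + (2 * b1 j + (2 * b2 j + (2 * b3 x j + R)))" for x j
  proof (cases "b1 j = 0 \<and> b2 j = 0 \<and> b3 x j = 0")
    case True
    then have j: "m \<le> j" "j < m3" "real t - \<Delta> < clock x j"
      by (auto simp: b1_def b2_def b3_def split: if_splits)
    have "\<bar>e j - \<epsilon>\<bar> \<le> d * \<epsilon>" using win[of j] j m3(2) by simp
    moreover have "d * \<epsilon> \<le> 1/4 * \<epsilon>" using d e by (intro mult_right_mono) auto
    ultimately have ej: "e j \<le> 3/2 * \<epsilon>" using e by linarith
    have x: "real x \<le> \<epsilon> * (real k / 16)"
    proof (cases "x = 0")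
      case False
      have "mean_time (Suc j) \<le> mean_time m3" using j(2) by (intro mean_time_mono) simp
      then have "real x / e j \<le> 3 * \<Delta>" using False j(3) m3_up by (simp add: clock_def)
      then have "real x \<le> 3 * \<Delta> * e j" using e_pos[of j] by (simp add: pos_divide_le_eq)
      also have "\<dots> \<le> 3 * \<Delta> * (3/2 * \<epsilon>)" using ej \<Delta>0 by (intro mult_left_mono) auto
      also have "\<dots> = \<epsilon> * (72 * \<Delta> / 16)" by simp
      also have "\<dots> \<le> \<epsilon> * (real k / 16)" using e \<Delta>(2) by (intro mult_left_mono divide_right_mono) auto
      finally show ?thesis .
    qed (use e in simp)
    have "(1 - \<epsilon>\<^sup>2 / 8) ^ k * lyap \<epsilon> x \<le> exp (- (\<epsilon>\<^sup>2 / 8) * real k) * (2 * exp (\<epsilon> * real x))"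
    proof (intro mult_mono)
      have "\<epsilon>\<^sup>2 \<le> 1" using e by (simp add: power_le_one)
      then have "(1 - \<epsilon>\<^sup>2 / 8) ^ k \<le> exp (- (\<epsilon>\<^sup>2 / 8)) ^ k"
        using exp_ge_add_one_self[of "- (\<epsilon>\<^sup>2 / 8)"] by (intro power_mono) auto
      then show "(1 - \<epsilon>\<^sup>2 / 8) ^ k \<le> exp (- (\<epsilon>\<^sup>2 / 8) * real k)"
        by (simp add: exp_of_nat_mult[symmetric] mult.commute)
      have "(1 + \<epsilon>) ^ x \<le> exp \<epsilon> ^ x" using e exp_ge_add_one_self[of \<epsilon>] by (intro power_mono) auto
      then show "lyap \<epsilon> x \<le> 2 * exp (\<epsilon> * real x)"
        using lyap_bounds(3)[OF e(1), of x] by (simp add: exp_of_nat_mult[symmetric] mult.commute)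
    qed (use lyap_bounds(2)[OF e(1), of x] in auto)
    also have "\<dots> = 2 * exp (\<epsilon> * real x - \<epsilon>\<^sup>2 * real k / 8)" by (simp add: exp_add[symmetric] algebra_simps)
    also have "\<dots> \<le> 2 * exp (- (\<epsilon>\<^sup>2 * real k / 16))"
    proof -
      have "\<epsilon> * real x \<le> \<epsilon> * (\<epsilon> * (real k / 16))" using x e by (intro mult_left_mono) auto
      then show ?thesis by (simp add: power2_eq_square)
    qed
    finally have "28 * \<bar>s\<bar> * ((1 - \<epsilon>\<^sup>2 / 8) ^ k * lyap \<epsilon> x) \<le> 28 * \<bar>s\<bar> * (2 * exp (- (\<epsilon>\<^sup>2 * real k / 16)))"
      by (intro mult_left_mono) auto
    moreover have "\<bar>(Q ^^ k) (\<lambda>x _. ?u x) x j - C\<bar>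
        \<le> 192 * d * \<bar>s\<bar> + 2 * \<bar>s\<bar> * \<epsilon> + 28 * \<bar>s\<bar> * ((1 - \<epsilon>\<^sup>2 / 8) ^ k * lyap \<epsilon> x)
          + 2 * (Q ^^ k) (\<lambda>_. J) x j"
      unfolding C_def J_def by (rule cos_close_to_stationary[OF e d win s j(1)])
    ultimately show ?thesis using True unfolding R_def by linarith
  next
    case False
    then have "1 \<le> b1 j + b2 j + b3 x j" by (auto simp: b1_def b2_def b3_def split: if_splits)
    moreover have "0 \<le> (Q ^^ k) (\<lambda>_. J) x j"
    proof -
      have "(Q ^^ k) (\<lambda>_ _. 0) x j \<le> (Q ^^ k) (\<lambda>_. J) x j" by (rule Q_pow_mono) (simp add: J_def)
      then show ?thesis by simp
    qed
    moreover have "\<bar>(Q ^^ k) (\<lambda>x _. ?u x) x j\<bar> \<le> 1"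
    proof -
      have "\<bar>(Q ^^ k) (\<lambda>x _. ?u x) x j\<bar> \<le> (Q ^^ k) (\<lambda>y i. \<bar>?u y\<bar>) x j" by (rule Q_pow_abs)
      also have "\<dots> \<le> (Q ^^ k) (\<lambda>_ _. 1) x j" by (rule Q_pow_mono) auto
      finally show ?thesis by simp
    qed
    ultimately show ?thesis using C R by linarith
  qed
  have "(Q ^^ (t + k)) (\<lambda>x _. ?u x) 0 0 - C = (Q ^^ t) (\<lambda>x j. (Q ^^ k) (\<lambda>x _. ?u x) x j + (- C)) 0 0"
    unfolding avg_step_pow_add_const by (simp add: funpow_add)
  then have "\<bar>(Q ^^ (t + k)) (\<lambda>x _. ?u x) 0 0 - C\<bar>
      \<le> (Q ^^ t) (\<lambda>x j. \<bar>(Q ^^ k) (\<lambda>x _. ?u x) x j + (- C)\<bar>) 0 0" by (simp only: Q_pow_abs)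
  also have "\<dots> \<le> (Q ^^ t) (\<lambda>x j. 2 * (Q ^^ k) (\<lambda>_. J) x j + 1 * (2 * b1 j + 1 * (2 * b2 j + 1 * (2 * b3 x j + R)))) 0 0"
    by (rule Q_pow_mono) (use pointwise in simp)
  also have "\<dots> = 2 * (Q ^^ t) ((Q ^^ k) (\<lambda>_. J)) 0 0 + 2 * (Q ^^ t) (\<lambda>_. b1) 0 0 + 2 * (Q ^^ t) (\<lambda>_. b2) 0 0
      + 2 * (Q ^^ t) b3 0 0 + R"
    unfolding avg_step_pow_linear avg_step_pow_add_const avg_step_pow_cmult by simp
  finally have total: "\<bar>(Q ^^ (t + k)) (\<lambda>x _. ?u x) 0 0 - C\<bar>
      \<le> 2 * (Q ^^ (t + k)) (\<lambda>_. J) 0 0 + 2 * (Q ^^ t) (\<lambda>_. b1) 0 0 + 2 * (Q ^^ t) (\<lambda>_. b2) 0 0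
      + 2 * (Q ^^ t) b3 0 0 + R" by (simp add: funpow_add)
  have "2 * (Q ^^ (t + k)) (\<lambda>_. J) 0 0 + 2 * (Q ^^ t) (\<lambda>_. b1) 0 0 + 2 * (Q ^^ t) (\<lambda>_. b2) 0 0
      + 2 * (Q ^^ t) b3 0 0 \<le> 8 * (real (t + k) * B\<^sup>2 / \<Delta>\<^sup>2)"
  proof -
    have t: "real t * B\<^sup>2 / \<Delta>\<^sup>2 \<le> real (t + k) * B\<^sup>2 / \<Delta>\<^sup>2"
      by (intro divide_right_mono mult_right_mono) auto
    have "(Q ^^ (t + k)) (\<lambda>_. J) 0 0 \<le> real (t + k) * B\<^sup>2 / \<Delta>\<^sup>2"
      unfolding J_def by (rule prob_many_excursions) (use B \<Delta>0 high in auto)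
    moreover have "(Q ^^ t) (\<lambda>_. b1) 0 0 \<le> real t * B\<^sup>2 / \<Delta>\<^sup>2"
      unfolding b1_def by (rule prob_few_excursions) (use B \<Delta>0 low m in auto)
    moreover have "(Q ^^ t) (\<lambda>_. b2) 0 0 \<le> real t * B\<^sup>2 / \<Delta>\<^sup>2"
      unfolding b2_def by (rule prob_many_excursions) (use B \<Delta>0 m3 in auto)
    moreover have "(Q ^^ t) b3 0 0 \<le> real t * B\<^sup>2 / \<Delta>\<^sup>2"
      unfolding b3_def by (rule prob_clock_late) (use B \<Delta>0 m3 in auto)
    moreover have "2 * a1 + 2 * a2 + 2 * a3 + 2 * a4 \<le> 8 * z"
      if "a1 \<le> z" "a2 \<le> y" "a3 \<le> y" "a4 \<le> y" "y \<le> z" for a1 a2 a3 a4 y z :: real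
      using that by linarith
    ultimately show ?thesis using t by blast
  qed
  then show ?thesis using total unfolding C_def R_def by linarith
qed

end

section \<open>From the Markov chain to the averaging operators\<close>

text \<open>
  The path up to time \<open>n\<close>, latest state first. Conditioning on a complete path is what the defining property of
  the chain describes; there are only countably many paths.
\<close>
primrec history :: "(nat \<Rightarrow> 'w \<Rightarrow> 's) \<Rightarrow> nat \<Rightarrow> 'w \<Rightarrow> 's list" where
  "history Y 0 \<omega> = [Y 0 \<omega>]"
| "history Y (Suc n) \<omega> = Y (Suc n) \<omega> # history Y n \<omega>"

primrec history_pmf :: "('s \<Rightarrow> 's pmf) \<Rightarrow> 's \<Rightarrow> nat \<Rightarrow> 's list pmf" where
  "history_pmf K s 0 = return_pmf [s]"
| "history_pmf K s (Suc n) = bind_pmf (history_pmf K s n) (\<lambda>l. map_pmf (\<lambda>t. t # l) (K (hd l)))"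

primrec chain_pmf :: "('s \<Rightarrow> 's pmf) \<Rightarrow> 's \<Rightarrow> nat \<Rightarrow> 's pmf" where
  "chain_pmf K s 0 = return_pmf s"
| "chain_pmf K s (Suc n) = bind_pmf (chain_pmf K s n) K"

lemma hd_history [simp]: "hd (history Y n \<omega>) = Y n \<omega>"
  by (cases n) auto

lemma history_eq_iff: "history Y n \<omega> = history Y n \<omega>' \<longleftrightarrow> (\<forall>k\<le>n. Y k \<omega> = Y k \<omega>')"
  by (induction n) (auto simp: le_Suc_eq)

lemma map_hd_history_pmf: "map_pmf hd (history_pmf K s n) = chain_pmf K s n"
  by (induction n) (simp_all add: map_bind_pmf bind_map_pmf[symmetric] pmf.map_comp o_def flip: bind_map_pmf)

lemma pmf_bind_Cons:
  "pmf (bind_pmf p (\<lambda>l. map_pmf (\<lambda>t. t # l) (K (hd l)))) (t # l) = pmf p l * pmf (K (hd l)) t"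
proof -
  have "pmf (map_pmf (\<lambda>t. t # x) (K (hd x))) (t # l) = indicator {l} x * pmf (K (hd l)) t" for x
  proof (cases "x = l")
    case True
    then show ?thesis using pmf_map_inj'[of "\<lambda>t. t # l" "K (hd l)" t] by (simp add: inj_def)
  next
    case False
    then have "pmf (map_pmf (\<lambda>t. t # x) (K (hd x))) (t # l) = 0" by (intro pmf_map_outside) auto
    then show ?thesis using False by simp
  qed
  then have "pmf (bind_pmf p (\<lambda>l. map_pmf (\<lambda>t. t # l) (K (hd l)))) (t # l)
      = (\<integral>x. indicator {l} x * pmf (K (hd l)) t \<partial>measure_pmf p)" by (simp add: pmf_bind)
  also have "\<dots> = pmf p l * pmf (K (hd l)) t" by (simp add: measure_pmf_single)
  finally show ?thesis .
qed

lemma measurable_history: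
  fixes Y :: "nat \<Rightarrow> 'w \<Rightarrow> 's :: countable"
  assumes "\<And>n. Y n \<in> measurable M (count_space UNIV)"
  shows "history Y n \<in> measurable M (count_space UNIV)"
proof (induction n)
  case 0
  have "(\<lambda>\<omega>. [Y 0 \<omega>]) \<in> measurable M (count_space UNIV)"
    by (rule measurable_compose[OF assms]) simp
  then show ?case by (simp cong: measurable_cong)
next
  case (Suc n)
  have "(\<lambda>\<omega>. Y (Suc n) \<omega> # l) \<in> measurable M (count_space UNIV)" for l
    by (rule measurable_compose[OF assms]) simp
  from measurable_compose_countable[OF this Suc]
  show ?case by (simp cong: measurable_cong)
qed

text \<open>
  The law of the path is the product of transition probabilities. A path of positive probability is realized at some
  sample point, and the states at this point serve as the conditioning sequence.
\<close>
lemma markov_chain_history: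
  fixes Y :: "nat \<Rightarrow> 'w \<Rightarrow> 's :: countable"
  assumes Y: "is_markov_chain M K Y" and s: "AE \<omega> in M. Y 0 \<omega> = s"
  shows "measure M {\<omega> \<in> space M. history Y n \<omega> = l} = pmf (history_pmf K s n) l"
proof (induction n arbitrary: l)
  case 0
  interpret prob_space M using Y by (simp add: is_markov_chain_def)
  have [measurable]: "Y 0 \<in> measurable M (count_space UNIV)" using Y by (simp add: is_markov_chain_def)
  have "prob {\<omega> \<in> space M. [Y 0 \<omega>] = l} = prob {\<omega> \<in> space M. [s] = l}"
    by (rule finite_measure_eq_AE) (use s in auto)
  then show ?case by (simp add: prob_space indicator_def)
next
  case (Suc n)
  interpret prob_space M using Y by (simp add: is_markov_chain_def)
  have [measurable]: "Y k \<in> measurable M (count_space UNIV)" for k using Y by (simp add: is_markov_chain_def)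
  have meas [measurable]: "history Y k \<in> measurable M (count_space UNIV)" for k
    by (rule measurable_history) measurable
  show ?case
  proof (cases l)
    case Nil
    have "pmf (history_pmf K s (Suc n)) [] = 0"
      by (auto simp: pmf_eq_0_set_pmf)
    then show ?thesis using Nil by simp
  next
    case (Cons t l')
    have split: "{\<omega> \<in> space M. history Y (Suc n) \<omega> = l}
        = {\<omega> \<in> space M. Y (Suc n) \<omega> = t \<and> history Y n \<omega> = l'}" using Cons by auto
    show ?thesis
    proof (cases "prob {\<omega> \<in> space M. history Y n \<omega> = l'} > 0")
      case False
      then have "prob {\<omega> \<in> space M. history Y n \<omega> = l'} = 0" using measure_nonneg[of M] by (simp add: not_less order.antisym)
      moreover from this have "prob {\<omega> \<in> space M. Y (Suc n) \<omega> = t \<and> history Y n \<omega> = l'} \<le> 0"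
        using finite_measure_mono[of "{\<omega> \<in> space M. Y (Suc n) \<omega> = t \<and> history Y n \<omega> = l'}"
            "{\<omega> \<in> space M. history Y n \<omega> = l'}"] by auto
      ultimately show ?thesis using Suc[of l'] split Cons measure_nonneg[of M]
        by (simp add: pmf_bind_Cons order.antisym)
    next
      case True
      then have "{\<omega> \<in> space M. history Y n \<omega> = l'} \<noteq> {}" by (metis measure_empty less_irrefl)
      then obtain \<omega>0 where l': "l' = history Y n \<omega>0" by auto
      have ev: "(\<forall>k\<le>n. Y k \<omega> = Y k \<omega>0) \<longleftrightarrow> history Y n \<omega> = l'" for \<omega>
        using history_eq_iff[of Y n \<omega> \<omega>0] l' by auto
      have "\<P>(\<omega> in M. Y (Suc n) \<omega> = t \<bar> \<forall>k\<le>n. Y k \<omega> = Y k \<omega>0) = pmf (K (Y n \<omega>0)) t"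
        using Y[unfolded is_markov_chain_def, THEN conjunct2, THEN conjunct2, THEN spec[of _ n],
            THEN spec[of _ "\<lambda>k. Y k \<omega>0"], THEN spec[of _ t]] True
        unfolding ev by simp
      then have "prob {\<omega> \<in> space M. Y (Suc n) \<omega> = t \<and> history Y n \<omega> = l'}
          = pmf (K (hd l')) t * prob {\<omega> \<in> space M. history Y n \<omega> = l'}"
        using True unfolding cond_prob_def ev by (simp add: l' field_simps)
      then show ?thesis using Suc[of l'] split Cons by (simp add: pmf_bind_Cons)
    qed
  qed
qed

lemma markov_chain_distr:
  fixes Y :: "nat \<Rightarrow> 'w \<Rightarrow> 's :: countable"
  assumes Y: "is_markov_chain M K Y" and s: "AE \<omega> in M. Y 0 \<omega> = s"
  shows "distr M (count_space UNIV) (Y n) = measure_pmf (chain_pmf K s n)"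
proof -
  interpret prob_space M using Y by (simp add: is_markov_chain_def)
  have meas: "history Y n \<in> measurable M (count_space UNIV)"
    by (rule measurable_history) (use Y in \<open>simp add: is_markov_chain_def\<close>)
  have "distr M (count_space UNIV) (history Y n) = measure_pmf (history_pmf K s n)"
  proof (rule measure_eqI_countable[of _ UNIV])
    fix l :: "'s list"
    have "emeasure (distr M (count_space UNIV) (history Y n)) {l} = emeasure M {\<omega> \<in> space M. history Y n \<omega> = l}"
      using meas by (subst emeasure_distr) (auto intro!: arg_cong[where f = "emeasure M"])
    also have "\<dots> = emeasure (measure_pmf (history_pmf K s n)) {l}"
      using markov_chain_history[OF Y s, of n l] by (simp add: emeasure_eq_measure emeasure_pmf_single)
    finally show "emeasure (distr M (count_space UNIV) (history Y n)) {l} = emeasure (measure_pmf (history_pmf K s n)) {l}" .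
  qed auto
  then have "distr (distr M (count_space UNIV) (history Y n)) (count_space UNIV) hd
      = measure_pmf (map_pmf hd (history_pmf K s n))" by (simp add: map_pmf_rep_eq)
  also have "distr (distr M (count_space UNIV) (history Y n)) (count_space UNIV) hd = distr M (count_space UNIV) (Y n)"
    using meas by (subst distr_distr) (auto simp: o_def)
  finally show ?thesis by (simp add: map_hd_history_pmf)
qed

lemma expectation_bind_pmf:
  fixes g :: "'b \<Rightarrow> real"
  assumes "\<And>x. \<bar>g x\<bar> \<le> B"
  shows "measure_pmf.expectation (bind_pmf p f) g = measure_pmf.expectation p (\<lambda>x. measure_pmf.expectation (f x) g)"
  unfolding measure_pmf_bind
  by (subst integral_bind[where K = "count_space UNIV" and B' = 1 and B = B])
    (use assms in \<open>auto simp: measure_pmf.emeasure_space_1 measure_pmf_in_subprob_algebra\<close>)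

lemma expectation_pmf_bound:
  fixes g :: "'b \<Rightarrow> real"
  assumes "\<And>x. \<bar>g x\<bar> \<le> B"
  shows "\<bar>measure_pmf.expectation p g\<bar> \<le> B"
proof -
  have int: "integrable (measure_pmf p) g"
    by (rule measure_pmf.integrable_const_bound[where B = B]) (use assms in auto)
  have "measure_pmf.expectation p g \<le> measure_pmf.expectation p (\<lambda>_. B)"
    using int assms by (intro integral_mono) (auto simp: abs_le_iff)
  moreover have "measure_pmf.expectation p (\<lambda>_. - B) \<le> measure_pmf.expectation p g"
    using int assms by (intro integral_mono) (auto simp: abs_le_iff minus_le_iff)
  ultimately show ?thesis by simp
qed

lemma expectation_drift_kernel:
  fixes g :: "int \<times> nat \<Rightarrow> real"
  assumes "0 < \<epsilon> m" "\<epsilon> m < 1"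
  shows "measure_pmf.expectation (drift_kernel \<epsilon> (i, m)) g
    = up_prob \<epsilon> i m * g (i + 1, if i = - 1 then m + 1 else m)
      + (1 - up_prob \<epsilon> i m) * g (i - 1, if i = 1 then m + 1 else m)"
proof -
  have "up_prob \<epsilon> i m \<in> {0..1}" using assms by (auto simp: up_prob_def sgn_if)
  moreover have "i + 1 = 0 \<longleftrightarrow> i = - 1" by auto
  ultimately show ?thesis by (simp add: drift_kernel_def Let_def)
qed

text \<open>
  A function of the absolute height and the excursion number is mapped by the kernel to a function of the same
  kind. The second component of the chain is the number of completed excursions plus one.
\<close>
lemma expectation_chain_even:
  assumes e: "\<And>n. n \<ge> 1 \<Longrightarrow> 0 < \<epsilon> n \<and> \<epsilon> n < 1"
    and G: "\<And>s. \<bar>G s\<bar> \<le> B" "\<And>i j. G (i, Suc j) = h (nat \<bar>i\<bar>) j"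
  shows "measure_pmf.expectation (chain_pmf (drift_kernel \<epsilon>) (0, 1) n) G = (avg_step (\<lambda>j. \<epsilon> (Suc j)) ^^ n) h 0 0"
  using G
proof (induction n arbitrary: G h)
  case 0
  then show ?case by simp
next
  case (Suc n)
  let ?G = "\<lambda>s. measure_pmf.expectation (drift_kernel \<epsilon> s) G"
  have "?G (i, Suc j) = avg_step (\<lambda>j. \<epsilon> (Suc j)) h (nat \<bar>i\<bar>) j" for i j
  proof -
    have ij: "0 < \<epsilon> (Suc j)" "\<epsilon> (Suc j) < 1" using e[of "Suc j"] by auto
    have shift: "G (k, if b then Suc j + 1 else Suc j) = h (nat \<bar>k\<bar>) (if b then Suc j else j)" for k b
      using Suc.prems(2)[of k "Suc j"] Suc.prems(2)[of k j] by simp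
    consider "i = 0" | "i > 0" | "i < 0" by linarith
    then show ?thesis
    proof cases
      case 1
      then show ?thesis unfolding expectation_drift_kernel[where \<epsilon> = \<epsilon> and m = "Suc j" and i = i, OF ij] shift
        by (simp add: avg_step_def up_prob_def)
    next
      case 2
      then have "nat \<bar>i + 1\<bar> = nat \<bar>i\<bar> + 1" "nat \<bar>i - 1\<bar> = nat \<bar>i\<bar> - 1" "nat \<bar>i\<bar> = 1 \<longleftrightarrow> i = 1" "i \<noteq> - 1"
        "nat \<bar>i\<bar> \<noteq> 0" by auto
      then show ?thesis unfolding expectation_drift_kernel[where \<epsilon> = \<epsilon> and m = "Suc j" and i = i, OF ij] shift using 2
        by (simp add: avg_step_def up_prob_def field_simps)
    next
      case 3
      then have "nat \<bar>i + 1\<bar> = nat \<bar>i\<bar> - 1" "nat \<bar>i - 1\<bar> = nat \<bar>i\<bar> + 1" "nat \<bar>i\<bar> = 1 \<longleftrightarrow> i = - 1" "i \<noteq> 1"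
        "nat \<bar>i\<bar> \<noteq> 0" by auto
      then show ?thesis unfolding expectation_drift_kernel[where \<epsilon> = \<epsilon> and m = "Suc j" and i = i, OF ij] shift using 3
        by (simp add: avg_step_def up_prob_def field_simps)
    qed
  qed
  then have "measure_pmf.expectation (chain_pmf (drift_kernel \<epsilon>) (0, 1) n) ?G
      = (avg_step (\<lambda>j. \<epsilon> (Suc j)) ^^ n) (avg_step (\<lambda>j. \<epsilon> (Suc j)) h) 0 0"
    by (intro Suc.IH expectation_pmf_bound Suc.prems)
  then show ?case by (simp add: expectation_bind_pmf[OF Suc.prems(1)] funpow_Suc_right del: funpow.simps)
qed

lemma expectation_chain_odd:
  assumes e: "\<And>n. n \<ge> 1 \<Longrightarrow> 0 < \<epsilon> n \<and> \<epsilon> n < 1"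
    and G: "\<And>s. \<bar>G s\<bar> \<le> B" "\<And>i m. m \<ge> 1 \<Longrightarrow> G (- i, m) = - G (i, m)"
  shows "measure_pmf.expectation (chain_pmf (drift_kernel \<epsilon>) (0, 1) n) G = (0 :: real)"
  using G
proof (induction n arbitrary: G)
  case 0
  then show ?case using "0"(2)[of 1 0] by simp
next
  case (Suc n)
  let ?G = "\<lambda>s. measure_pmf.expectation (drift_kernel \<epsilon> s) G"
  have "?G (- i, m) = - ?G (i, m)" if m: "m \<ge> 1" for i m
  proof -
    have ij: "0 < \<epsilon> m" "\<epsilon> m < 1" using e[OF m] by auto
    have neg: "- i = - 1 \<longleftrightarrow> i = 1" "- i = 1 \<longleftrightarrow> i = - 1" "- i + 1 = - (i - 1)" "- i - 1 = - (i + 1)" by auto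
    have odd: "G (- k, if b then m + 1 else m) = - G (k, if b then m + 1 else m)" for k b
      using Suc.prems(2)[of "if b then m + 1 else m" k] m by simp
    have "up_prob \<epsilon> (- i) m = 1 - up_prob \<epsilon> i m" by (simp add: up_prob_def sgn_if field_simps)
    then show ?thesis unfolding expectation_drift_kernel[where \<epsilon> = \<epsilon> and m = m, OF ij] neg odd by simp
  qed
  then have "measure_pmf.expectation (chain_pmf (drift_kernel \<epsilon>) (0, 1) n) ?G = 0"
    by (intro Suc.IH expectation_pmf_bound Suc.prems)
  then show ?case by (simp add: expectation_bind_pmf[OF Suc.prems(1)])
qed

lemma drift_walk_char:
  assumes e: "\<And>n. n \<ge> 1 \<Longrightarrow> 0 < \<epsilon> n \<and> \<epsilon> n < 1" and w: "drift_walk M \<epsilon> X"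
  shows "char (distr M borel (\<lambda>\<omega>. real_of_int (X n \<omega>) / b)) s
    = complex_of_real ((avg_step (\<lambda>j. \<epsilon> (Suc j)) ^^ n) (\<lambda>x _. cos (s * (1 / b) * real x)) 0 0)"
proof -
  define Y where "Y n \<omega> = (X n \<omega>, eta X n \<omega>)" for n \<omega>
  define D where "D = chain_pmf (drift_kernel \<epsilon>) (0, 1) n"
  have Y: "is_markov_chain M (drift_kernel \<epsilon>) Y" using w unfolding drift_walk_def Y_def[abs_def] by blast
  have "AE \<omega> in M. X 0 \<omega> = 0" using w by (simp add: drift_walk_def)
  then have start: "AE \<omega> in M. Y 0 \<omega> = (0, 1)" by eventually_elim (simp add: Y_def eta_def)
  interpret prob_space M using Y by (simp add: is_markov_chain_def)
  have Ym [measurable]: "Y n \<in> measurable M (count_space UNIV)" for n using Y by (simp add: is_markov_chain_def)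
  have X_eq: "X n = (\<lambda>\<omega>. fst (Y n \<omega>))" for n by (simp add: Y_def fun_eq_iff)
  have law: "distr M (count_space UNIV) (Y n) = measure_pmf D"
    unfolding D_def by (rule markov_chain_distr[OF Y start])
  have ex: "(LINT \<omega>|M. F (X n \<omega>)) = measure_pmf.expectation D (\<lambda>s. F (fst s))" for F :: "int \<Rightarrow> real"
    unfolding law[symmetric] X_eq by (subst integral_distr) auto
  have Xm [measurable]: "(\<lambda>\<omega>. real_of_int (X n \<omega>)) \<in> borel_measurable M"
    unfolding X_eq by (rule measurable_compose[OF Ym]) simp
  let ?z = "\<lambda>i::int. s * (real_of_int i / b)"
  have "char (distr M borel (\<lambda>\<omega>. real_of_int (X n \<omega>) / b)) s = (CLINT \<omega>|M. iexp (?z (X n \<omega>)))"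
    unfolding char_def by (subst integral_distr) auto
  also have "\<dots> = (CLINT \<omega>|M. complex_of_real (cos (?z (X n \<omega>))) + \<i> * complex_of_real (sin (?z (X n \<omega>))))"
  proof -
    have "iexp y = complex_of_real (cos y) + \<i> * complex_of_real (sin y)" for y
      by (simp add: exp_Euler cos_of_real sin_of_real)
    then show ?thesis by (simp only:)
  qed
  also have "\<dots> = (CLINT \<omega>|M. complex_of_real (cos (?z (X n \<omega>)))) + (CLINT \<omega>|M. \<i> * complex_of_real (sin (?z (X n \<omega>))))"
    by (rule Bochner_Integration.integral_add; rule integrable_const_bound[where B = 1]) (auto simp: norm_mult)
  also have "\<dots> = complex_of_real (LINT \<omega>|M. cos (?z (X n \<omega>))) + \<i> * complex_of_real (LINT \<omega>|M. sin (?z (X n \<omega>)))"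
    by simp
  also have "(LINT \<omega>|M. sin (?z (X n \<omega>))) = 0"
    unfolding ex[of "\<lambda>i. sin (?z i)"] D_def by (rule expectation_chain_odd[OF e, where B = 1]) auto
  also have "(LINT \<omega>|M. cos (?z (X n \<omega>))) = (avg_step (\<lambda>j. \<epsilon> (Suc j)) ^^ n) (\<lambda>x _. cos (s * (1 / b) * real x)) 0 0"
    unfolding ex[of "\<lambda>i. cos (?z i)"] D_def
  proof (rule expectation_chain_even[OF e, where B = 1])
    show "cos (?z (fst (i, Suc j))) = cos (s * (1 / b) * real (nat \<bar>i\<bar>))" for i j
      by (cases "i \<ge> 0") auto
  qed auto
  finally show ?thesis by simp
qed

section \<open>The two-sided exponential distribution\<close>

text \<open>
  On the half-line the cosine integral follows from an explicit antiderivative; for the sine only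
  integrability matters, since the integral over the line vanishes by oddness.
\<close>
lemma laplace_half_line:
  fixes s :: real
  shows "has_bochner_integral lborel (\<lambda>x. indicator {0..} x *\<^sub>R (cos (s * x) * exp (- 2 * \<bar>x\<bar>))) (2 / (4 + s\<^sup>2))"
    and "integrable lborel (\<lambda>x. indicator {0..} x *\<^sub>R (sin (s * x) * exp (- 2 * \<bar>x\<bar>)))"
proof -
  have "set_integrable lborel {0<..} (\<lambda>x. exp (- (x * 2 :: real)))" by (rule integrable_I0i_exp_mscale) simp
  then have base: "integrable lborel (\<lambda>x. indicator {0<..} x * exp (- 2 * \<bar>x\<bar> :: real))"
    unfolding set_integrable_def
    by (rule Bochner_Integration.integrable_bound) (auto split: split_indicator)
  have ae: "AE x::real in lborel. indicator {0<..} x = (indicator {0..} x :: real)"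
    by (rule AE_mp[OF AE_lborel_singleton[of "0::real"]]) (auto intro!: AE_I2 split: split_indicator)
  have intg: "integrable lborel (\<lambda>x. indicator {0<..} x *\<^sub>R (g x * exp (- 2 * \<bar>x\<bar>)))"
    if [measurable]: "g \<in> borel_measurable borel" and "\<And>x. \<bar>g x\<bar> \<le> 1" for g :: "real \<Rightarrow> real"
    using base
  proof (rule Bochner_Integration.integrable_bound)
    show "AE x in lborel. norm (indicator {0<..} x *\<^sub>R (g x * exp (- 2 * \<bar>x\<bar>))) \<le> norm (indicator {0<..} x * exp (- 2 * \<bar>x\<bar>))"
      using that(2) by (auto simp: abs_mult mult_left_le_one_le split: split_indicator)
  qed simp
  have move: "integrable lborel (\<lambda>x. indicator {0..} x *\<^sub>R (g x * exp (- 2 * \<bar>x\<bar>)))"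
    if [measurable]: "g \<in> borel_measurable borel" and "\<And>x. \<bar>g x\<bar> \<le> 1" for g :: "real \<Rightarrow> real"
    using intg[OF that] by (rule integrable_cong_AE_imp) (use ae in \<open>auto elim: eventually_mono\<close>)
  show "integrable lborel (\<lambda>x. indicator {0..} x *\<^sub>R (sin (s * x) * exp (- 2 * \<bar>x\<bar>)))" by (rule move) auto
  define f where "f x = cos (s * x) * exp (- 2 * x)" for x :: real
  define F where "F x = exp (- 2 * x) * (s * sin (s * x) - 2 * cos (s * x)) / (4 + s\<^sup>2)" for x :: real
  have pos: "4 + s\<^sup>2 > 0" by (simp add: add_pos_nonneg)
  have deriv: "(F has_real_derivative f x) (at x)" for x
  proof -
    have "((\<lambda>x. exp (- 2 * x) * (s * sin (s * x) - 2 * cos (s * x))) has_real_derivative f x * (4 + s\<^sup>2)) (at x)"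
      unfolding f_def by (rule derivative_eq_intros refl | simp)+ (simp add: power2_eq_square algebra_simps)
    from DERIV_cdivide[OF this, of "4 + s\<^sup>2"]
    show ?thesis using pos unfolding F_def by simp
  qed
  have "(LBINT x=0..\<infinity>. f x) = 0 - F 0"
  proof (rule interval_integral_FTC_integrable)
    show "(F has_vector_derivative f x) (at x)" for x
      using deriv has_real_derivative_iff_has_vector_derivative by blast
    show "isCont f x" for x unfolding f_def by (intro continuous_intros)
    have "integrable lborel (\<lambda>x. indicator {0<..} x *\<^sub>R (cos (s * x) * exp (- 2 * \<bar>x\<bar>)))" by (rule intg) auto
    then have "integrable lborel (\<lambda>x. indicator {0<..} x *\<^sub>R f x)"
      by (rule Bochner_Integration.integrable_cong[THEN iffD1, rotated 2]) (auto simp: f_def split: split_indicator)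
    moreover have "einterval 0 \<infinity> = {0<..}" by (simp add: zero_ereal_def einterval_eq_Ici)
    ultimately show "set_integrable lborel (einterval 0 \<infinity>) f" by (simp add: set_integrable_def)
    have "isCont F 0" using deriv DERIV_isCont by blast
    then show "((F \<circ> real_of_ereal) \<longlongrightarrow> F 0) (at_right 0)"
      unfolding zero_ereal_def ereal_tendsto_simps by (simp add: isCont_def filterlim_at_split)
    have "(F \<longlongrightarrow> 0) at_top"
    proof (rule Lim_null_comparison)
      have "norm (F x) \<le> (\<bar>s\<bar> + 2) / (4 + s\<^sup>2) * exp (- 2 * x)" for x
      proof -
        have "\<bar>s * sin (s * x) - 2 * cos (s * x)\<bar> \<le> \<bar>s * sin (s * x)\<bar> + \<bar>2 * cos (s * x)\<bar>" by linarith
        also have "\<dots> \<le> \<bar>s\<bar> * 1 + 2 * 1" unfolding abs_mult by (intro add_mono mult_mono) auto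
        finally have "exp (- 2 * x) * \<bar>s * sin (s * x) - 2 * cos (s * x)\<bar> \<le> exp (- 2 * x) * (\<bar>s\<bar> + 2)"
          by (intro mult_left_mono) auto
        then show ?thesis using pos by (simp add: F_def abs_mult divide_right_mono mult.commute)
      qed
      then show "\<forall>\<^sub>F x in at_top. norm (F x) \<le> (\<bar>s\<bar> + 2) / (4 + s\<^sup>2) * exp (- 2 * x)" by simp
      have "((\<lambda>x::real. exp (- 2 * x)) \<longlongrightarrow> 0) at_top"
        by (rule filterlim_compose[OF exp_at_bot])
          (intro filterlim_tendsto_neg_mult_at_bot[OF tendsto_const] filterlim_ident, simp)
      then show "((\<lambda>x. (\<bar>s\<bar> + 2) / (4 + s\<^sup>2) * exp (- 2 * x)) \<longlongrightarrow> 0) at_top"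
        by (rule tendsto_mult_right_zero)
    qed
    then show "((F \<circ> real_of_ereal) \<longlongrightarrow> 0) (at_left \<infinity>)" unfolding ereal_tendsto_simps .
  qed simp
  also have "0 - F 0 = 2 / (4 + s\<^sup>2)" by (simp add: F_def)
  also have "(LBINT x=0..\<infinity>. f x) = (LINT x|lborel. indicator {0..} x *\<^sub>R (cos (s * x) * exp (- 2 * \<bar>x\<bar>)))"
    unfolding interval_lebesgue_integral_0_infty set_lebesgue_integral_def
    by (rule integral_cong_AE) (use ae in \<open>auto simp: f_def split: split_indicator elim: eventually_mono\<close>)
  finally show "has_bochner_integral lborel (\<lambda>x. indicator {0..} x *\<^sub>R (cos (s * x) * exp (- 2 * \<bar>x\<bar>))) (2 / (4 + s\<^sup>2))"
    using move[of "\<lambda>x. cos (s * x)"] by (simp add: has_bochner_integral_iff)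
qed

lemma laplace_cos_integral:
  fixes s :: real
  shows "has_bochner_integral lborel (\<lambda>x. cos (s * x) * exp (- 2 * \<bar>x\<bar>)) (4 / (4 + s\<^sup>2))"
  using has_bochner_integral_even_function[OF laplace_half_line(1)[of s]] by simp

lemma laplace_sin_integral:
  fixes s :: real
  shows "has_bochner_integral lborel (\<lambda>x. sin (s * x) * exp (- 2 * \<bar>x\<bar>)) 0"
  by (rule has_bochner_integral_odd_function[OF has_bochner_integral_integrable[OF laplace_half_line(2)[of s]]]) simp

lemma laplace_char:
  "char (density lborel (\<lambda>x. ennreal (exp (- 2 * \<bar>x\<bar>)))) s = complex_of_real (4 / (4 + s\<^sup>2))"
proof -
  have "char (density lborel (\<lambda>x. ennreal (exp (- 2 * \<bar>x\<bar>)))) s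
      = (CLINT x|lborel. exp (- 2 * \<bar>x\<bar>) *\<^sub>R iexp (s * x))"
    unfolding char_def by (rule integral_density) auto
  also have "(\<lambda>x. exp (- 2 * \<bar>x\<bar>) *\<^sub>R iexp (s * x)) = (\<lambda>x. complex_of_real (cos (s * x) * exp (- 2 * \<bar>x\<bar>))
      + \<i> * complex_of_real (sin (s * x) * exp (- 2 * \<bar>x\<bar>)))"
  proof
    fix x
    have "iexp (s * x) = complex_of_real (cos (s * x)) + \<i> * complex_of_real (sin (s * x))"
      by (simp add: exp_Euler cos_of_real sin_of_real flip: of_real_mult)
    then show "exp (- 2 * \<bar>x\<bar>) *\<^sub>R iexp (s * x) = complex_of_real (cos (s * x) * exp (- 2 * \<bar>x\<bar>))
      + \<i> * complex_of_real (sin (s * x) * exp (- 2 * \<bar>x\<bar>))"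
      by (simp add: scaleR_conv_of_real algebra_simps del: of_real_exp)
  qed
  also have "(CLINT x|lborel. complex_of_real (cos (s * x) * exp (- 2 * \<bar>x\<bar>))
      + \<i> * complex_of_real (sin (s * x) * exp (- 2 * \<bar>x\<bar>)))
      = (CLINT x|lborel. complex_of_real (cos (s * x) * exp (- 2 * \<bar>x\<bar>)))
        + (CLINT x|lborel. \<i> * complex_of_real (sin (s * x) * exp (- 2 * \<bar>x\<bar>)))"
    using laplace_cos_integral[of s] laplace_sin_integral[of s]
    by (intro Bochner_Integration.integral_add integrable_mult_right integrable_of_real)
      (auto simp: has_bochner_integral_iff)
  also have "\<dots> = complex_of_real (LINT x|lborel. cos (s * x) * exp (- 2 * \<bar>x\<bar>))
        + \<i> * complex_of_real (LINT x|lborel. sin (s * x) * exp (- 2 * \<bar>x\<bar>))"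
    by (simp only: integral_mult_right_zero integral_complex_of_real)
  also have "\<dots> = complex_of_real (4 / (4 + s\<^sup>2))"
    using laplace_cos_integral[of s] laplace_sin_integral[of s] by (simp add: has_bochner_integral_iff)
  finally show ?thesis .
qed

lemma laplace_real_distribution:
  "real_distribution (density lborel (\<lambda>x. ennreal (exp (- 2 * \<bar>x\<bar>))))"
proof -
  have "has_bochner_integral lborel (\<lambda>x::real. exp (- 2 * \<bar>x\<bar>)) 1" using laplace_cos_integral[of 0] by simp
  then have "(\<integral>\<^sup>+x. ennreal (exp (- 2 * \<bar>x\<bar>)) \<partial>lborel) = ennreal 1"
    by (subst nn_integral_eq_integral) (auto simp: has_bochner_integral_iff)
  then have "prob_space (density lborel (\<lambda>x::real. ennreal (exp (- 2 * \<bar>x\<bar>))))"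
    by (intro prob_spaceI) (simp add: emeasure_density)
  then show ?thesis by (simp add: real_distribution_def real_distribution_axioms_def)
qed

section \<open>Convergence in distribution\<close>

lemma c_seq_properties:
  assumes e: "\<And>n. n \<ge> 1 \<Longrightarrow> 0 < \<epsilon> n" and n: "n \<ge> 1"
  shows "1 \<le> c_seq \<epsilon> n" "real n \<le> a_seq \<epsilon> (c_seq \<epsilon> n)" "a_seq \<epsilon> (c_seq \<epsilon> n) \<le> real n + 1 + 1 / \<epsilon> (c_seq \<epsilon> n)"
proof -
  have "1 \<le> n \<and> real n \<le> a_seq \<epsilon> n" using a_seq_ge[of \<epsilon> n] e n by blast
  from LeastI[of "\<lambda>i. 1 \<le> i \<and> a_seq \<epsilon> i \<ge> real n", OF this]
  show c: "1 \<le> c_seq \<epsilon> n" "real n \<le> a_seq \<epsilon> (c_seq \<epsilon> n)" unfolding c_seq_def by auto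
  then obtain i where i: "c_seq \<epsilon> n = Suc i" by (cases "c_seq \<epsilon> n") auto
  have "\<not> (1 \<le> i \<and> a_seq \<epsilon> i \<ge> real n)"
    using not_less_Least[of i "\<lambda>i. 1 \<le> i \<and> a_seq \<epsilon> i \<ge> real n"] i unfolding c_seq_def by simp
  then have "a_seq \<epsilon> i \<le> real n" by (cases "i = 0") (auto simp: a_seq_def)
  then show "a_seq \<epsilon> (c_seq \<epsilon> n) \<le> real n + 1 + 1 / \<epsilon> (c_seq \<epsilon> n)"
    unfolding i by (simp add: a_seq_def)
qed

lemma c_seq_at_top:
  assumes e: "\<And>n. n \<ge> 1 \<Longrightarrow> 0 < \<epsilon> n"
  shows "filterlim (c_seq \<epsilon>) at_top sequentially"
  unfolding filterlim_at_top
proof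
  fix Z
  have mono: "a_seq \<epsilon> i \<le> a_seq \<epsilon> Z" if "i \<le> Z" for i
  proof -
    have "real (Z - i) * 0 \<le> a_seq \<epsilon> Z - a_seq \<epsilon> i"
      by (rule a_seq_diff_ge[OF that]) (use e in \<open>simp add: less_imp_le\<close>)
    then show ?thesis by simp
  qed
  have "Z \<le> c_seq \<epsilon> n" if "real n > max 1 (a_seq \<epsilon> Z)" for n
  proof (rule ccontr)
    assume "\<not> Z \<le> c_seq \<epsilon> n"
    then have "a_seq \<epsilon> (c_seq \<epsilon> n) \<le> a_seq \<epsilon> Z" by (intro mono) simp
    moreover have "real n \<le> a_seq \<epsilon> (c_seq \<epsilon> n)" using c_seq_properties(2)[where \<epsilon> = \<epsilon> and n = n] e that by simp
    ultimately show False using that by simp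
  qed
  moreover have "\<forall>\<^sub>F n in sequentially. real n > max 1 (a_seq \<epsilon> Z)"
    using filterlim_real_sequentially unfolding filterlim_at_top_dense by blast
  ultimately show "\<forall>\<^sub>F n in sequentially. Z \<le> c_seq \<epsilon> n" by (rule eventually_mono[rotated])
qed

text \<open>
  Applies \<open>cos_error_bound\<close> with all lengths proportional to \<open>n\<close>: if the window
  changes the total mean time by the fraction \<open>z\<close>, then \<open>\<Delta> = z * n / 200\<close> and \<open>k\<close> is about \<open>72 * \<Delta>\<close>, so that \<open>k + \<Delta>\<close> stays
  well below \<open>z * n\<close>. The errors are a multiple of the freedom \<open>d\<close> in the drift, a multiple of
  \<open>\<epsilon> (c_seq \<epsilon> n)\<close>, and a multiple of \<open>\<beta> n = (B n)\<^sup>2 / n\<close>, which tends to \<open>0\<close>.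
\<close>
lemma scaled_char_tendsto:
  assumes reg: "regularly_varying \<epsilon> (- \<alpha>)" and a: "0 \<le> \<alpha>" and e1: "\<And>n. n \<ge> 1 \<Longrightarrow> 0 < \<epsilon> n \<and> \<epsilon> n < 1"
    and eps0: "\<epsilon> \<longlonglongrightarrow> 0" and div: "filterlim (\<lambda>n. real n * \<epsilon> n) at_top sequentially" and s: "s \<noteq> 0"
  shows "(\<lambda>n. (avg_step (\<lambda>j. \<epsilon> (Suc j)) ^^ n) (\<lambda>x _. cos (s * (1 / b_seq \<epsilon> n) * real x)) 0 0)
    \<longlonglongrightarrow> 4 / (4 + s\<^sup>2)"
proof -
  interpret drift_seq "\<lambda>j. \<epsilon> (Suc j)" by unfold_locales (use e1 in auto)
  have mean_time: "mean_time m = a_seq \<epsilon> m" for m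
    unfolding mean_time_def a_seq_def by (simp add: sum.distrib sum.atLeast1_atMost_eq)
  have ep: "0 < \<epsilon> n" if "n \<ge> 1" for n using e1[OF that] by simp
  define c where "c = c_seq \<epsilon>"
  define E where "E n = \<epsilon> (c n)" for n
  have c_top: "filterlim c at_top sequentially" unfolding c_def by (rule c_seq_at_top) (rule ep)
  have c1: "1 \<le> c n" "real n \<le> a_seq \<epsilon> (c n)" "a_seq \<epsilon> (c n) \<le> real n + 1 + 1 / E n" if "n \<ge> 1" for n
    unfolding c_def E_def using c_seq_properties[where \<epsilon> = \<epsilon> and n = n] ep that by auto
  have E01: "0 < E n" "E n < 1" if "n \<ge> 1" for n unfolding E_def using e1[OF c1(1)[OF that]] by auto
  have E_lim: "E \<longlonglongrightarrow> 0" unfolding E_def by (rule filterlim_compose[OF eps0 c_top])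
  have invb: "1 / b_seq \<epsilon> n = E n" for n by (simp add: b_seq_def E_def c_def)
  obtain B0 where B0: "\<And>m i. m \<ge> 1 \<Longrightarrow> 1 \<le> i \<Longrightarrow> i \<le> 2 * m \<Longrightarrow> 1 / \<epsilon> i \<le> B0 m"
    "(\<lambda>m. (B0 m)\<^sup>2 / a_seq \<epsilon> m) \<longlonglongrightarrow> 0"
    using inverse_drift_bound[OF reg a e1 div] by blast
  define B where "B n = B0 (c n)" for n
  define \<beta> where "\<beta> n = (B n)\<^sup>2 / real n" for n
  have BE: "1 / E n \<le> B n" if "n \<ge> 1" for n
    unfolding B_def E_def using B0(1)[of "c n" "c n"] c1(1)[OF that] by simp
  have B1: "1 \<le> B n" if "n \<ge> 1" for n
  proof -
    have "1 \<le> 1 / E n" using E01[OF that] by simp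
    then show ?thesis using BE[OF that] by linarith
  qed
  have \<beta>_lim: "\<beta> \<longlonglongrightarrow> 0"
  proof -
    have lim: "(\<lambda>n. (B n)\<^sup>2 / a_seq \<epsilon> (c n)) \<longlonglongrightarrow> 0"
      unfolding B_def by (rule filterlim_compose[OF B0(2) c_top])
    have "\<forall>\<^sub>F n in sequentially. (B n)\<^sup>2 / a_seq \<epsilon> (c n) < 1/4"
      using order_tendstoD(2)[OF lim, of "1/4"] by simp
    then have "\<forall>\<^sub>F n in sequentially. norm (\<beta> n) \<le> 2 * ((B n)\<^sup>2 / a_seq \<epsilon> (c n))"
      using eventually_ge_at_top[of 2]
    proof eventually_elim
      case (elim n)
      have n: "n \<ge> 1" using elim by simp
      have ac: "0 < a_seq \<epsilon> (c n)" using c1(2)[OF n] n by linarith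
      have "B n * 1 \<le> B n * B n" using B1[OF n] by (intro mult_left_mono) auto
      then have "B n \<le> (B n)\<^sup>2" by (simp add: power2_eq_square)
      also have "\<dots> \<le> a_seq \<epsilon> (c n) / 4" using elim(1) ac by (simp add: pos_divide_less_eq)
      finally have "a_seq \<epsilon> (c n) \<le> real n + 1 + a_seq \<epsilon> (c n) / 4" using c1(3)[OF n] BE[OF n] by linarith
      then have "a_seq \<epsilon> (c n) \<le> 2 * real n" using elim(2) by linarith
      then have "(B n)\<^sup>2 / (2 * real n) \<le> (B n)\<^sup>2 / a_seq \<epsilon> (c n)"
        using ac n by (intro divide_left_mono) auto
      then show ?case using n by (simp add: \<beta>_def field_simps)
    qed
    moreover have "(\<lambda>n. 2 * ((B n)\<^sup>2 / a_seq \<epsilon> (c n))) \<longlonglongrightarrow> 0" using lim by (rule tendsto_mult_right_zero)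
    ultimately show ?thesis by (rule Lim_null_comparison)
  qed
  have B_small: "1 + B n \<le> 2 * \<beta> n * real n" if "n \<ge> 1" for n
  proof -
    have "B n * 1 \<le> B n * B n" "1 * 1 \<le> B n * B n" using B1[OF that] by (intro mult_mono; simp)+
    then show ?thesis using that by (simp add: \<beta>_def power2_eq_square)
  qed
  define err where "err n = \<bar>(Q ^^ n) (\<lambda>x _. cos (s * E n * real x)) 0 0 - stat_cos (E n) (s * E n)\<bar>" for n
  have err_lim: "err \<longlonglongrightarrow> 0"
  proof (rule tendstoI)
    fix \<gamma> :: real assume \<gamma>: "\<gamma> > 0"
    define d where "d = min (1/4) (\<gamma> / (400 * (\<bar>s\<bar> + 1)))"
    have d: "0 < d" "d \<le> 1/4" "192 * d * \<bar>s\<bar> < \<gamma> / 2"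
    proof -
      show "0 < d" using \<gamma> by (simp add: d_def)
      show "d \<le> 1/4" unfolding d_def by (rule min.cobounded1)
      have "d \<le> \<gamma> / (400 * (\<bar>s\<bar> + 1))" by (simp add: d_def)
      then have "400 * (d * (\<bar>s\<bar> + 1)) \<le> \<gamma>" by (simp add: pos_le_divide_eq mult_ac)
      moreover have "d * \<bar>s\<bar> \<le> d * (\<bar>s\<bar> + 1)" using \<open>0 < d\<close> by (intro mult_left_mono) auto
      ultimately show "192 * d * \<bar>s\<bar> < \<gamma> / 2" using \<gamma> by linarith
    qed
    have d1: "d \<le> 1" using d(2) by simp
    obtain z where z: "0 < z" "z \<le> 1" and win: "\<forall>\<^sub>F m in sequentially. \<exists>h. 0 < h \<and> 2 * h \<le> m \<and>
      (\<forall>i. m - h \<le> i \<longrightarrow> i \<le> m + h \<longrightarrow> \<bar>\<epsilon> i - \<epsilon> m\<bar> \<le> d * \<epsilon> m) \<and>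
      (1 + z) * a_seq \<epsilon> m \<le> a_seq \<epsilon> (m + h) \<and> a_seq \<epsilon> (m - h) \<le> (1 - z) * a_seq \<epsilon> m"
      using excursion_window[OF reg a _ d(1) d1] e1 by blast
    \<comment> \<open>\<open>56 * 46 \<le> 2600\<close> for the mixing error and \<open>8 * 200\<^sup>2 = 320000\<close> for Chebyshev's bound\<close>
    define K where "K = 2600 * \<bar>s\<bar> / z + 320000 / z\<^sup>2"
    have win_c: "\<forall>\<^sub>F n in sequentially. \<exists>h. 0 < h \<and> 2 * h \<le> c n \<and>
      (\<forall>i. c n - h \<le> i \<longrightarrow> i \<le> c n + h \<longrightarrow> \<bar>\<epsilon> i - E n\<bar> \<le> d * E n) \<and>
      (1 + z) * a_seq \<epsilon> (c n) \<le> a_seq \<epsilon> (c n + h) \<and> a_seq \<epsilon> (c n - h) \<le> (1 - z) * a_seq \<epsilon> (c n)"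
      unfolding E_def using win c_top unfolding filterlim_iff by blast
    have "\<forall>\<^sub>F n in sequentially. \<beta> n < z / 400" using order_tendstoD(2)[OF \<beta>_lim, of "z / 400"] z by simp
    moreover have "\<forall>\<^sub>F n in sequentially. \<bar>s\<bar> * E n < 3"
    proof -
      have "(\<lambda>n. \<bar>s\<bar> * E n) \<longlonglongrightarrow> 0" using E_lim by (rule tendsto_mult_right_zero)
      then show ?thesis by (rule order_tendstoD(2)) simp
    qed
    moreover have "\<forall>\<^sub>F n in sequentially. 2 * \<bar>s\<bar> * E n + K * \<beta> n < \<gamma> / 2"
    proof -
      have "(\<lambda>n. 2 * \<bar>s\<bar> * E n + K * \<beta> n) \<longlonglongrightarrow> 2 * \<bar>s\<bar> * 0 + K * 0"
        by (intro tendsto_intros E_lim \<beta>_lim)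
      then show ?thesis using \<gamma> by (intro order_tendstoD(2)) auto
    qed
    moreover have "\<forall>\<^sub>F n in sequentially. real n \<ge> 100 / z"
      using filterlim_real_sequentially unfolding filterlim_at_top by blast
    ultimately show "\<forall>\<^sub>F n in sequentially. dist (err n) 0 < \<gamma>"
      using win_c eventually_ge_at_top[of 1]
    proof eventually_elim
      case (elim n)
      have n: "n \<ge> 1" by fact
      obtain h where h: "0 < h" "2 * h \<le> c n"
        and hw: "\<And>i. c n - h \<le> i \<Longrightarrow> i \<le> c n + h \<Longrightarrow> \<bar>\<epsilon> i - E n\<bar> \<le> d * E n"
        and up: "(1 + z) * a_seq \<epsilon> (c n) \<le> a_seq \<epsilon> (c n + h)"
        and dn: "a_seq \<epsilon> (c n - h) \<le> (1 - z) * a_seq \<epsilon> (c n)"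
        using elim(5) by blast
      define \<Delta> where "\<Delta> = z * real n / 200"
      define k where "k = nat \<lceil>72 * \<Delta>\<rceil>"
      define t where "t = n - k"
      have zn: "100 \<le> z * real n" using elim(4) z by (simp add: pos_divide_le_eq mult.commute)
      have \<Delta>0: "\<Delta> > 0" using zn by (simp add: \<Delta>_def)
      have k: "72 * \<Delta> \<le> real k" "real k \<le> 72 * \<Delta> + 1" using \<Delta>0 unfolding k_def by linarith+
      have znn: "z * real n \<le> real n" using z n by simp
      have "real k \<le> real n" using k(2) zn znn unfolding \<Delta>_def by linarith
      then have tk: "t + k = n" "real t = real n - real k" unfolding t_def by auto
      have \<Delta>B: "1 + B n \<le> \<Delta>"
      proof -
        have "2 * \<beta> n * real n \<le> 2 * (z / 400) * real n" using elim(1) by (intro mult_right_mono) auto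
        then show ?thesis using B_small[OF n] unfolding \<Delta>_def by simp
      qed
      have ac: "a_seq \<epsilon> (c n) \<le> real n + \<Delta>" using c1(3)[OF n] BE[OF n] \<Delta>B by linarith
      have "a_seq \<epsilon> (c n - h) \<le> (1 - z) * (real n + \<Delta>)"
        using dn ac z by (meson diff_ge_0_iff_ge mult_left_mono order_trans)
      also have "\<dots> = real n + \<Delta> - z * real n - z * \<Delta>" by (simp add: algebra_simps)
      also have "\<dots> \<le> real n - z * real n + \<Delta>" using z \<Delta>0 by simp
      finally have low: "mean_time (c n - h) \<le> real t - \<Delta>"
        unfolding mean_time tk(2) using k(2) zn unfolding \<Delta>_def by linarith
      have "(1 + z) * real n \<le> (1 + z) * a_seq \<epsilon> (c n)" using c1(2)[OF n] z by (intro mult_left_mono) auto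
      then have high: "real (t + k) + \<Delta> \<le> mean_time (c n + h)"
        unfolding mean_time tk(1) using up zn unfolding \<Delta>_def by (simp add: algebra_simps)
      have sn: "sin (s * E n) \<noteq> 0"
      proof
        assume sin0: "sin (s * E n) = 0"
        have "\<bar>s * E n\<bar> < pi"
        proof -
          have "\<bar>s * E n\<bar> = \<bar>s\<bar> * E n" using E01(1)[OF n] by (simp add: abs_mult)
          then show ?thesis using elim(2) pi_gt3 by linarith
        qed
        then have "- pi < s * E n" "s * E n < pi" by linarith+
        then have "s * E n = 0" using sin0 by (rule sin_eq_0_pi)
        then show False using s E01(1)[OF n] by simp
      qed
      have "\<bar>(Q ^^ (t + k)) (\<lambda>x _. cos (s * E n * real x)) 0 0 - stat_cos (E n) (s * E n)\<bar>
          \<le> 192 * d * \<bar>s\<bar> + 2 * \<bar>s\<bar> * E n + 56 * \<bar>s\<bar> * exp (- ((E n)\<^sup>2 * real k / 16))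
            + 8 * (real (t + k) * (B n)\<^sup>2 / \<Delta>\<^sup>2)"
      proof (rule cos_error_bound[where m = "c n - h" and m' = "c n + h"])
        show "\<bar>\<epsilon> (Suc j) - E n\<bar> \<le> d * E n" if "c n - h \<le> j" "j < c n + h" for j
          using hw[of "Suc j"] that by simp
        show "1 / \<epsilon> (Suc i) \<le> B n" if "i < c n + h" for i
          unfolding B_def using B0(1)[of "c n" "Suc i"] c1(1)[OF n] that h by simp
      qed (use E01[OF n] d sn B1[OF n] \<Delta>B k low high in auto)
      then have bound: "err n \<le> 192 * d * \<bar>s\<bar> + 2 * \<bar>s\<bar> * E n + 56 * \<bar>s\<bar> * exp (- ((E n)\<^sup>2 * real k / 16))
            + 8 * (real n * (B n)\<^sup>2 / \<Delta>\<^sup>2)"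
        unfolding tk(1) err_def .
      have \<beta>_pos: "\<beta> n > 0" using B1[OF n] n by (simp add: \<beta>_def)
      have "exp (- ((E n)\<^sup>2 * real k / 16)) \<le> 46 / z * \<beta> n"
      proof -
        define y where "y = (E n)\<^sup>2 * real k / 16"
        have EB: "1 \<le> E n * B n" using BE[OF n] E01(1)[OF n] by (simp add: pos_divide_le_eq mult.commute)
        then have "1 * 1 \<le> (E n * B n) * (E n * B n)" by (intro mult_mono) auto
        then have 1: "1 \<le> (E n)\<^sup>2 * (B n)\<^sup>2" by (simp add: power2_eq_square mult_ac)
        have "z * real n / 46 \<le> real k / 16" using k(1) zn unfolding \<Delta>_def by linarith
        then have "1 * (z * real n / 46) \<le> ((E n)\<^sup>2 * (B n)\<^sup>2) * (real k / 16)"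
          using 1 z n by (intro mult_mono) auto
        then have 2: "z / 46 \<le> \<beta> n * y" using n by (simp add: \<beta>_def y_def field_simps)
        then have y: "y > 0" using z \<beta>_pos by (smt (verit) divide_pos_pos zero_less_mult_pos)
        have "exp (- y) \<le> 1 / y"
        proof -
          have "y \<le> exp y" using exp_ge_add_one_self[of y] by linarith
          then show ?thesis using y by (simp add: exp_minus field_simps)
        qed
        also have "1 / y \<le> 46 / z * \<beta> n" using 2 y z by (simp add: field_simps)
        finally show ?thesis by (simp add: y_def)
      qed
      then have "56 * \<bar>s\<bar> * exp (- ((E n)\<^sup>2 * real k / 16)) \<le> 56 * \<bar>s\<bar> * (46 / z * \<beta> n)"
        by (intro mult_left_mono) auto
      also have "\<dots> \<le> 2600 * \<bar>s\<bar> / z * \<beta> n"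
      proof -
        have "2576 * (\<bar>s\<bar> / z * \<beta> n) \<le> 2600 * (\<bar>s\<bar> / z * \<beta> n)" using z \<beta>_pos by (intro mult_right_mono) auto
        then show ?thesis by simp
      qed
      moreover have "8 * (real n * (B n)\<^sup>2 / \<Delta>\<^sup>2) = 320000 / z\<^sup>2 * \<beta> n"
        using n z by (simp add: \<Delta>_def \<beta>_def power2_eq_square field_simps)
      ultimately have "err n \<le> 192 * d * \<bar>s\<bar> + 2 * \<bar>s\<bar> * E n + (2600 * \<bar>s\<bar> / z * \<beta> n + 320000 / z\<^sup>2 * \<beta> n)"
        using bound by linarith
      also have "2600 * \<bar>s\<bar> / z * \<beta> n + 320000 / z\<^sup>2 * \<beta> n = K * \<beta> n" by (simp add: K_def distrib_right)
      finally have "err n < \<gamma>" using d(3) elim(3) by linarith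
      then show ?case by (simp add: err_def)
    qed
  qed
  have E_pos: "\<forall>\<^sub>F n in sequentially. 0 < E n"
    using eventually_ge_at_top[of 1] by eventually_elim (rule E01)
  have "(\<lambda>n. (Q ^^ n) (\<lambda>x _. cos (s * E n * real x)) 0 0 - stat_cos (E n) (s * E n)) \<longlonglongrightarrow> 0"
    using err_lim unfolding err_def by (rule tendsto_rabs_zero_cancel)
  from tendsto_add[OF this stat_cos_tendsto[OF s E_lim E_pos]]
  show ?thesis unfolding invb by simp
qed

theorem theorem5:
  fixes \<alpha> :: real and \<epsilon> :: "nat \<Rightarrow> real"
    and M :: "'w measure" and X :: "nat \<Rightarrow> 'w \<Rightarrow> int"
  assumes "0 \<le> \<alpha>" and "\<alpha> \<le> 1"
    and "\<And>n. n \<ge> 1 \<Longrightarrow> 0 < \<epsilon> n \<and> \<epsilon> n < 1"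
    and "regularly_varying \<epsilon> (- \<alpha>)"
    and "\<alpha> = 0 \<Longrightarrow> \<epsilon> \<longlonglongrightarrow> 0"
    and "\<alpha> = 1 \<Longrightarrow> filterlim (\<lambda>n. real n * \<epsilon> n / ln (real n)) at_top sequentially"
    and "drift_walk M \<epsilon> X"
  shows "weak_conv_m (\<lambda>n. distr M borel (\<lambda>\<omega>. real_of_int (X n \<omega>) / b_seq \<epsilon> n))
           (density lborel (\<lambda>x. ennreal (exp (- 2 * \<bar>x\<bar>))))"
proof (rule levy_continuity)
  interpret prob_space M using assms(7) by (simp add: drift_walk_def is_markov_chain_def)
  have "(\<lambda>\<omega>. (X n \<omega>, eta X n \<omega>)) \<in> measurable M (count_space UNIV)" for n
    using assms(7) by (simp add: drift_walk_def is_markov_chain_def)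
  from measurable_compose[OF this, of "\<lambda>p. real_of_int (fst p)" borel]
  have [measurable]: "(\<lambda>\<omega>. real_of_int (X n \<omega>)) \<in> borel_measurable M" for n by simp
  show "real_distribution (distr M borel (\<lambda>\<omega>. real_of_int (X n \<omega>) / b_seq \<epsilon> n))" for n
    by (rule real_distribution_distr) simp
  show "real_distribution (density lborel (\<lambda>x. ennreal (exp (- 2 * \<bar>x\<bar>))))"
    by (rule laplace_real_distribution)
  have eps0: "\<epsilon> \<longlonglongrightarrow> 0"
    using assms(1,5) drift_tendsto_0[OF assms(4)] by (cases "\<alpha> = 0") auto
  have div: "filterlim (\<lambda>n. real n * \<epsilon> n) at_top sequentially"
  proof (cases "\<alpha> = 1")
    case True
    have "\<forall>\<^sub>F n in sequentially. real n * \<epsilon> n / ln (real n) \<le> real n * \<epsilon> n"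
      using eventually_ge_at_top[of 3]
    proof eventually_elim
      case (elim n)
      have "exp 1 \<le> real n" using exp_le elim by linarith
      then have "1 \<le> ln (real n)" using elim by (subst ln_ge_iff) auto
      moreover have "0 \<le> real n * \<epsilon> n" using assms(3)[of n] elim by simp
      ultimately show ?case by (simp add: pos_divide_le_eq mult_le_cancel_left1)
    qed
    then show ?thesis by (rule filterlim_at_top_mono[OF assms(6)[OF True]])
  next
    case False
    then show ?thesis using assms(2) scaled_drift_diverges[OF assms(4)] by simp
  qed
  show "(\<lambda>n. char (distr M borel (\<lambda>\<omega>. real_of_int (X n \<omega>) / b_seq \<epsilon> n)) s)
      \<longlonglongrightarrow> char (density lborel (\<lambda>x. ennreal (exp (- 2 * \<bar>x\<bar>)))) s" for s
  proof -
    have walk: "char (distr M borel (\<lambda>\<omega>. real_of_int (X n \<omega>) / b_seq \<epsilon> n)) s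
      = complex_of_real ((avg_step (\<lambda>j. \<epsilon> (Suc j)) ^^ n) (\<lambda>x _. cos (s * (1 / b_seq \<epsilon> n) * real x)) 0 0)" for n
      by (rule drift_walk_char) (use assms(3,7) in auto)
    have "(\<lambda>n. (avg_step (\<lambda>j. \<epsilon> (Suc j)) ^^ n) (\<lambda>x _. cos (s * (1 / b_seq \<epsilon> n) * real x)) 0 0)
        \<longlonglongrightarrow> 4 / (4 + s\<^sup>2)"
    proof (cases "s = 0")
      case False
      then show ?thesis
        by (intro scaled_char_tendsto[where \<alpha> = \<alpha>]) (use assms eps0 div in auto)
    qed simp
    then show ?thesis unfolding walk laplace_char by (rule tendsto_of_real)
  qed
qed

end
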